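(* There exists an isomorphism of categories $$\mathsf{St}(\mathbf{Span}(\mathbf{Set})) \;\cong\; \mathbf{Span}(\mathbf{Graph})_{\ast}.$$ That is, the free feedback category $\mathsf{St}(\mathbf{Span}(\mathbf{Set}))$ over $\mathbf{Span}(\mathbf{Set})$ is isomorphic to the full subcategory of $\mathbf{Span}(\mathbf{Graph})$ given by single-vertex graphs.
   Context: Composition $f ; g$ is written in diagrammatic order; associators and unitors are suppressed. **Spans.** For a category $\mathbf{C}$ with finite limits, $\mathbf{Span}(\mathbf{C})$ has the objects of $\mathbf{C}$; a morphism $A\to B$ is an isomorphism class of spans $A \xleftarrow{f} E \xrightarrow{g} B$ (two spans are equal if there is an isomorphism between their heads commuting with both legs). Composition is by pullback. It is symmetric monoidal with tensor given by the cartesian product of $\mathbf{C}$ on objects and componentwise on spans. **Graphs.** An object of $\mathbf{Graph}$ is a pair of functions $s,t\colon E\rightrightarrows V$ (source and target); a morphism $(e,v)$ consists of functions $e\colon E\to E'$, $v\colon V\to V'$ with $e;s'=s;v$ and $e;t'=t;v$. $\mathbf{Span}(\mathbf{Graph})_{\ast}$ is the full subcategory of $\mathbf{Span}(\mathbf{Graph})$ on the single-vertex graphs $(A\rightrightarrows 1)$, where $A$ is a set and $1$ is the (chosen) one-point set; its tensor is the product of graphs, $(A \rightrightarrows 1)\otimes(B\rightrightarrows 1) = (A\times B\rightrightarrows 1)$. **Stateful processes.** For a symmetric monoidal category $(\mathbf{C},\otimes,I)$ with symmetry $\sigma$, $\mathsf{St}(\mathbf{C})$ has the objects of $\mathbf{C}$;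 a morphism $A\to B$ is a pair $(S\mid f)$ with $S\in\mathbf{C}$ and $f\colon S\otimes A\to S\otimes B$, modulo $(S\mid f) = (T\mid (h^{-1}\otimes \mathrm{id});f;(h\otimes \mathrm{id}))$ for every isomorphism $h\colon S\cong T$ of $\mathbf{C}$. The identity on $A$ is $(I\mid \mathrm{id}_{I\otimes A})$. Sequential composition of $(S\mid f)\colon A\to B$ and $(T\mid g)\colon B\to C$ is $(S\otimes T\mid (\sigma_{S,T}\otimes \mathrm{id}_A);(\mathrm{id}_T\otimes f);(\sigma_{T,S}\otimes \mathrm{id}_B);(\mathrm{id}_S\otimes g))$. The tensor of $(S\mid f)\colon A\to B$ and $(S'\mid f')\colon A'\to B'$ is $(S\otimes S'\mid (\mathrm{id}\otimes\sigma\otimes \mathrm{id});(f\otimes f');(\mathrm{id}\otimes\sigma\otimes \mathrm{id}))$. With the operator $\mathsf{store}_T(S\mid f) = (S\otimes T\mid f)$ for $f \colon S\otimes T\otimes A\to S\otimes T\otimes B$, $\mathsf{St}(\mathbf{C})$ is a feedback category, and by a known theorem of Katis, Sabadini and Walters it is the free feedback category over $\mathbf{C}$; "the free feedback category over $\mathbf{C}$" refers to this category. **Isomorphism of categories.** An isomorphism between symmetric monoidal categories means a symmetric strong monoidal functor that is fully faithful and bijective on objects. *)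

theory Defs
  imports "HOL-Library.FuncSet"
begin

section \<open>Categories\<close>

text \<open>Arrows carry their domain and codomain. Composition is in diagrammatic order.\<close>

record ('o, 'm) cat_data =
  Ob :: "'o set"
  Arr :: "'m set"
  Dom :: "'m \<Rightarrow> 'o"
  Cod :: "'m \<Rightarrow> 'o"
  Id :: "'o \<Rightarrow> 'm"
  Comp :: "'m \<Rightarrow> 'm \<Rightarrow> 'm"  (infixl "\<Zcomp>\<index>" 60)

definition Hom :: "('o, 'm, 'z) cat_data_scheme \<Rightarrow> 'o \<Rightarrow> 'o \<Rightarrow> 'm set" where
  "Hom C A B = {f \<in> Arr C. Dom C f = A \<and> Cod C f = B}"

definition Isos :: "('o, 'm, 'z) cat_data_scheme \<Rightarrow> 'o \<Rightarrow> 'o \<Rightarrow> 'm set" where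
  "Isos C A B = {h \<in> Hom C A B. \<exists>k \<in> Hom C B A. h \<Zcomp> k = Id C A \<and> k \<Zcomp> h = Id C B}"
  for C (structure)

definition Inv :: "('o, 'm, 'z) cat_data_scheme \<Rightarrow> 'm \<Rightarrow> 'm" where
  "Inv C h = (THE k. k \<in> Hom C (Cod C h) (Dom C h) \<and>
     h \<Zcomp> k = Id C (Dom C h) \<and> k \<Zcomp> h = Id C (Cod C h))"
  for C (structure)

locale cat =
  fixes C :: "('o, 'm, 'z) cat_data_scheme" (structure)
  assumes Dom_in_Ob: "f \<in> Arr C \<Longrightarrow> Dom C f \<in> Ob C"
    and Cod_in_Ob: "f \<in> Arr C \<Longrightarrow> Cod C f \<in> Ob C"
    and Id_in_Hom: "A \<in> Ob C \<Longrightarrow> Id C A \<in> Hom C A A"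
    and Comp_in_Hom: "f \<in> Hom C A B \<Longrightarrow> g \<in> Hom C B D \<Longrightarrow> f \<Zcomp> g \<in> Hom C A D"
    and Id_left: "f \<in> Hom C A B \<Longrightarrow> Id C A \<Zcomp> f = f"
    and Id_right: "f \<in> Hom C A B \<Longrightarrow> f \<Zcomp> Id C B = f"
    and Comp_assoc: "f \<in> Hom C A B \<Longrightarrow> g \<in> Hom C B D \<Longrightarrow> h \<in> Hom C D E \<Longrightarrow>
      (f \<Zcomp> g) \<Zcomp> h = f \<Zcomp> (g \<Zcomp> h)"

definition full_sub :: "('o, 'm) cat_data \<Rightarrow> 'o set \<Rightarrow> ('o, 'm) cat_data" where
  "full_sub C X = C\<lparr>Ob := X, Arr := {f \<in> Arr C. Dom C f \<in> X \<and> Cod C f \<in> X}\<rparr>"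

section \<open>Symmetric monoidal categories\<close>

record ('o, 'm) smc_data = "('o, 'm) cat_data" +
  Ten :: "'o \<Rightarrow> 'o \<Rightarrow> 'o"  (infixr "\<odot>\<index>" 75)
  TenA :: "'m \<Rightarrow> 'm \<Rightarrow> 'm"  (infixr "\<otimes>\<index>" 75)
  Unit :: 'o  ("\<one>\<index>")
  Assoc :: "'o \<Rightarrow> 'o \<Rightarrow> 'o \<Rightarrow> 'm"  ("\<alpha>\<index>")
  LUnit :: "'o \<Rightarrow> 'm"  ("\<l>\<index>")
  RUnit :: "'o \<Rightarrow> 'm"  ("\<r>\<index>")
  Sym :: "'o \<Rightarrow> 'o \<Rightarrow> 'm"  ("\<sigma>\<index>")

locale symmetric_monoidal_category = cat M
  for M :: "('o, 'm, 'z) smc_data_scheme" (structure) +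
  assumes Unit_in_Ob: "\<one> \<in> Ob M"
    and Ten_in_Ob: "A \<in> Ob M \<Longrightarrow> B \<in> Ob M \<Longrightarrow> A \<odot> B \<in> Ob M"
    and TenA_in_Hom: "f \<in> Hom M A B \<Longrightarrow> f' \<in> Hom M A' B' \<Longrightarrow> f \<otimes> f' \<in> Hom M (A \<odot> A') (B \<odot> B')"
    and TenA_Id: "A \<in> Ob M \<Longrightarrow> B \<in> Ob M \<Longrightarrow> Id M A \<otimes> Id M B = Id M (A \<odot> B)"
    and TenA_Comp: "f \<in> Hom M A B \<Longrightarrow> g \<in> Hom M B D \<Longrightarrow> f' \<in> Hom M A' B' \<Longrightarrow> g' \<in> Hom M B' D' \<Longrightarrow>
      (f \<Zcomp> g) \<otimes> (f' \<Zcomp> g') = (f \<otimes> f') \<Zcomp> (g \<otimes> g')"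
    and Assoc_iso: "A \<in> Ob M \<Longrightarrow> B \<in> Ob M \<Longrightarrow> D \<in> Ob M \<Longrightarrow>
      \<alpha> A B D \<in> Isos M ((A \<odot> B) \<odot> D) (A \<odot> (B \<odot> D))"
    and LUnit_iso: "A \<in> Ob M \<Longrightarrow> \<l> A \<in> Isos M (\<one> \<odot> A) A"
    and RUnit_iso: "A \<in> Ob M \<Longrightarrow> \<r> A \<in> Isos M (A \<odot> \<one>) A"
    and Sym_in_Hom: "A \<in> Ob M \<Longrightarrow> B \<in> Ob M \<Longrightarrow> \<sigma> A B \<in> Hom M (A \<odot> B) (B \<odot> A)"
    and Assoc_nat: "f \<in> Hom M A A' \<Longrightarrow> g \<in> Hom M B B' \<Longrightarrow> h \<in> Hom M D D' \<Longrightarrow>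
      ((f \<otimes> g) \<otimes> h) \<Zcomp> \<alpha> A' B' D' = \<alpha> A B D \<Zcomp> (f \<otimes> (g \<otimes> h))"
    and LUnit_nat: "f \<in> Hom M A B \<Longrightarrow> (Id M \<one> \<otimes> f) \<Zcomp> \<l> B = \<l> A \<Zcomp> f"
    and RUnit_nat: "f \<in> Hom M A B \<Longrightarrow> (f \<otimes> Id M \<one>) \<Zcomp> \<r> B = \<r> A \<Zcomp> f"
    and Sym_nat: "f \<in> Hom M A A' \<Longrightarrow> g \<in> Hom M B B' \<Longrightarrow>
      (f \<otimes> g) \<Zcomp> \<sigma> A' B' = \<sigma> A B \<Zcomp> (g \<otimes> f)"
    and pentagon: "A \<in> Ob M \<Longrightarrow> B \<in> Ob M \<Longrightarrow> D \<in> Ob M \<Longrightarrow> E \<in> Ob M \<Longrightarrow>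
      (\<alpha> A B D \<otimes> Id M E) \<Zcomp> \<alpha> A (B \<odot> D) E \<Zcomp> (Id M A \<otimes> \<alpha> B D E)
        = \<alpha> (A \<odot> B) D E \<Zcomp> \<alpha> A B (D \<odot> E)"
    and triangle: "A \<in> Ob M \<Longrightarrow> B \<in> Ob M \<Longrightarrow>
      \<alpha> A \<one> B \<Zcomp> (Id M A \<otimes> \<l> B) = \<r> A \<otimes> Id M B"
    and hexagon: "A \<in> Ob M \<Longrightarrow> B \<in> Ob M \<Longrightarrow> D \<in> Ob M \<Longrightarrow>
      \<alpha> A B D \<Zcomp> \<sigma> A (B \<odot> D) \<Zcomp> \<alpha> B D A
        = (\<sigma> A B \<otimes> Id M D) \<Zcomp> \<alpha> B A D \<Zcomp> (Id M B \<otimes> \<sigma> A D)"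
    and Sym_Sym: "A \<in> Ob M \<Longrightarrow> B \<in> Ob M \<Longrightarrow> \<sigma> A B \<Zcomp> \<sigma> B A = Id M (A \<odot> B)"

locale symmetric_strong_monoidal_functor =
  M: symmetric_monoidal_category M + N: symmetric_monoidal_category N
  for M :: "('o, 'm, 'y) smc_data_scheme" (structure)
    and N :: "('p, 'n, 'z) smc_data_scheme" (structure) +
  fixes Fo :: "'o \<Rightarrow> 'p" and Fa :: "'m \<Rightarrow> 'n"
    and \<phi> :: "'o \<Rightarrow> 'o \<Rightarrow> 'n" and \<epsilon> :: 'n
  assumes Fo_in_Ob: "A \<in> Ob M \<Longrightarrow> Fo A \<in> Ob N"
    and Fa_in_Hom: "f \<in> Hom M A B \<Longrightarrow> Fa f \<in> Hom N (Fo A) (Fo B)"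
    and Fa_Id: "A \<in> Ob M \<Longrightarrow> Fa (Id M A) = Id N (Fo A)"
    and Fa_Comp: "f \<in> Hom M A B \<Longrightarrow> g \<in> Hom M B D \<Longrightarrow> Fa (f \<Zcomp> g) = Fa f \<Zcomp>\<^bsub>N\<^esub> Fa g"
    and phi_iso: "A \<in> Ob M \<Longrightarrow> B \<in> Ob M \<Longrightarrow> \<phi> A B \<in> Isos N (Fo A \<odot>\<^bsub>N\<^esub> Fo B) (Fo (A \<odot> B))"
    and eps_iso: "\<epsilon> \<in> Isos N \<one>\<^bsub>N\<^esub> (Fo \<one>)"
    and phi_nat: "f \<in> Hom M A A' \<Longrightarrow> g \<in> Hom M B B' \<Longrightarrow>
      (Fa f \<otimes>\<^bsub>N\<^esub> Fa g) \<Zcomp>\<^bsub>N\<^esub> \<phi> A' B' = \<phi> A B \<Zcomp>\<^bsub>N\<^esub> Fa (f \<otimes> g)"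
    and phi_Assoc: "A \<in> Ob M \<Longrightarrow> B \<in> Ob M \<Longrightarrow> D \<in> Ob M \<Longrightarrow>
      (\<phi> A B \<otimes>\<^bsub>N\<^esub> Id N (Fo D)) \<Zcomp>\<^bsub>N\<^esub> \<phi> (A \<odot> B) D \<Zcomp>\<^bsub>N\<^esub> Fa (\<alpha> A B D)
        = \<alpha>\<^bsub>N\<^esub> (Fo A) (Fo B) (Fo D) \<Zcomp>\<^bsub>N\<^esub> (Id N (Fo A) \<otimes>\<^bsub>N\<^esub> \<phi> B D) \<Zcomp>\<^bsub>N\<^esub> \<phi> A (B \<odot> D)"
    and phi_LUnit: "A \<in> Ob M \<Longrightarrow>
      (\<epsilon> \<otimes>\<^bsub>N\<^esub> Id N (Fo A)) \<Zcomp>\<^bsub>N\<^esub> \<phi> \<one> A \<Zcomp>\<^bsub>N\<^esub> Fa (\<l> A) = \<l>\<^bsub>N\<^esub> (Fo A)"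
    and phi_RUnit: "A \<in> Ob M \<Longrightarrow>
      (Id N (Fo A) \<otimes>\<^bsub>N\<^esub> \<epsilon>) \<Zcomp>\<^bsub>N\<^esub> \<phi> A \<one> \<Zcomp>\<^bsub>N\<^esub> Fa (\<r> A) = \<r>\<^bsub>N\<^esub> (Fo A)"
    and phi_Sym: "A \<in> Ob M \<Longrightarrow> B \<in> Ob M \<Longrightarrow>
      \<phi> A B \<Zcomp>\<^bsub>N\<^esub> Fa (\<sigma> A B) = \<sigma>\<^bsub>N\<^esub> (Fo A) (Fo B) \<Zcomp>\<^bsub>N\<^esub> \<phi> B A"

locale symmetric_monoidal_isomorphism = symmetric_strong_monoidal_functor +
  assumes fully_faithful: "A \<in> Ob M \<Longrightarrow> B \<in> Ob M \<Longrightarrow>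
      bij_betw Fa (Hom M A B) (Hom N (Fo A) (Fo B))"
    and bij_Ob: "bij_betw Fo (Ob M) (Ob N)"

section \<open>Spans\<close>

definition is_pullback :: "('o, 'm, 'z) cat_data_scheme \<Rightarrow> 'm \<Rightarrow> 'm \<Rightarrow> 'm \<Rightarrow> 'm \<Rightarrow> bool" where
  "is_pullback C f g p q \<longleftrightarrow>
     f \<in> Arr C \<and> g \<in> Arr C \<and> Cod C f = Cod C g \<and>
     p \<in> Hom C (Dom C p) (Dom C f) \<and> q \<in> Hom C (Dom C p) (Dom C g) \<and> p \<Zcomp> f = q \<Zcomp> g \<and>
     (\<forall>Z. \<forall>a \<in> Hom C Z (Dom C f). \<forall>b \<in> Hom C Z (Dom C g). a \<Zcomp> f = b \<Zcomp> g \<longrightarrow>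
        (\<exists>!u. u \<in> Hom C Z (Dom C p) \<and> u \<Zcomp> p = a \<and> u \<Zcomp> q = b))"
  for C (structure)

definition is_product :: "('o, 'm, 'z) cat_data_scheme \<Rightarrow> 'o \<Rightarrow> 'o \<Rightarrow> 'm \<Rightarrow> 'm \<Rightarrow> bool" where
  "is_product C A B p q \<longleftrightarrow>
     p \<in> Hom C (Dom C p) A \<and> q \<in> Hom C (Dom C p) B \<and>
     (\<forall>Z. \<forall>a \<in> Hom C Z A. \<forall>b \<in> Hom C Z B.
        (\<exists>!u. u \<in> Hom C Z (Dom C p) \<and> u \<Zcomp> p = a \<and> u \<Zcomp> q = b))"
  for C (structure)

text \<open>A span \<open>A \<leftarrow> E \<rightarrow> B\<close> is the pair of its legs. A morphism of the category of spans is
  a triple \<open>(A, B, X)\<close> with \<open>X\<close> an isomorphism class of spans.\<close>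

definition spans :: "('o, 'm, 'z) cat_data_scheme \<Rightarrow> 'o \<Rightarrow> 'o \<Rightarrow> ('m \<times> 'm) set" where
  "spans C A B = {(f, g). \<exists>E. f \<in> Hom C E A \<and> g \<in> Hom C E B}"

definition span_rel :: "('o, 'm, 'z) cat_data_scheme \<Rightarrow> 'o \<Rightarrow> 'o \<Rightarrow> (('m \<times> 'm) \<times> ('m \<times> 'm)) set" where
  "span_rel C A B = {((f, g), (f', g')). (f, g) \<in> spans C A B \<and> (f', g') \<in> spans C A B \<and>
     (\<exists>h \<in> Isos C (Dom C f) (Dom C f'). h \<Zcomp> f' = f \<and> h \<Zcomp> g' = g)}"
  for C (structure)

type_synonym ('o, 'm) span_arr = "'o \<times> 'o \<times> ('m \<times> 'm) set"

text \<open>The composite class consists of all composites formed with any representatives and any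
  pullback, so that no choice of pullbacks is involved.\<close>

definition span_cat :: "('o, 'm, 'z) cat_data_scheme \<Rightarrow> ('o, ('o, 'm) span_arr) cat_data" where
  "span_cat C = \<lparr>
     Ob = Ob C,
     Arr = {(A, B, X). A \<in> Ob C \<and> B \<in> Ob C \<and> X \<in> spans C A B // span_rel C A B},
     Dom = (\<lambda>(A, B, X). A),
     Cod = (\<lambda>(A, B, X). B),
     Id = (\<lambda>A. (A, A, span_rel C A A `` {(Id C A, Id C A)})),
     Comp = (\<lambda>(A, B, X) (B', D, Y). (A, D,
       {(p \<Zcomp> f, q \<Zcomp> g') | f g f' g' p q.
          (f, g) \<in> X \<and> (f', g') \<in> Y \<and> is_pullback C g f' p q}))\<rparr>"
  for C (structure)

text \<open>Chosen binary products with their projections, and a chosen terminal object.\<close>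

record ('o, 'm) products =
  Prod :: "'o \<Rightarrow> 'o \<Rightarrow> 'o"
  Pr1 :: "'o \<Rightarrow> 'o \<Rightarrow> 'm"
  Pr2 :: "'o \<Rightarrow> 'o \<Rightarrow> 'm"
  Terminal :: 'o

definition pairing ::
  "('o, 'm, 'z) cat_data_scheme \<Rightarrow> ('o, 'm) products \<Rightarrow> 'o \<Rightarrow> 'o \<Rightarrow> 'm \<Rightarrow> 'm \<Rightarrow> 'm" where
  "pairing C R A B a b = (THE h. h \<in> Hom C (Dom C a) (Prod R A B) \<and>
     h \<Zcomp> Pr1 R A B = a \<and> h \<Zcomp> Pr2 R A B = b)"
  for C (structure)

definition span_of :: "('o, 'm, 'z) cat_data_scheme \<Rightarrow> 'm \<Rightarrow> ('o, 'm) span_arr" where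
  "span_of C f = (Dom C f, Cod C f, span_rel C (Dom C f) (Cod C f) `` {(Id C (Dom C f), f)})"

text \<open>The full subcategory of spans on the objects \<open>X\<close>, with the tensor given on objects by the
  chosen products \<open>R\<close> and componentwise on spans. The chosen products need only exist on \<open>X\<close>; the
  head of a tensor of spans, which may lie outside \<open>X\<close>, is an arbitrary product of the two heads.
  The coherence isomorphisms are those of the cartesian structure, regarded as spans.\<close>

definition span_smc ::
  "('o, 'm, 'z) cat_data_scheme \<Rightarrow> ('o, 'm) products \<Rightarrow> 'o set \<Rightarrow> ('o, ('o, 'm) span_arr) smc_data" where
  "span_smc C R X = cat_data.extend (full_sub (span_cat C) X) (smc_data.fields
     (Prod R)
     (\<lambda>(A, B, X) (A', B', X'). (Prod R A A', Prod R B B',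
        {(pairing C R A A' (p \<Zcomp> f) (q \<Zcomp> f'), pairing C R B B' (p \<Zcomp> g) (q \<Zcomp> g')) | f g f' g' p q.
           (f, g) \<in> X \<and> (f', g') \<in> X' \<and> is_product C (Dom C f) (Dom C f') p q}))
     (Terminal R)
     (\<lambda>A B D. span_of C (pairing C R A (Prod R B D)
        (Pr1 R (Prod R A B) D \<Zcomp> Pr1 R A B)
        (pairing C R B D (Pr1 R (Prod R A B) D \<Zcomp> Pr2 R A B) (Pr2 R (Prod R A B) D))))
     (\<lambda>A. span_of C (Pr2 R (Terminal R) A))
     (\<lambda>A. span_of C (Pr1 R A (Terminal R)))
     (\<lambda>A B. span_of C (pairing C R B A (Pr2 R A B) (Pr1 R A B))))"
  for C (structure)

section \<open>Stateful processes\<close>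

text \<open>A morphism of \<open>St M\<close> is a triple \<open>(A, B, X)\<close> with \<open>X\<close> an equivalence class of pairs
  \<open>(S | f)\<close>. Associators, which are usually suppressed, are inserted explicitly.\<close>

definition st_pairs :: "('o, 'm, 'z) smc_data_scheme \<Rightarrow> 'o \<Rightarrow> 'o \<Rightarrow> ('o \<times> 'm) set" where
  "st_pairs M A B = {(S, f). S \<in> Ob M \<and> f \<in> Hom M (S \<odot> A) (S \<odot> B)}"
  for M (structure)

definition st_rel :: "('o, 'm, 'z) smc_data_scheme \<Rightarrow> 'o \<Rightarrow> 'o \<Rightarrow> (('o \<times> 'm) \<times> ('o \<times> 'm)) set" where
  "st_rel M A B = {((S, f), (T, g)). (S, f) \<in> st_pairs M A B \<and> (T, g) \<in> st_pairs M A B \<and>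
     (\<exists>h \<in> Isos M S T. g = (Inv M h \<otimes> Id M A) \<Zcomp> f \<Zcomp> (h \<otimes> Id M B))}"
  for M (structure)

type_synonym ('o, 'm) st_arr = "'o \<times> 'o \<times> ('o \<times> 'm) set"

definition st_of :: "('o, 'm, 'z) smc_data_scheme \<Rightarrow> 'm \<Rightarrow> ('o, 'm) st_arr" where
  "st_of M f = (Dom M f, Cod M f, st_rel M (Dom M f) (Cod M f) `` {(\<one>, Id M \<one> \<otimes> f)})"
  for M (structure)

text \<open>The arrow \<open>id \<otimes> \<sigma> \<otimes> id\<close> from \<open>(P \<odot> Q) \<odot> (R \<odot> W)\<close> to \<open>(P \<odot> R) \<odot> (Q \<odot> W)\<close>.\<close>

definition mid_swap :: "('o, 'm, 'z) smc_data_scheme \<Rightarrow> 'o \<Rightarrow> 'o \<Rightarrow> 'o \<Rightarrow> 'o \<Rightarrow> 'm" where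
  "mid_swap M P Q R W =
     \<alpha> P Q (R \<odot> W) \<Zcomp>
     (Id M P \<otimes> (Inv M (\<alpha> Q R W) \<Zcomp> (\<sigma> Q R \<otimes> Id M W) \<Zcomp> \<alpha> R Q W)) \<Zcomp>
     Inv M (\<alpha> P R (Q \<odot> W))"
  for M (structure)

definition St :: "('o, 'm, 'z) smc_data_scheme \<Rightarrow> ('o, ('o, 'm) st_arr) smc_data" where
  "St M = \<lparr>
     Ob = Ob M,
     Arr = {(A, B, X). A \<in> Ob M \<and> B \<in> Ob M \<and> X \<in> st_pairs M A B // st_rel M A B},
     Dom = (\<lambda>(A, B, X). A),
     Cod = (\<lambda>(A, B, X). B),
     Id = (\<lambda>A. (A, A, st_rel M A A `` {(\<one>, Id M (\<one> \<odot> A))})),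
     Comp = (\<lambda>(A, B, X) (B', D, Y). (A, D,
       \<Union>(S, f) \<in> X. \<Union>(T, g) \<in> Y. st_rel M A D `` {(S \<odot> T,
         (\<sigma> S T \<otimes> Id M A) \<Zcomp> \<alpha> T S A \<Zcomp> (Id M T \<otimes> f) \<Zcomp> Inv M (\<alpha> T S B) \<Zcomp>
         (\<sigma> T S \<otimes> Id M B) \<Zcomp> \<alpha> S T B \<Zcomp> (Id M S \<otimes> g) \<Zcomp> Inv M (\<alpha> S T D))})),
     Ten = Ten M,
     TenA = (\<lambda>(A, B, X) (A', B', X'). (A \<odot> A', B \<odot> B',
       \<Union>(S, f) \<in> X. \<Union>(S', f') \<in> X'. st_rel M (A \<odot> A') (B \<odot> B') `` {(S \<odot> S',
         mid_swap M S S' A A' \<Zcomp> (f \<otimes> f') \<Zcomp> mid_swap M S B S' B')})),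
     Unit = \<one>,
     Assoc = (\<lambda>A B D. st_of M (\<alpha> A B D)),
     LUnit = (\<lambda>A. st_of M (\<l> A)),
     RUnit = (\<lambda>A. st_of M (\<r> A)),
     Sym = (\<lambda>A B. st_of M (\<sigma> A B))\<rparr>"
  for M (structure)

section \<open>Sets and graphs\<close>

text \<open>HOL has no type of all sets, so the category of sets is taken relative to a collection
  \<open>U\<close> of sets of elements of a type \<open>'u\<close>, closed under what the cartesian products, subsets and
  one-point set of the category of sets require. In a type carrying a model of set theory, with
  \<open>U\<close> the extensions of the sets of the model and \<open>pair\<close> the ordered pair, this is the category
  of all sets of the model. Every infinite type also yields an instance with \<open>U = UNIV\<close>.\<close>

locale set_universe =
  fixes U :: "'u set set" and pair :: "'u \<Rightarrow> 'u \<Rightarrow> 'u" and pt :: 'u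
  assumes pair_inject: "pair a b = pair c d \<Longrightarrow> a = c \<and> b = d"
    and subset_closed: "A \<in> U \<Longrightarrow> B \<subseteq> A \<Longrightarrow> B \<in> U"
    and prod_closed: "A \<in> U \<Longrightarrow> B \<in> U \<Longrightarrow> {pair a b | a b. a \<in> A \<and> b \<in> B} \<in> U"
    and pt_closed: "{pt} \<in> U"

lemma set_universe_infinite_type:
  assumes "infinite (UNIV :: 'u set)"
  shows "\<exists>(pair :: 'u \<Rightarrow> 'u \<Rightarrow> 'u) pt. set_universe UNIV pair pt"
proof -
  have "(card_of (UNIV \<times> UNIV :: ('u \<times> 'u) set), card_of (UNIV :: 'u set)) \<in> ordIso"
    using assms by (rule card_of_Times_same_infinite)
  then obtain f :: "'u \<times> 'u \<Rightarrow> 'u" where "bij f"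
    using card_of_ordIso[of "UNIV \<times> UNIV :: ('u \<times> 'u) set" "UNIV :: 'u set"] by auto
  then have "set_universe UNIV (\<lambda>a b. f (a, b)) pt" for pt
    by unfold_locales (auto dest: bij_is_inj injD)
  then show ?thesis by blast
qed

type_synonym 'u fn = "'u set \<times> 'u set \<times> ('u \<Rightarrow> 'u)"

definition Set_cat :: "'u set set \<Rightarrow> ('u set, 'u fn) cat_data" where
  "Set_cat U = \<lparr>
     Ob = U,
     Arr = {(A, B, f). A \<in> U \<and> B \<in> U \<and> f \<in> A \<rightarrow>\<^sub>E B},
     Dom = (\<lambda>(A, B, f). A),
     Cod = (\<lambda>(A, B, f). B),
     Id = (\<lambda>A. (A, A, \<lambda>x \<in> A. x)),
     Comp = (\<lambda>(A, B, f) (B', D, g). (A, D, compose A g f))\<rparr>"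

definition set_prod :: "('u \<Rightarrow> 'u \<Rightarrow> 'u) \<Rightarrow> 'u set \<Rightarrow> 'u set \<Rightarrow> 'u set" where
  "set_prod pair A B = {pair a b | a b. a \<in> A \<and> b \<in> B}"

definition proj1 :: "('u \<Rightarrow> 'u \<Rightarrow> 'u) \<Rightarrow> 'u set \<Rightarrow> 'u set \<Rightarrow> 'u \<Rightarrow> 'u" where
  "proj1 pair A B = (\<lambda>z \<in> set_prod pair A B. THE a. \<exists>b. z = pair a b)"

definition proj2 :: "('u \<Rightarrow> 'u \<Rightarrow> 'u) \<Rightarrow> 'u set \<Rightarrow> 'u set \<Rightarrow> 'u \<Rightarrow> 'u" where
  "proj2 pair A B = (\<lambda>z \<in> set_prod pair A B. THE b. \<exists>a. z = pair a b)"

definition set_products :: "('u \<Rightarrow> 'u \<Rightarrow> 'u) \<Rightarrow> 'u \<Rightarrow> ('u set, 'u fn) products" where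
  "set_products pair pt = \<lparr>
     Prod = set_prod pair,
     Pr1 = (\<lambda>A B. (set_prod pair A B, A, proj1 pair A B)),
     Pr2 = (\<lambda>A B. (set_prod pair A B, B, proj2 pair A B)),
     Terminal = {pt}\<rparr>"

definition Span_Set ::
  "'u set set \<Rightarrow> ('u \<Rightarrow> 'u \<Rightarrow> 'u) \<Rightarrow> 'u \<Rightarrow> ('u set, ('u set, 'u fn) span_arr) smc_data" where
  "Span_Set U pair pt = span_smc (Set_cat U) (set_products pair pt) U"

record 'u graph =
  Edges :: "'u set"
  Verts :: "'u set"
  src :: "'u \<Rightarrow> 'u"
  tgt :: "'u \<Rightarrow> 'u"

type_synonym 'u graph_arr = "'u graph \<times> 'u graph \<times> ('u \<Rightarrow> 'u) \<times> ('u \<Rightarrow> 'u)"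

definition Graph_cat :: "'u set set \<Rightarrow> ('u graph, 'u graph_arr) cat_data" where
  "Graph_cat U = (let
     graphs = {G. Edges G \<in> U \<and> Verts G \<in> U \<and>
       src G \<in> Edges G \<rightarrow>\<^sub>E Verts G \<and> tgt G \<in> Edges G \<rightarrow>\<^sub>E Verts G} in \<lparr>
     Ob = graphs,
     Arr = {(G, H, e, v). G \<in> graphs \<and> H \<in> graphs \<and>
       e \<in> Edges G \<rightarrow>\<^sub>E Edges H \<and> v \<in> Verts G \<rightarrow>\<^sub>E Verts H \<and>
       (\<forall>x \<in> Edges G. src H (e x) = v (src G x) \<and> tgt H (e x) = v (tgt G x))},
     Dom = (\<lambda>(G, H, e, v). G),
     Cod = (\<lambda>(G, H, e, v). H),
     Id = (\<lambda>G. (G, G, \<lambda>x \<in> Edges G. x, \<lambda>x \<in> Verts G. x)),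
     Comp = (\<lambda>(G, H, e, v) (H', K, e', v').
       (G, K, compose (Edges G) e' e, compose (Verts G) v' v))\<rparr>)"

text \<open>The single-vertex graph \<open>A \<rightrightarrows> 1\<close>.\<close>

definition single_vertex :: "'u \<Rightarrow> 'u set \<Rightarrow> 'u graph" where
  "single_vertex pt A = \<lparr>Edges = A, Verts = {pt}, src = (\<lambda>x \<in> A. pt), tgt = (\<lambda>x \<in> A. pt)\<rparr>"

text \<open>The chosen products of single-vertex graphs: \<open>(A \<rightrightarrows> 1) \<otimes> (B \<rightrightarrows> 1) = (A \<times> B \<rightrightarrows> 1)\<close>.\<close>

definition single_vertex_products :: "('u \<Rightarrow> 'u \<Rightarrow> 'u) \<Rightarrow> 'u \<Rightarrow> ('u graph, 'u graph_arr) products" where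
  "single_vertex_products pair pt = (let
     P = (\<lambda>G H. single_vertex pt (set_prod pair (Edges G) (Edges H))) in \<lparr>
     Prod = P,
     Pr1 = (\<lambda>G H. (P G H, G, proj1 pair (Edges G) (Edges H), \<lambda>x \<in> {pt}. pt)),
     Pr2 = (\<lambda>G H. (P G H, H, proj2 pair (Edges G) (Edges H), \<lambda>x \<in> {pt}. pt)),
     Terminal = single_vertex pt {pt}\<rparr>)"

text \<open>The full subcategory of spans of graphs on the single-vertex graphs.\<close>

definition Span_Graph_single ::
  "'u set set \<Rightarrow> ('u \<Rightarrow> 'u \<Rightarrow> 'u) \<Rightarrow> 'u \<Rightarrow> ('u graph, ('u graph, 'u graph_arr) span_arr) smc_data" where
  "Span_Graph_single U pair pt =
     span_smc (Graph_cat U) (single_vertex_products pair pt) (single_vertex pt ` U)"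

end

theory Submission
  imports Defs
begin

text \<open>A span of graphs between single-vertex graphs \<open>A\<close> and \<open>B\<close> is a graph whose arcs carry an
  input label in \<open>A\<close> and an output label in \<open>B\<close>. Writing its node set as \<open>S\<close>, source and input label
  together form a map into \<open>S \<times> A\<close>, target and output label a map into \<open>S \<times> B\<close>: this is exactly a
  span of sets \<open>S \<times> A \<leftarrow> E \<rightarrow> S \<times> B\<close>, that is, a stateful process with state space \<open>S\<close>. Invertible
  spans of sets are bijections, so both sides identify the same labelled graphs. Composition is on
  both sides the synchronised product, and the tensor the plain product, of labelled graphs.
  Hence every law reduces to an explicit isomorphism of labelled graphs, and since the
  correspondence preserves all structure strictly, the symmetric monoidal axioms need only be
  checked for spans of graphs. Spans of sets are the labelled graphs with a single node.\<close>

section \<open>Labelled graphs up to isomorphism\<close>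

text \<open>Why states multiply under composition: all vertices of a span's foot lie at one point,
  so the pullback over a single-vertex graph restricts pairs of arcs but keeps every pair of nodes.
  The node set of a composite span is therefore a full product, matching the state space
  \<open>S \<odot> T\<close> of a sequential composite of processes. Two features shape the
  formalisation. Composition and tensor of classes range over all representatives and all pullbacks
  or products, so each time it has to be shown that the resulting set is a single isomorphism class.
  And labelled graphs are polymorphic in nodes and arcs: products of graphs are formed on HOL
  product types, isomorphism compares graphs of different types, and \<open>pair\<close> codes nodes
  and arcs only when a graph has to return to the universe \<open>U\<close>. Labels, which belong to
  the objects, are coded throughout. Spans of sets and spans of graphs are treated once, in the
  locale \<open>graph_model\<close>; the comparison of the two instances happens only on labelled
  graphs.\<close>

record ('v, 'e, 'l) lgraph =
  nodes :: "'v set"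
  arcs :: "'e set"
  tail :: "'e \<Rightarrow> 'v"
  head :: "'e \<Rightarrow> 'v"
  lin :: "'e \<Rightarrow> 'l"
  lout :: "'e \<Rightarrow> 'l"

definition wf_lgraph :: "('v, 'e, 'l) lgraph \<Rightarrow> bool" where
  "wf_lgraph m \<longleftrightarrow> tail m \<in> arcs m \<rightarrow> nodes m \<and> head m \<in> arcs m \<rightarrow> nodes m"

definition lgraph_on :: "'l set \<Rightarrow> 'l set \<Rightarrow> ('v, 'e, 'l) lgraph \<Rightarrow> bool" where
  "lgraph_on A B m \<longleftrightarrow> wf_lgraph m \<and> lin m \<in> arcs m \<rightarrow> A \<and> lout m \<in> arcs m \<rightarrow> B"

text \<open>The two graphs may have nodes and arcs of different types. Well-formedness is demanded
  of the left one only; the bijections carry it over, as \<open>lgraph_iso_wf\<close>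
  records.\<close>

definition lgraph_iso :: "('v, 'e, 'l) lgraph \<Rightarrow> ('w, 'f, 'l) lgraph \<Rightarrow> bool"  (infix "\<simeq>" 50) where
  "m \<simeq> n \<longleftrightarrow> wf_lgraph m \<and> (\<exists>\<phi> \<psi>. bij_betw \<phi> (nodes m) (nodes n) \<and> bij_betw \<psi> (arcs m) (arcs n) \<and>
     (\<forall>e \<in> arcs m. tail n (\<psi> e) = \<phi> (tail m e) \<and> head n (\<psi> e) = \<phi> (head m e) \<and>
        lin n (\<psi> e) = lin m e \<and> lout n (\<psi> e) = lout m e))"

lemma lgraph_isoI:
  assumes "wf_lgraph m" "bij_betw \<phi> (nodes m) (nodes n)" "bij_betw \<psi> (arcs m) (arcs n)"
    and "\<And>e. e \<in> arcs m \<Longrightarrow> tail n (\<psi> e) = \<phi> (tail m e)"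
    and "\<And>e. e \<in> arcs m \<Longrightarrow> head n (\<psi> e) = \<phi> (head m e)"
    and "\<And>e. e \<in> arcs m \<Longrightarrow> lin n (\<psi> e) = lin m e"
    and "\<And>e. e \<in> arcs m \<Longrightarrow> lout n (\<psi> e) = lout m e"
  shows "m \<simeq> n"
  using assms unfolding lgraph_iso_def by blast

lemma lgraph_on_wf: "lgraph_on A B m \<Longrightarrow> wf_lgraph m"
  by (simp add: lgraph_on_def)

lemma lgraph_iso_refl: "wf_lgraph m \<Longrightarrow> m \<simeq> m"
  by (rule lgraph_isoI[where \<phi> = id and \<psi> = id]) auto

text \<open>The fields are total functions, so graphs that agree on all arcs can still differ as
  records. Such graphs are related by identity maps.\<close>

lemma lgraph_iso_cong:
  assumes "wf_lgraph m" "nodes m = nodes n" "arcs m = arcs n"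
    and "\<And>e. e \<in> arcs m \<Longrightarrow> tail n e = tail m e" "\<And>e. e \<in> arcs m \<Longrightarrow> head n e = head m e"
    and "\<And>e. e \<in> arcs m \<Longrightarrow> lin n e = lin m e" "\<And>e. e \<in> arcs m \<Longrightarrow> lout n e = lout m e"
  shows "m \<simeq> n"
  using assms by (intro lgraph_isoI[where \<phi> = id and \<psi> = id]) auto

lemma lgraph_iso_sym:
  assumes "m \<simeq> n" shows "n \<simeq> m"
proof -
  obtain \<phi> \<psi> where wf: "wf_lgraph m" and \<phi>: "bij_betw \<phi> (nodes m) (nodes n)"
    and \<psi>: "bij_betw \<psi> (arcs m) (arcs n)"
    and eq: "\<forall>e \<in> arcs m. tail n (\<psi> e) = \<phi> (tail m e) \<and> head n (\<psi> e) = \<phi> (head m e) \<and>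
        lin n (\<psi> e) = lin m e \<and> lout n (\<psi> e) = lout m e"
    using assms unfolding lgraph_iso_def by blast
  let ?\<phi> = "inv_into (nodes m) \<phi>" and ?\<psi> = "inv_into (arcs m) \<psi>"
  have arc: "?\<psi> e \<in> arcs m \<and> \<psi> (?\<psi> e) = e" if "e \<in> arcs n" for e
    using that \<psi> by (metis bij_betw_imp_surj_on f_inv_into_f inv_into_into)
  have node: "?\<phi> (\<phi> v) = v" if "v \<in> nodes m" for v
    using that \<phi> by (simp add: bij_betw_inv_into_left)
  have mem: "tail m e \<in> nodes m" "head m e \<in> nodes m" if "e \<in> arcs m" for e
    using wf that by (auto simp: wf_lgraph_def)
  show ?thesis
  proof (rule lgraph_isoI[where \<phi> = ?\<phi> and \<psi> = ?\<psi>])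
    \<comment> \<open>Every arc of \<open>n\<close> is the image of an arc of \<open>m\<close>, so
      its end points are images of nodes of \<open>m\<close>.\<close>
    show "wf_lgraph n"
      unfolding wf_lgraph_def using arc eq mem \<phi>
      by (auto simp: bij_betw_def) (metis imageI)+
    show "bij_betw ?\<phi> (nodes n) (nodes m)" "bij_betw ?\<psi> (arcs n) (arcs m)"
      using \<phi> \<psi> by (auto intro: bij_betw_inv_into)
  qed (use arc node mem eq in \<open>metis+\<close>)
qed

lemma lgraph_iso_trans [trans]:
  assumes "m \<simeq> n" "n \<simeq> k" shows "m \<simeq> k"
proof -
  obtain \<phi> \<psi> where 1: "wf_lgraph m" "bij_betw \<phi> (nodes m) (nodes n)"
    "bij_betw \<psi> (arcs m) (arcs n)"
    "\<forall>e \<in> arcs m. tail n (\<psi> e) = \<phi> (tail m e) \<and> head n (\<psi> e) = \<phi> (head m e) \<and>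
        lin n (\<psi> e) = lin m e \<and> lout n (\<psi> e) = lout m e"
    using assms unfolding lgraph_iso_def by blast
  obtain \<phi>' \<psi>' where 2: "bij_betw \<phi>' (nodes n) (nodes k)"
    "bij_betw \<psi>' (arcs n) (arcs k)"
    "\<forall>e \<in> arcs n. tail k (\<psi>' e) = \<phi>' (tail n e) \<and> head k (\<psi>' e) = \<phi>' (head n e) \<and>
        lin k (\<psi>' e) = lin n e \<and> lout k (\<psi>' e) = lout n e"
    using assms unfolding lgraph_iso_def by blast
  have "\<psi> e \<in> arcs n" if "e \<in> arcs m" for e
    using 1 that by (auto simp: bij_betw_def)
  then show ?thesis using 1 2
    by (intro lgraph_isoI[where \<phi> = "\<phi>' \<circ> \<phi>" and \<psi> = "\<psi>' \<circ> \<psi>"]) (auto intro: bij_betw_trans)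
qed

lemma lgraph_iso_wf: "m \<simeq> n \<Longrightarrow> wf_lgraph m" "m \<simeq> n \<Longrightarrow> wf_lgraph n"
  using lgraph_iso_sym unfolding lgraph_iso_def by blast+

lemma lgraph_on_iso:
  assumes "m \<simeq> n" "lgraph_on A B m" shows "lgraph_on A B n"
proof -
  obtain \<psi> where "bij_betw \<psi> (arcs n) (arcs m)"
    "\<forall>e \<in> arcs n. lin m (\<psi> e) = lin n e \<and> lout m (\<psi> e) = lout n e"
    using lgraph_iso_sym[OF assms(1)] unfolding lgraph_iso_def by blast
  then show ?thesis
    using lgraph_iso_wf[OF assms(1)] assms(2) unfolding lgraph_on_def
    by (auto simp: Pi_iff bij_betw_def) (metis imageI)+
qed

text \<open>The pullback of the two middle labellings. Nodes and arcs are HOL pairs, so no coding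
  intervenes and associativity is plain rebracketing.\<close>

definition lg_comp :: "('v, 'e, 'l) lgraph \<Rightarrow> ('w, 'f, 'l) lgraph \<Rightarrow> ('v \<times> 'w, 'e \<times> 'f, 'l) lgraph" where
  "lg_comp m n = \<lparr>nodes = nodes m \<times> nodes n,
     arcs = {(e, e'). e \<in> arcs m \<and> e' \<in> arcs n \<and> lout m e = lin n e'},
     tail = map_prod (tail m) (tail n), head = map_prod (head m) (head n),
     lin = lin m \<circ> fst, lout = lout n \<circ> snd\<rparr>"

definition lg_ten :: "('l \<Rightarrow> 'l \<Rightarrow> 'l) \<Rightarrow> ('v, 'e, 'l) lgraph \<Rightarrow> ('w, 'f, 'l) lgraph \<Rightarrow>
    ('v \<times> 'w, 'e \<times> 'f, 'l) lgraph" where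
  "lg_ten pair m n = \<lparr>nodes = nodes m \<times> nodes n, arcs = arcs m \<times> arcs n,
     tail = map_prod (tail m) (tail n), head = map_prod (head m) (head n),
     lin = (\<lambda>(e, e'). pair (lin m e) (lin n e')), lout = (\<lambda>(e, e'). pair (lout m e) (lout n e'))\<rparr>"

text \<open>The span of functions whose left leg is the identity of \<open>A\<close> and whose right
  leg is \<open>h\<close>, as a one-node graph.\<close>

definition lg_fun :: "'l set \<Rightarrow> ('l \<Rightarrow> 'l) \<Rightarrow> (unit, 'l, 'l) lgraph" where
  "lg_fun A h = \<lparr>nodes = {()}, arcs = A, tail = (\<lambda>_. ()), head = (\<lambda>_. ()), lin = (\<lambda>x. x), lout = h\<rparr>"

text \<open>Composition with a function on the right, or with a bijection on the left, has this
  effect up to isomorphism; coherence arrows thereby disappear from later computations.\<close>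

definition relabel :: "('l \<Rightarrow> 'l) \<Rightarrow> ('l \<Rightarrow> 'l) \<Rightarrow> ('v, 'e, 'l) lgraph \<Rightarrow> ('v, 'e, 'l) lgraph" where
  "relabel i j m = m\<lparr>lin := i \<circ> lin m, lout := j \<circ> lout m\<rparr>"

lemmas lg_defs = lg_comp_def lg_ten_def lg_fun_def relabel_def

section \<open>Invariance under isomorphism, and the laws of composition\<close>

lemma bij_betw_map_prod':
  "bij_betw f A B \<Longrightarrow> bij_betw g C D \<Longrightarrow> bij_betw (map_prod f g) (A \<times> C) (B \<times> D)"
  by (auto simp: bij_betw_def inj_on_def)

lemma lg_comp_cong:
  assumes "m \<simeq> m'" "n \<simeq> n'" shows "lg_comp m n \<simeq> lg_comp m' n'"
proof -
  obtain \<phi> \<psi> where 1: "wf_lgraph m" "bij_betw \<phi> (nodes m) (nodes m')"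
    "bij_betw \<psi> (arcs m) (arcs m')"
    "\<forall>e \<in> arcs m. tail m' (\<psi> e) = \<phi> (tail m e) \<and> head m' (\<psi> e) = \<phi> (head m e) \<and>
        lin m' (\<psi> e) = lin m e \<and> lout m' (\<psi> e) = lout m e"
    using assms unfolding lgraph_iso_def by blast
  obtain \<phi>' \<psi>' where 2: "wf_lgraph n" "bij_betw \<phi>' (nodes n) (nodes n')"
    "bij_betw \<psi>' (arcs n) (arcs n')"
    "\<forall>e \<in> arcs n. tail n' (\<psi>' e) = \<phi>' (tail n e) \<and> head n' (\<psi>' e) = \<phi>' (head n e) \<and>
        lin n' (\<psi>' e) = lin n e \<and> lout n' (\<psi>' e) = lout n e"
    using assms unfolding lgraph_iso_def by blast
  have im: "arcs m' = \<psi> ` arcs m" "arcs n' = \<psi>' ` arcs n" using 1 2 by (auto simp: bij_betw_def)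
  \<comment> \<open>Isomorphisms do not change labels, so a pair of arcs is composable exactly when
    its image is.\<close>
  have "map_prod \<psi> \<psi>' ` arcs (lg_comp m n) = arcs (lg_comp m' n')"
    using 1 2 unfolding lg_comp_def im by (auto simp: image_iff)
  moreover have "inj_on (map_prod \<psi> \<psi>') (arcs (lg_comp m n))"
    using 1 2 by (auto simp: lg_comp_def bij_betw_def inj_on_def)
  ultimately have "bij_betw (map_prod \<psi> \<psi>') (arcs (lg_comp m n)) (arcs (lg_comp m' n'))"
    by (simp add: bij_betw_def)
  then show ?thesis using 1 2
    by (intro lgraph_isoI[where \<phi> = "map_prod \<phi> \<phi>'" and \<psi> = "map_prod \<psi> \<psi>'"])
      (auto simp: lg_comp_def wf_lgraph_def Pi_iff intro: bij_betw_map_prod')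
qed

lemma lg_ten_cong:
  assumes "m \<simeq> m'" "n \<simeq> n'" shows "lg_ten pair m n \<simeq> lg_ten pair m' n'"
proof -
  obtain \<phi> \<psi> where 1: "wf_lgraph m" "bij_betw \<phi> (nodes m) (nodes m')"
    "bij_betw \<psi> (arcs m) (arcs m')"
    "\<forall>e \<in> arcs m. tail m' (\<psi> e) = \<phi> (tail m e) \<and> head m' (\<psi> e) = \<phi> (head m e) \<and>
        lin m' (\<psi> e) = lin m e \<and> lout m' (\<psi> e) = lout m e"
    using assms unfolding lgraph_iso_def by blast
  obtain \<phi>' \<psi>' where 2: "wf_lgraph n" "bij_betw \<phi>' (nodes n) (nodes n')"
    "bij_betw \<psi>' (arcs n) (arcs n')"
    "\<forall>e \<in> arcs n. tail n' (\<psi>' e) = \<phi>' (tail n e) \<and> head n' (\<psi>' e) = \<phi>' (head n e) \<and>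
        lin n' (\<psi>' e) = lin n e \<and> lout n' (\<psi>' e) = lout n e"
    using assms unfolding lgraph_iso_def by blast
  show ?thesis using 1 2
    by (intro lgraph_isoI[where \<phi> = "map_prod \<phi> \<phi>'" and \<psi> = "map_prod \<psi> \<psi>'"])
      (auto simp: lg_ten_def wf_lgraph_def Pi_iff intro: bij_betw_map_prod')
qed

lemma lgraph_on_comp:
  "lgraph_on A B m \<Longrightarrow> lgraph_on B D n \<Longrightarrow> lgraph_on A D (lg_comp m n)"
  by (auto simp: lgraph_on_def wf_lgraph_def lg_comp_def)

lemma lgraph_on_ten:
  "lgraph_on A B m \<Longrightarrow> lgraph_on A' B' n \<Longrightarrow>
    lgraph_on (set_prod pair A A') (set_prod pair B B') (lg_ten pair m n)"
  by (fastforce simp: lgraph_on_def wf_lgraph_def lg_ten_def set_prod_def)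

lemma lgraph_on_fun: "h \<in> A \<rightarrow> B \<Longrightarrow> lgraph_on A B (lg_fun A h)"
  by (auto simp: lgraph_on_def wf_lgraph_def lg_fun_def)

lemma lg_comp_assoc:
  assumes "wf_lgraph m" "wf_lgraph n" "wf_lgraph k"
  shows "lg_comp (lg_comp m n) k \<simeq> lg_comp m (lg_comp n k)"
  using assms
  by (intro lgraph_isoI[where \<phi> = "\<lambda>((x, y), z). (x, (y, z))" and \<psi> = "\<lambda>((x, y), z). (x, (y, z))"])
    (auto simp: wf_lgraph_def lg_comp_def Pi_iff
      intro!: bij_betwI[where g = "\<lambda>(x, (y, z)). ((x, y), z)"])

text \<open>An arc \<open>e\<close> of \<open>m\<close> is composable with exactly one arc of the
  function, namely its own output label.\<close>

lemma lg_comp_fun_right: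
  assumes "lgraph_on A B m"
  shows "lg_comp m (lg_fun B h) \<simeq> relabel (\<lambda>x. x) h m"
  using assms
  by (intro lgraph_isoI[where \<phi> = fst and \<psi> = fst])
    (auto simp: lgraph_on_def wf_lgraph_def lg_defs Pi_iff intro: bij_betwI[where g = "\<lambda>x. (x, ())"]
      bij_betwI[where g = "\<lambda>x. (x, lout m x)"])

text \<open>Bijectivity makes the arc of the function preceding \<open>e\<close> unique: it must be
  \<open>k (lin m e)\<close>. The input labels are thus changed by the inverse \<open>k\<close>, not
  by \<open>h\<close>.\<close>

lemma lg_comp_fun_left:
  assumes "lgraph_on B D m" "h \<in> A \<rightarrow> B" "k \<in> B \<rightarrow> A"
    "\<And>x. x \<in> A \<Longrightarrow> k (h x) = x" "\<And>y. y \<in> B \<Longrightarrow> h (k y) = y"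
  shows "lg_comp (lg_fun A h) m \<simeq> relabel k (\<lambda>x. x) m"
proof (rule lgraph_isoI[where \<phi> = snd and \<psi> = snd])
  show "bij_betw snd (arcs (lg_comp (lg_fun A h) m)) (arcs (relabel k (\<lambda>x. x) m))"
    using assms by (intro bij_betwI[where g = "\<lambda>e. (k (lin m e), e)"])
      (auto simp: lgraph_on_def lg_defs Pi_iff, metis)
qed (use assms in \<open>auto simp: lgraph_on_def wf_lgraph_def lg_defs Pi_iff
      intro: bij_betwI[where g = "\<lambda>x. ((), x)"]\<close>, metis)

lemma lg_fun_cong: "(\<And>x. x \<in> A \<Longrightarrow> h x = k x) \<Longrightarrow> lg_fun A h \<simeq> lg_fun A k"
  by (rule lgraph_iso_cong) (auto simp: lg_fun_def wf_lgraph_def)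

lemma relabel_id: "relabel (\<lambda>x. x) (\<lambda>x. x) m = m"
  by (cases m) (simp add: relabel_def comp_def)

lemma relabel_fun: "relabel (\<lambda>x. x) k (lg_fun A h) = lg_fun A (\<lambda>x. k (h x))"
  by (simp add: relabel_def lg_fun_def comp_def)

lemma lg_comp_fun_fun:
  assumes "h \<in> A \<rightarrow> B"
  shows "lg_comp (lg_fun A h) (lg_fun B k) \<simeq> lg_fun A (\<lambda>x. k (h x))"
  using lg_comp_fun_right[OF lgraph_on_fun[OF assms]] by (simp add: relabel_fun)

lemma lg_comp_id_right: "lgraph_on A B m \<Longrightarrow> lg_comp m (lg_fun B (\<lambda>x. x)) \<simeq> m"
  using lg_comp_fun_right[of A B m "\<lambda>x. x"] by (simp add: relabel_id)

lemma lg_comp_id_left: "lgraph_on A B m \<Longrightarrow> lg_comp (lg_fun A (\<lambda>x. x)) m \<simeq> m"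
  using lg_comp_fun_left[of A B m "\<lambda>x. x" A "\<lambda>x. x"] by (simp add: relabel_id)

text \<open>Projections that do not depend on the two factors; on a product they agree with
  \<open>proj1\<close> and \<open>proj2\<close>, see \<open>proj_eq\<close>.\<close>

definition pr1 :: "('u \<Rightarrow> 'u \<Rightarrow> 'u) \<Rightarrow> 'u \<Rightarrow> 'u" where
  "pr1 pair z = (THE a. \<exists>b. z = pair a b)"

definition pr2 :: "('u \<Rightarrow> 'u \<Rightarrow> 'u) \<Rightarrow> 'u \<Rightarrow> 'u" where
  "pr2 pair z = (THE b. \<exists>a. z = pair a b)"

section \<open>Tensor of labelled graphs over a fixed universe\<close>

context set_universe
begin

abbreviation times (infixr "\<boxtimes>" 75) where "A \<boxtimes> B \<equiv> set_prod pair A B"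
abbreviation fs where "fs \<equiv> pr1 pair"
abbreviation sn where "sn \<equiv> pr2 pair"
abbreviation ten (infixr "\<otimes>\<^sub>l" 75) where "m \<otimes>\<^sub>l n \<equiv> lg_ten pair m n"

lemma pair_eq [simp]: "pair a b = pair c d \<longleftrightarrow> a = c \<and> b = d"
  using pair_inject by blast

lemma fs_pair [simp]: "fs (pair a b) = a"
  by (auto simp: pr1_def)

lemma sn_pair [simp]: "sn (pair a b) = b"
  by (auto simp: pr2_def)

lemma pair_in [simp]: "pair a b \<in> A \<boxtimes> B \<longleftrightarrow> a \<in> A \<and> b \<in> B"
  by (auto simp: set_prod_def)

lemma times_cases:
  assumes "z \<in> A \<boxtimes> B" obtains a b where "z = pair a b" "a \<in> A" "b \<in> B"
  using assms by (auto simp: set_prod_def)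

lemma ball_times [simp]: "(\<forall>z \<in> A \<boxtimes> B. P z) \<longleftrightarrow> (\<forall>a \<in> A. \<forall>b \<in> B. P (pair a b))"
  by (auto simp: set_prod_def)

lemma times_in_U [simp]: "A \<in> U \<Longrightarrow> B \<in> U \<Longrightarrow> A \<boxtimes> B \<in> U"
  by (simp add: set_prod_def prod_closed)

text \<open>Interchange of the inner factors of both nodes and arcs. Injectivity of
  \<open>pair\<close> enters in the arcs: two coded labels match exactly when both components
  match.\<close>

lemma lg_ten_comp:
  assumes "wf_lgraph m" "wf_lgraph n" "wf_lgraph m'" "wf_lgraph n'"
  shows "lg_comp m n \<otimes>\<^sub>l lg_comp m' n' \<simeq> lg_comp (m \<otimes>\<^sub>l m') (n \<otimes>\<^sub>l n')"
  using assms
  by (intro lgraph_isoI[where \<phi> = "\<lambda>((x, y), (z, w)). ((x, z), (y, w))"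
        and \<psi> = "\<lambda>((x, y), (z, w)). ((x, z), (y, w))"])
    (auto simp: wf_lgraph_def lg_comp_def lg_ten_def Pi_iff
      intro!: bij_betwI[where g = "\<lambda>((x, y), (z, w)). ((x, z), (y, w))"])

definition cross :: "('u \<Rightarrow> 'u) \<Rightarrow> ('u \<Rightarrow> 'u) \<Rightarrow> 'u \<Rightarrow> 'u" where
  "cross h k z = pair (h (fs z)) (k (sn z))"

text \<open>These structural maps are total on \<open>'u\<close>, but only their values on coded
  tuples matter. After \<open>times_cases\<close> the simplification rules evaluate any composite of
  them on a generic tuple.\<close>

definition assoc_fn where "assoc_fn z = pair (fs (fs z)) (pair (sn (fs z)) (sn z))"
definition unassoc_fn where "unassoc_fn z = pair (pair (fs z) (fs (sn z))) (sn (sn z))"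
definition swap_fn where "swap_fn z = pair (sn z) (fs z)"

lemma cross_pair [simp]: "cross h k (pair a b) = pair (h a) (k b)"
  by (simp add: cross_def)

lemma assoc_pair [simp]: "assoc_fn (pair (pair a b) c) = pair a (pair b c)"
  by (simp add: assoc_fn_def)

lemma unassoc_pair [simp]: "unassoc_fn (pair a (pair b c)) = pair (pair a b) c"
  by (simp add: unassoc_fn_def)

lemma swap_pair [simp]: "swap_fn (pair a b) = pair b a"
  by (simp add: swap_fn_def)

lemma lg_ten_fun: "lg_fun A h \<otimes>\<^sub>l lg_fun B k \<simeq> lg_fun (A \<boxtimes> B) (cross h k)"
  by (rule lgraph_isoI[where \<phi> = "\<lambda>_. ()" and \<psi> = "\<lambda>(x, y). pair x y"])
    (auto simp: lg_defs wf_lgraph_def bij_betw_def inj_on_def set_prod_def)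

text \<open>Naturality of the associator in terms of labels: composing with it on the right acts on
  outputs by \<open>assoc_fn\<close>, composing on the left acts on inputs by the inverse. The next
  three lemmas do the same for the unitors and the symmetry.\<close>

lemma lg_assoc_nat:
  assumes "wf_lgraph m" "wf_lgraph n" "wf_lgraph k"
  shows "relabel (\<lambda>x. x) assoc_fn ((m \<otimes>\<^sub>l n) \<otimes>\<^sub>l k) \<simeq> relabel unassoc_fn (\<lambda>x. x) (m \<otimes>\<^sub>l (n \<otimes>\<^sub>l k))"
  using assms
  by (intro lgraph_isoI[where \<phi> = "\<lambda>((x, y), z). (x, (y, z))" and \<psi> = "\<lambda>((x, y), z). (x, (y, z))"])
    (auto simp: wf_lgraph_def lg_defs Pi_iff
      intro!: bij_betwI[where g = "\<lambda>(x, (y, z)). ((x, y), z)"])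

lemma lg_lunit_nat:
  assumes "wf_lgraph m"
  shows "relabel (\<lambda>x. x) sn (lg_fun {c} (\<lambda>x. x) \<otimes>\<^sub>l m) \<simeq> relabel (pair c) (\<lambda>x. x) m"
  using assms
  by (intro lgraph_isoI[where \<phi> = snd and \<psi> = snd])
    (auto simp: wf_lgraph_def lg_defs Pi_iff intro: bij_betwI[where g = "\<lambda>x. ((), x)"]
      bij_betwI[where g = "\<lambda>x. (c, x)"])

lemma lg_runit_nat:
  assumes "wf_lgraph m"
  shows "relabel (\<lambda>x. x) fs (m \<otimes>\<^sub>l lg_fun {c} (\<lambda>x. x)) \<simeq> relabel (\<lambda>x. pair x c) (\<lambda>x. x) m"
  using assms
  by (intro lgraph_isoI[where \<phi> = fst and \<psi> = fst])
    (auto simp: wf_lgraph_def lg_defs Pi_iff intro: bij_betwI[where g = "\<lambda>x. (x, ())"]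
      bij_betwI[where g = "\<lambda>x. (x, c)"])

lemma lg_swap_nat:
  assumes "wf_lgraph m" "wf_lgraph n"
  shows "relabel (\<lambda>x. x) swap_fn (m \<otimes>\<^sub>l n) \<simeq> relabel swap_fn (\<lambda>x. x) (n \<otimes>\<^sub>l m)"
  using assms
  by (intro lgraph_isoI[where \<phi> = prod.swap and \<psi> = prod.swap])
    (auto simp: wf_lgraph_def lg_defs Pi_iff intro!: bij_betwI[where g = prod.swap])

end

section \<open>Transport of symmetric monoidal structure\<close>

lemma (in cat) Hom_Ob: "f \<in> Hom C A B \<Longrightarrow> A \<in> Ob C \<and> B \<in> Ob C"
  using Dom_in_Ob Cod_in_Ob by (auto simp: Hom_def)

lemma (in cat) Id_in_Isos: "A \<in> Ob C \<Longrightarrow> Id C A \<in> Isos C A A"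
  using Id_in_Hom[of A] Id_left[of "Id C A" A A] by (auto simp: Isos_def)

lemma (in cat) Inv_eqI:
  assumes "h \<in> Hom C A B" "k \<in> Hom C B A" "h \<Zcomp> k = Id C A" "k \<Zcomp> h = Id C B"
  shows "Inv C h = k"
proof -
  have [simp]: "Dom C h = A" "Cod C h = B" using assms by (auto simp: Hom_def)
  have "k' = k" if "k' \<in> Hom C B A" "h \<Zcomp> k' = Id C A" "k' \<Zcomp> h = Id C B" for k'
  proof -
    have "k' = (k \<Zcomp> h) \<Zcomp> k'" using that assms by (simp add: Id_left)
    also have "\<dots> = k" using that assms Comp_assoc[of k B A h B k' A] by (simp add: Id_right)
    finally show ?thesis .
  qed
  then show ?thesis
    unfolding Inv_def \<open>Dom C h = A\<close> \<open>Cod C h = B\<close> using assms by (blast intro: the_equality)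
qed

text \<open>Since \<open>Fa\<close> is injective on each hom-set, every axiom of \<open>M\<close> can be checked after applying it.\<close>

lemma strict_isomorphism_transport:
  fixes M :: "('o, 'm, 'y) smc_data_scheme" and N :: "('p, 'n, 'z) smc_data_scheme"
  assumes N: "symmetric_monoidal_category N"
    and Ob: "bij_betw Fo (Ob M) (Ob N)"
    and Arr: "\<And>f. f \<in> Arr M \<Longrightarrow> Dom M f \<in> Ob M \<and> Cod M f \<in> Ob M"
    and Hom: "\<And>A B. A \<in> Ob M \<Longrightarrow> B \<in> Ob M \<Longrightarrow> bij_betw Fa (Hom M A B) (Hom N (Fo A) (Fo B))"
    and Id: "\<And>A. A \<in> Ob M \<Longrightarrow> Id M A \<in> Hom M A A \<and> Fa (Id M A) = Id N (Fo A)"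
    and Comp: "\<And>f g A B D. f \<in> Hom M A B \<Longrightarrow> g \<in> Hom M B D \<Longrightarrow>
      f \<Zcomp>\<^bsub>M\<^esub> g \<in> Hom M A D \<and> Fa (f \<Zcomp>\<^bsub>M\<^esub> g) = Fa f \<Zcomp>\<^bsub>N\<^esub> Fa g"
    and Unit: "\<one>\<^bsub>M\<^esub> \<in> Ob M" "Fo \<one>\<^bsub>M\<^esub> = \<one>\<^bsub>N\<^esub>"
    and Ten: "\<And>A B. A \<in> Ob M \<Longrightarrow> B \<in> Ob M \<Longrightarrow> A \<odot>\<^bsub>M\<^esub> B \<in> Ob M \<and> Fo (A \<odot>\<^bsub>M\<^esub> B) = Fo A \<odot>\<^bsub>N\<^esub> Fo B"
    and TenA: "\<And>f g A B A' B'. f \<in> Hom M A B \<Longrightarrow> g \<in> Hom M A' B' \<Longrightarrow>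
      f \<otimes>\<^bsub>M\<^esub> g \<in> Hom M (A \<odot>\<^bsub>M\<^esub> A') (B \<odot>\<^bsub>M\<^esub> B') \<and> Fa (f \<otimes>\<^bsub>M\<^esub> g) = Fa f \<otimes>\<^bsub>N\<^esub> Fa g"
    and Assoc: "\<And>A B D. A \<in> Ob M \<Longrightarrow> B \<in> Ob M \<Longrightarrow> D \<in> Ob M \<Longrightarrow>
      \<alpha>\<^bsub>M\<^esub> A B D \<in> Hom M ((A \<odot>\<^bsub>M\<^esub> B) \<odot>\<^bsub>M\<^esub> D) (A \<odot>\<^bsub>M\<^esub> (B \<odot>\<^bsub>M\<^esub> D)) \<and> Fa (\<alpha>\<^bsub>M\<^esub> A B D) = \<alpha>\<^bsub>N\<^esub> (Fo A) (Fo B) (Fo D)"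
    and LUnit: "\<And>A. A \<in> Ob M \<Longrightarrow> \<l>\<^bsub>M\<^esub> A \<in> Hom M (\<one>\<^bsub>M\<^esub> \<odot>\<^bsub>M\<^esub> A) A \<and> Fa (\<l>\<^bsub>M\<^esub> A) = \<l>\<^bsub>N\<^esub> (Fo A)"
    and RUnit: "\<And>A. A \<in> Ob M \<Longrightarrow> \<r>\<^bsub>M\<^esub> A \<in> Hom M (A \<odot>\<^bsub>M\<^esub> \<one>\<^bsub>M\<^esub>) A \<and> Fa (\<r>\<^bsub>M\<^esub> A) = \<r>\<^bsub>N\<^esub> (Fo A)"
    and Sym: "\<And>A B. A \<in> Ob M \<Longrightarrow> B \<in> Ob M \<Longrightarrow>
      \<sigma>\<^bsub>M\<^esub> A B \<in> Hom M (A \<odot>\<^bsub>M\<^esub> B) (B \<odot>\<^bsub>M\<^esub> A) \<and> Fa (\<sigma>\<^bsub>M\<^esub> A B) = \<sigma>\<^bsub>N\<^esub> (Fo A) (Fo B)"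
  shows "symmetric_monoidal_isomorphism M N Fo Fa (\<lambda>A B. Id N (Fo A \<odot>\<^bsub>N\<^esub> Fo B)) (Id N \<one>\<^bsub>N\<^esub>)"
proof -
  interpret N: symmetric_monoidal_category N by fact
  have FoOb: "Fo A \<in> Ob N" if "A \<in> Ob M" for A using Ob that by (auto simp: bij_betw_def)
  have HomOb: "A \<in> Ob M" "B \<in> Ob M" if "f \<in> Hom M A B" for f A B
    using Arr that by (auto simp: Hom_def)
  have FaHom: "Fa f \<in> Hom N (Fo A) (Fo B)" if "f \<in> Hom M A B" for f A B
    using Hom HomOb[OF that] that by (auto simp: bij_betw_def)
  have inj: "f = g" if "Fa f = Fa g" "f \<in> Hom M A B" "g \<in> Hom M A B" for f g A B
    using Hom[OF HomOb[OF that(2)]] that by (auto simp: bij_betw_def inj_on_def)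
  \<comment> \<open>\<open>T f f' A B\<close> tracks an arrow of \<open>M\<close> together with its
    image. Resolution with the rules below computes the images of both sides of an equation, and
    \<open>T_eq\<close> leaves the corresponding axiom of \<open>N\<close>.\<close>
  define T where "T f f' A B \<longleftrightarrow> f \<in> Hom M A B \<and> Fa f = f'" for f f' A B
  have T_eq: "f = g" if "T f f' A B" "T g g' A B" "f' = g'" for f f' g g' A B
    using that inj by (auto simp: T_def)
  have T_Hom: "T f (Fa f) A B" if "f \<in> Hom M A B" for f A B
    using that by (simp add: T_def)
  have T_Comp: "T (f \<Zcomp>\<^bsub>M\<^esub> g) (f' \<Zcomp>\<^bsub>N\<^esub> g') A D" if "T f f' A B" "T g g' B D" for f f' g g' A B D
    using that Comp[of f A B g D] by (simp add: T_def)
  have T_TenA: "T (f \<otimes>\<^bsub>M\<^esub> g) (f' \<otimes>\<^bsub>N\<^esub> g') (A \<odot>\<^bsub>M\<^esub> A') (B \<odot>\<^bsub>M\<^esub> B')"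
    if "T f f' A B" "T g g' A' B'" for f f' g g' A B A' B'
    using that TenA[of f A B g A' B'] by (simp add: T_def)
  have T_structure:
    "T (Id M A) (Id N (Fo A)) A A"
    "T (\<l>\<^bsub>M\<^esub> A) (\<l>\<^bsub>N\<^esub> (Fo A)) (\<one>\<^bsub>M\<^esub> \<odot>\<^bsub>M\<^esub> A) A" "T (\<r>\<^bsub>M\<^esub> A) (\<r>\<^bsub>N\<^esub> (Fo A)) (A \<odot>\<^bsub>M\<^esub> \<one>\<^bsub>M\<^esub>) A"
    if "A \<in> Ob M" for A
    using Id LUnit RUnit that by (simp_all add: T_def)
  have T_Assoc: "T (\<alpha>\<^bsub>M\<^esub> A B D) (\<alpha>\<^bsub>N\<^esub> (Fo A) (Fo B) (Fo D)) ((A \<odot>\<^bsub>M\<^esub> B) \<odot>\<^bsub>M\<^esub> D) (A \<odot>\<^bsub>M\<^esub> (B \<odot>\<^bsub>M\<^esub> D))"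
    if "A \<in> Ob M" "B \<in> Ob M" "D \<in> Ob M" for A B D
    using Assoc that by (simp add: T_def)
  have T_Sym: "T (\<sigma>\<^bsub>M\<^esub> A B) (\<sigma>\<^bsub>N\<^esub> (Fo A) (Fo B)) (A \<odot>\<^bsub>M\<^esub> B) (B \<odot>\<^bsub>M\<^esub> A)"
    if "A \<in> Ob M" "B \<in> Ob M" for A B
    using Sym that by (simp add: T_def)
  note TenOb = conjunct1[OF Ten] and FoTen = conjunct2[OF Ten]
  note T_rules = T_Comp T_TenA T_structure T_Assoc T_Sym T_Hom TenOb Unit(1)
  have FaT: "Fa f = f'" if "T f f' A B" for f f' A B using that by (simp add: T_def)
  have isos: "f \<in> Isos M A B" if f: "T f f' A B" and f': "f' \<in> Isos N (Fo A) (Fo B)" for f f' A B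
  proof -
    obtain k where k: "k \<in> Hom N (Fo B) (Fo A)" "f' \<Zcomp>\<^bsub>N\<^esub> k = Id N (Fo A)" "k \<Zcomp>\<^bsub>N\<^esub> f' = Id N (Fo B)"
      using f' by (auto simp: Isos_def)
    have ob: "A \<in> Ob M" "B \<in> Ob M" using f HomOb by (auto simp: T_def)
    \<comment> \<open>Fullness lifts the inverse from \<open>N\<close>; faithfulness then shows that
      the lift is an inverse in \<open>M\<close>.\<close>
    obtain k' where "k' \<in> Hom M B A" "Fa k' = k"
      using Hom[OF ob(2,1)] k(1) by (metis bij_betw_imp_surj_on imageE)
    then have k': "T k' k B A" by (simp add: T_def)
    have "f \<Zcomp>\<^bsub>M\<^esub> k' = Id M A" "k' \<Zcomp>\<^bsub>M\<^esub> f = Id M B"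
      by (rule T_eq, (rule T_Comp f k' T_structure ob)+, rule k)+
    then show ?thesis using f k' by (auto simp: Isos_def T_def)
  qed
  have Hom_Isos: "Fa f \<in> Isos N (Fo A) (Fo B)" if f: "f \<in> Isos M A B" for f A B
  proof -
    obtain k where k: "f \<in> Hom M A B" "k \<in> Hom M B A" "f \<Zcomp>\<^bsub>M\<^esub> k = Id M A" "k \<Zcomp>\<^bsub>M\<^esub> f = Id M B"
      using f by (auto simp: Isos_def)
    then have "Fa f \<Zcomp>\<^bsub>N\<^esub> Fa k = Id N (Fo A)" "Fa k \<Zcomp>\<^bsub>N\<^esub> Fa f = Id N (Fo B)"
      using Comp[OF k(1,2)] Comp[OF k(2,1)] Id HomOb[OF k(1)] by auto
    then show ?thesis using k FaHom by (auto simp: Isos_def)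
  qed
  interpret M: cat M
  proof
    show "Dom M f \<in> Ob M" "Cod M f \<in> Ob M" if "f \<in> Arr M" for f using Arr that by auto
    show "Id M A \<in> Hom M A A" if "A \<in> Ob M" for A using Id that by blast
    show "f \<Zcomp>\<^bsub>M\<^esub> g \<in> Hom M A D" if "f \<in> Hom M A B" "g \<in> Hom M B D" for f g A B D
      using Comp that by blast
    fix f A B assume f: "f \<in> Hom M A B"
    show "Id M A \<Zcomp>\<^bsub>M\<^esub> f = f"
      by (rule T_eq, (rule T_rules HomOb[OF f] f)+, rule N.Id_left, (rule FaHom f)+)
    show "f \<Zcomp>\<^bsub>M\<^esub> Id M B = f"
      by (rule T_eq, (rule T_rules HomOb[OF f] f)+, rule N.Id_right, (rule FaHom f)+)
    fix g h D E assume gh: "g \<in> Hom M B D" "h \<in> Hom M D E"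
    show "(f \<Zcomp>\<^bsub>M\<^esub> g) \<Zcomp>\<^bsub>M\<^esub> h = f \<Zcomp>\<^bsub>M\<^esub> (g \<Zcomp>\<^bsub>M\<^esub> h)"
      by (rule T_eq, (rule T_Comp T_Hom f gh)+, rule N.Comp_assoc; (rule FaHom f gh)+)
  qed
  interpret M: symmetric_monoidal_category M
  proof
    show "\<one>\<^bsub>M\<^esub> \<in> Ob M" by (rule Unit)
    fix A B assume A: "A \<in> Ob M" and B: "B \<in> Ob M"
    show "A \<odot>\<^bsub>M\<^esub> B \<in> Ob M" using A B by (rule TenOb)
    show "Id M A \<otimes>\<^bsub>M\<^esub> Id M B = Id M (A \<odot>\<^bsub>M\<^esub> B)"
      by (rule T_eq, (rule T_rules A B)+, simp add: FoTen A B N.TenA_Id FoOb)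
    show "\<l>\<^bsub>M\<^esub> A \<in> Isos M (\<one>\<^bsub>M\<^esub> \<odot>\<^bsub>M\<^esub> A) A" "\<r>\<^bsub>M\<^esub> A \<in> Isos M (A \<odot>\<^bsub>M\<^esub> \<one>\<^bsub>M\<^esub>) A"
      by (rule isos, (rule T_rules A)+, simp add: FoTen Unit A N.LUnit_iso N.RUnit_iso FoOb)+
    show "\<sigma>\<^bsub>M\<^esub> A B \<in> Hom M (A \<odot>\<^bsub>M\<^esub> B) (B \<odot>\<^bsub>M\<^esub> A)" using Sym A B by blast
    show "\<sigma>\<^bsub>M\<^esub> A B \<Zcomp>\<^bsub>M\<^esub> \<sigma>\<^bsub>M\<^esub> B A = Id M (A \<odot>\<^bsub>M\<^esub> B)"
      by (rule T_eq, (rule T_rules A B)+, simp add: FoTen A B N.Sym_Sym FoOb)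
    show "\<alpha>\<^bsub>M\<^esub> A \<one>\<^bsub>M\<^esub> B \<Zcomp>\<^bsub>M\<^esub> (Id M A \<otimes>\<^bsub>M\<^esub> \<l>\<^bsub>M\<^esub> B) = \<r>\<^bsub>M\<^esub> A \<otimes>\<^bsub>M\<^esub> Id M B"
      by (rule T_eq, (rule T_rules A B)+, simp add: FoTen A B Unit N.triangle FoOb)
    fix D assume D: "D \<in> Ob M"
    show "\<alpha>\<^bsub>M\<^esub> A B D \<in> Isos M ((A \<odot>\<^bsub>M\<^esub> B) \<odot>\<^bsub>M\<^esub> D) (A \<odot>\<^bsub>M\<^esub> (B \<odot>\<^bsub>M\<^esub> D))"
      by (rule isos, (rule T_rules A B D)+, simp add: FoTen TenOb A B D N.Assoc_iso FoOb)
    show "\<alpha>\<^bsub>M\<^esub> A B D \<Zcomp>\<^bsub>M\<^esub> \<sigma>\<^bsub>M\<^esub> A (B \<odot>\<^bsub>M\<^esub> D) \<Zcomp>\<^bsub>M\<^esub> \<alpha>\<^bsub>M\<^esub> B D A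
        = (\<sigma>\<^bsub>M\<^esub> A B \<otimes>\<^bsub>M\<^esub> Id M D) \<Zcomp>\<^bsub>M\<^esub> \<alpha>\<^bsub>M\<^esub> B A D \<Zcomp>\<^bsub>M\<^esub> (Id M B \<otimes>\<^bsub>M\<^esub> \<sigma>\<^bsub>M\<^esub> A D)"
      by (rule T_eq, (rule T_rules A B D)+, simp add: FoTen TenOb A B D N.hexagon FoOb)
    fix E assume E: "E \<in> Ob M"
    show "(\<alpha>\<^bsub>M\<^esub> A B D \<otimes>\<^bsub>M\<^esub> Id M E) \<Zcomp>\<^bsub>M\<^esub> \<alpha>\<^bsub>M\<^esub> A (B \<odot>\<^bsub>M\<^esub> D) E \<Zcomp>\<^bsub>M\<^esub> (Id M A \<otimes>\<^bsub>M\<^esub> \<alpha>\<^bsub>M\<^esub> B D E)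
        = \<alpha>\<^bsub>M\<^esub> (A \<odot>\<^bsub>M\<^esub> B) D E \<Zcomp>\<^bsub>M\<^esub> \<alpha>\<^bsub>M\<^esub> A B (D \<odot>\<^bsub>M\<^esub> E)"
      by (rule T_eq, (rule T_rules A B D E)+, simp add: FoTen TenOb A B D E N.pentagon FoOb)
  next
    fix f g f' g' A B D A' B' D'
    assume h: "f \<in> Hom M A B" "g \<in> Hom M B D" "f' \<in> Hom M A' B'" "g' \<in> Hom M B' D'"
    show "(f \<Zcomp>\<^bsub>M\<^esub> g) \<otimes>\<^bsub>M\<^esub> (f' \<Zcomp>\<^bsub>M\<^esub> g') = (f \<otimes>\<^bsub>M\<^esub> f') \<Zcomp>\<^bsub>M\<^esub> (g \<otimes>\<^bsub>M\<^esub> g')"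
      by (rule T_eq, (rule T_Comp T_TenA T_Hom h)+, rule N.TenA_Comp; (rule FaHom h)+)
  next
    fix f f' A B A' B' assume h: "f \<in> Hom M A B" "f' \<in> Hom M A' B'"
    show "f \<otimes>\<^bsub>M\<^esub> f' \<in> Hom M (A \<odot>\<^bsub>M\<^esub> A') (B \<odot>\<^bsub>M\<^esub> B')" using TenA h by blast
  next
    fix f g h A B D A' B' D'
    assume h: "f \<in> Hom M A A'" "g \<in> Hom M B B'" "h \<in> Hom M D D'"
    show "((f \<otimes>\<^bsub>M\<^esub> g) \<otimes>\<^bsub>M\<^esub> h) \<Zcomp>\<^bsub>M\<^esub> \<alpha>\<^bsub>M\<^esub> A' B' D' = \<alpha>\<^bsub>M\<^esub> A B D \<Zcomp>\<^bsub>M\<^esub> (f \<otimes>\<^bsub>M\<^esub> (g \<otimes>\<^bsub>M\<^esub> h))"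
      by (rule T_eq, (rule T_Comp T_TenA T_Assoc T_Hom h HomOb[OF h(1)] HomOb[OF h(2)] HomOb[OF h(3)])+,
          rule N.Assoc_nat; (rule FaHom h)+)
  next
    fix f A B assume f: "f \<in> Hom M A B"
    note rules = T_Comp T_TenA T_structure T_Hom f Unit(1) HomOb[OF f]
    show "(Id M \<one>\<^bsub>M\<^esub> \<otimes>\<^bsub>M\<^esub> f) \<Zcomp>\<^bsub>M\<^esub> \<l>\<^bsub>M\<^esub> B = \<l>\<^bsub>M\<^esub> A \<Zcomp>\<^bsub>M\<^esub> f"
      by (rule T_eq, (rule rules)+, simp add: Unit N.LUnit_nat FaHom[OF f])
    show "(f \<otimes>\<^bsub>M\<^esub> Id M \<one>\<^bsub>M\<^esub>) \<Zcomp>\<^bsub>M\<^esub> \<r>\<^bsub>M\<^esub> B = \<r>\<^bsub>M\<^esub> A \<Zcomp>\<^bsub>M\<^esub> f"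
      by (rule T_eq, (rule rules)+, simp add: Unit N.RUnit_nat FaHom[OF f])
  next
    fix f g A A' B B' assume h: "f \<in> Hom M A A'" "g \<in> Hom M B B'"
    show "(f \<otimes>\<^bsub>M\<^esub> g) \<Zcomp>\<^bsub>M\<^esub> \<sigma>\<^bsub>M\<^esub> A' B' = \<sigma>\<^bsub>M\<^esub> A B \<Zcomp>\<^bsub>M\<^esub> (g \<otimes>\<^bsub>M\<^esub> f)"
      by (rule T_eq, (rule T_Comp T_TenA T_Sym T_Hom h HomOb[OF h(1)] HomOb[OF h(2)])+,
          rule N.Sym_nat; (rule FaHom h)+)
  qed
  show ?thesis
  proof
    show "Fo A \<in> Ob N" if "A \<in> Ob M" for A using that by (rule FoOb)
    show "Fa f \<in> Hom N (Fo A) (Fo B)" if "f \<in> Hom M A B" for f A B using that by (rule FaHom)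
    show "Fa (Id M A) = Id N (Fo A)" if "A \<in> Ob M" for A using that Id by blast
    show "Fa (f \<Zcomp>\<^bsub>M\<^esub> g) = Fa f \<Zcomp>\<^bsub>N\<^esub> Fa g" if "f \<in> Hom M A B" "g \<in> Hom M B D" for f g A B D
      using that Comp by blast
    \<comment> \<open>\<open>Fo\<close> preserves tensor and unit on the nose, so identities serve
      as comparison arrows, and every coherence law reduces to \<open>Fa\<close> preserving the
      corresponding structural arrow.\<close>
    show "Id N (Fo A \<odot>\<^bsub>N\<^esub> Fo B) \<in> Isos N (Fo A \<odot>\<^bsub>N\<^esub> Fo B) (Fo (A \<odot>\<^bsub>M\<^esub> B))"
      if "A \<in> Ob M" "B \<in> Ob M" for A B
      using that by (simp add: FoTen N.Id_in_Isos N.Ten_in_Ob FoOb)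
    show "Id N \<one>\<^bsub>N\<^esub> \<in> Isos N \<one>\<^bsub>N\<^esub> (Fo \<one>\<^bsub>M\<^esub>)"
      by (simp add: Unit N.Id_in_Isos N.Unit_in_Ob)
    show "(Fa f \<otimes>\<^bsub>N\<^esub> Fa g) \<Zcomp>\<^bsub>N\<^esub> Id N (Fo A' \<odot>\<^bsub>N\<^esub> Fo B') = Id N (Fo A \<odot>\<^bsub>N\<^esub> Fo B) \<Zcomp>\<^bsub>N\<^esub> Fa (f \<otimes>\<^bsub>M\<^esub> g)"
      if "f \<in> Hom M A A'" "g \<in> Hom M B B'" for f g A A' B B'
    proof -
      have "Fa f \<otimes>\<^bsub>N\<^esub> Fa g \<in> Hom N (Fo A \<odot>\<^bsub>N\<^esub> Fo B) (Fo A' \<odot>\<^bsub>N\<^esub> Fo B')"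
        using that by (intro N.TenA_in_Hom FaHom)
      then show ?thesis using TenA[OF that] by (simp add: N.Id_left N.Id_right)
    qed
    show "bij_betw Fa (Hom M A B) (Hom N (Fo A) (Fo B))" if "A \<in> Ob M" "B \<in> Ob M" for A B
      using that by (rule Hom)
    show "bij_betw Fo (Ob M) (Ob N)" by (rule Ob)
    fix A assume A: "A \<in> Ob M"
    note A' = FoOb[OF A]
    have u: "\<l>\<^bsub>N\<^esub> (Fo A) \<in> Hom N (\<one>\<^bsub>N\<^esub> \<odot>\<^bsub>N\<^esub> Fo A) (Fo A)" "\<r>\<^bsub>N\<^esub> (Fo A) \<in> Hom N (Fo A \<odot>\<^bsub>N\<^esub> \<one>\<^bsub>N\<^esub>) (Fo A)"
      using N.LUnit_iso N.RUnit_iso A' by (auto simp: Isos_def)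
    show "(Id N \<one>\<^bsub>N\<^esub> \<otimes>\<^bsub>N\<^esub> Id N (Fo A)) \<Zcomp>\<^bsub>N\<^esub> Id N (Fo \<one>\<^bsub>M\<^esub> \<odot>\<^bsub>N\<^esub> Fo A) \<Zcomp>\<^bsub>N\<^esub> Fa (\<l>\<^bsub>M\<^esub> A) = \<l>\<^bsub>N\<^esub> (Fo A)"
      using u LUnit[OF A] A' N.Id_left[OF N.Id_in_Hom]
      by (simp add: Unit N.TenA_Id N.Unit_in_Ob N.Ten_in_Ob N.Id_left)
    show "(Id N (Fo A) \<otimes>\<^bsub>N\<^esub> Id N \<one>\<^bsub>N\<^esub>) \<Zcomp>\<^bsub>N\<^esub> Id N (Fo A \<odot>\<^bsub>N\<^esub> Fo \<one>\<^bsub>M\<^esub>) \<Zcomp>\<^bsub>N\<^esub> Fa (\<r>\<^bsub>M\<^esub> A) = \<r>\<^bsub>N\<^esub> (Fo A)"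
      using u RUnit[OF A] A' N.Id_left[OF N.Id_in_Hom]
      by (simp add: Unit N.TenA_Id N.Unit_in_Ob N.Ten_in_Ob N.Id_left)
    fix B assume B: "B \<in> Ob M"
    note B' = FoOb[OF B]
    have s: "\<sigma>\<^bsub>N\<^esub> (Fo A) (Fo B) \<in> Hom N (Fo A \<odot>\<^bsub>N\<^esub> Fo B) (Fo B \<odot>\<^bsub>N\<^esub> Fo A)"
      using N.Sym_in_Hom A' B' by blast
    show "Id N (Fo A \<odot>\<^bsub>N\<^esub> Fo B) \<Zcomp>\<^bsub>N\<^esub> Fa (\<sigma>\<^bsub>M\<^esub> A B) = \<sigma>\<^bsub>N\<^esub> (Fo A) (Fo B) \<Zcomp>\<^bsub>N\<^esub> Id N (Fo B \<odot>\<^bsub>N\<^esub> Fo A)"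
      using s Sym[OF A B] by (simp add: N.Id_left N.Id_right)
    fix D assume D: "D \<in> Ob M"
    note D' = FoOb[OF D]
    have "\<alpha>\<^bsub>N\<^esub> (Fo A) (Fo B) (Fo D) \<in> Hom N ((Fo A \<odot>\<^bsub>N\<^esub> Fo B) \<odot>\<^bsub>N\<^esub> Fo D) (Fo A \<odot>\<^bsub>N\<^esub> (Fo B \<odot>\<^bsub>N\<^esub> Fo D))"
      using N.Assoc_iso A' B' D' by (auto simp: Isos_def)
    then show "(Id N (Fo A \<odot>\<^bsub>N\<^esub> Fo B) \<otimes>\<^bsub>N\<^esub> Id N (Fo D)) \<Zcomp>\<^bsub>N\<^esub> Id N (Fo (A \<odot>\<^bsub>M\<^esub> B) \<odot>\<^bsub>N\<^esub> Fo D) \<Zcomp>\<^bsub>N\<^esub> Fa (\<alpha>\<^bsub>M\<^esub> A B D)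
        = \<alpha>\<^bsub>N\<^esub> (Fo A) (Fo B) (Fo D) \<Zcomp>\<^bsub>N\<^esub> (Id N (Fo A) \<otimes>\<^bsub>N\<^esub> Id N (Fo B \<odot>\<^bsub>N\<^esub> Fo D)) \<Zcomp>\<^bsub>N\<^esub> Id N (Fo A \<odot>\<^bsub>N\<^esub> Fo (B \<odot>\<^bsub>M\<^esub> D))"
      using Assoc[OF A B D] A' B' D' N.Id_left[OF N.Id_in_Hom]
      by (simp add: FoTen A B D N.TenA_Id N.Ten_in_Ob N.Id_left N.Id_right)
  qed
qed

section \<open>Spans in a category of graph-like objects\<close>

text \<open>Pullbacks and products differ only in the condition imposed on a pair of arrows, so one
  notion with a free condition \<open>\<Phi>\<close> serves both.\<close>

definition universal_cone ::
  "('o, 'm, 'z) cat_data_scheme \<Rightarrow> 'o \<Rightarrow> 'o \<Rightarrow> ('m \<Rightarrow> 'm \<Rightarrow> bool) \<Rightarrow> 'm \<Rightarrow> 'm \<Rightarrow> bool" where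
  "universal_cone C G H \<Phi> p q \<longleftrightarrow>
     p \<in> Hom C (Dom C p) G \<and> q \<in> Hom C (Dom C p) H \<and> \<Phi> p q \<and>
     (\<forall>Z. \<forall>a \<in> Hom C Z G. \<forall>b \<in> Hom C Z H. \<Phi> a b \<longrightarrow>
        (\<exists>!u. u \<in> Hom C Z (Dom C p) \<and> u \<Zcomp> p = a \<and> u \<Zcomp> q = b))"
  for C (structure)

text \<open>Lets a condition on labels be exchanged for an equation of composites, which agree only
  on arrows with the right codomains.\<close>

lemma universal_cone_cong:
  assumes "\<And>Z a b. a \<in> Hom C Z G \<Longrightarrow> b \<in> Hom C Z H \<Longrightarrow> \<Phi> a b \<longleftrightarrow> \<Psi> a b"
  shows "universal_cone C G H \<Phi> p q \<longleftrightarrow> universal_cone C G H \<Psi> p q"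
  using assms unfolding universal_cone_def by meson

lemma is_product_cone: "is_product C G H p q \<longleftrightarrow> universal_cone C G H (\<lambda>_ _. True) p q"
  by (simp add: is_product_def universal_cone_def)

lemma is_pullback_cone:
  "f \<in> Arr C \<Longrightarrow> g \<in> Arr C \<Longrightarrow> Cod C f = Cod C g \<Longrightarrow> is_pullback C f g p q \<longleftrightarrow>
    universal_cone C (Dom C f) (Dom C g) (\<lambda>a b. a \<Zcomp>\<^bsub>C\<^esub> f = b \<Zcomp>\<^bsub>C\<^esub> g) p q"
  by (auto simp: is_pullback_def universal_cone_def)

section \<open>Uniqueness and transport of universal cones\<close>

context cat
begin

lemma universal_cone_eqI:
  assumes cone: "universal_cone C G H \<Phi> p q" and "\<Phi> (u \<Zcomp> p) (u \<Zcomp> q)"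
    and "u \<in> Hom C Z (Dom C p)" "v \<in> Hom C Z (Dom C p)" "u \<Zcomp> p = v \<Zcomp> p" "u \<Zcomp> q = v \<Zcomp> q"
  shows "u = v"
proof -
  have "u \<Zcomp> p \<in> Hom C Z G" "u \<Zcomp> q \<in> Hom C Z H"
    using assms by (auto simp: universal_cone_def intro: Comp_in_Hom)
  then have "\<exists>!w. w \<in> Hom C Z (Dom C p) \<and> w \<Zcomp> p = u \<Zcomp> p \<and> w \<Zcomp> q = u \<Zcomp> q"
    using cone assms(2) unfolding universal_cone_def by blast
  then show ?thesis using assms(3-) by metis
qed

text \<open>Makes the isomorphism class of a composite or tensor independent of the pullback or
  product that was used.\<close>

lemma universal_cone_unique:
  assumes c: "universal_cone C G H \<Phi> p q" and c': "universal_cone C G H \<Phi> p' q'"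
  shows "\<exists>h \<in> Isos C (Dom C p) (Dom C p'). h \<Zcomp> p' = p \<and> h \<Zcomp> q' = q"
proof -
  let ?P = "Dom C p" and ?P' = "Dom C p'"
  have p: "p \<in> Hom C ?P G" "q \<in> Hom C ?P H" "\<Phi> p q" and p': "p' \<in> Hom C ?P' G" "q' \<in> Hom C ?P' H" "\<Phi> p' q'"
    using c c' by (auto simp: universal_cone_def)
  obtain h where h: "h \<in> Hom C ?P ?P'" "h \<Zcomp> p' = p" "h \<Zcomp> q' = q"
    using c' p unfolding universal_cone_def by blast
  obtain k where k: "k \<in> Hom C ?P' ?P" "k \<Zcomp> p = p'" "k \<Zcomp> q = q'"
    using c p' unfolding universal_cone_def by blast
  have "(h \<Zcomp> k) \<Zcomp> p = p" "(h \<Zcomp> k) \<Zcomp> q = q" "(k \<Zcomp> h) \<Zcomp> p' = p'" "(k \<Zcomp> h) \<Zcomp> q' = q'"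
    using h k p p' Comp_assoc by metis+
  note eqs = this
  have P: "?P \<in> Ob C" "?P' \<in> Ob C" using Hom_Ob[OF h(1)] by auto
  have "h \<Zcomp> k = Id C ?P"
    using eqs p by (intro universal_cone_eqI[OF c _ Comp_in_Hom[OF h(1) k(1)] Id_in_Hom[OF P(1)]])
      (simp_all add: Id_left)
  moreover have "k \<Zcomp> h = Id C ?P'"
    using eqs p' by (intro universal_cone_eqI[OF c' _ Comp_in_Hom[OF k(1) h(1)] Id_in_Hom[OF P(2)]])
      (simp_all add: Id_left)
  ultimately show ?thesis using h k by (auto simp: Isos_def)
qed

text \<open>Makes the set of composites closed under isomorphism of spans: an isomorphism onto the
  apex can be absorbed into the cone. Since \<open>\<Phi>\<close> is arbitrary, its validity for the
  new pair is assumed; for pullbacks it follows by associativity, for products it is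
  trivial.\<close>

lemma universal_cone_iso:
  assumes c: "universal_cone C G H \<Phi> p q" and h: "h \<in> Isos C P (Dom C p)"
    and \<Phi>: "\<Phi> (h \<Zcomp> p) (h \<Zcomp> q)"
  shows "universal_cone C G H \<Phi> (h \<Zcomp> p) (h \<Zcomp> q)"
proof -
  have p: "p \<in> Hom C (Dom C p) G" "q \<in> Hom C (Dom C p) H" using c by (auto simp: universal_cone_def)
  obtain k where h': "h \<in> Hom C P (Dom C p)" and k: "k \<in> Hom C (Dom C p) P"
    "h \<Zcomp> k = Id C P" "k \<Zcomp> h = Id C (Dom C p)"
    using h by (auto simp: Isos_def)
  have hp: "h \<Zcomp> p \<in> Hom C P G" "h \<Zcomp> q \<in> Hom C P H" using h' p by (auto intro: Comp_in_Hom)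
  then have dom: "Dom C (h \<Zcomp> p) = P" by (simp add: Hom_def)
  have "\<exists>!u. u \<in> Hom C Z P \<and> u \<Zcomp> (h \<Zcomp> p) = a \<and> u \<Zcomp> (h \<Zcomp> q) = b"
    if ab: "a \<in> Hom C Z G" "b \<in> Hom C Z H" "\<Phi> a b" for Z a b
  proof -
    have ex1: "\<exists>!u. u \<in> Hom C Z (Dom C p) \<and> u \<Zcomp> p = a \<and> u \<Zcomp> q = b"
      using c ab unfolding universal_cone_def by blast
    then obtain u where u: "u \<in> Hom C Z (Dom C p)" "u \<Zcomp> p = a" "u \<Zcomp> q = b" by blast
    show ?thesis
    proof (rule ex1I[of _ "u \<Zcomp> k"])
      have "(u \<Zcomp> k) \<Zcomp> h = u"
        using u k h' Comp_assoc[of u _ _ k _ h] by (simp add: Id_right)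
      then show "u \<Zcomp> k \<in> Hom C Z P \<and> (u \<Zcomp> k) \<Zcomp> (h \<Zcomp> p) = a \<and> (u \<Zcomp> k) \<Zcomp> (h \<Zcomp> q) = b"
        using u(2,3) Comp_in_Hom[OF u(1) k(1)] Comp_assoc[OF Comp_in_Hom[OF u(1) k(1)] h' p(1)]
          Comp_assoc[OF Comp_in_Hom[OF u(1) k(1)] h' p(2)] by simp
      fix v assume v: "v \<in> Hom C Z P \<and> v \<Zcomp> (h \<Zcomp> p) = a \<and> v \<Zcomp> (h \<Zcomp> q) = b"
      then have "v \<Zcomp> h \<in> Hom C Z (Dom C p)" "(v \<Zcomp> h) \<Zcomp> p = a" "(v \<Zcomp> h) \<Zcomp> q = b"
        using Comp_in_Hom[OF _ h'] Comp_assoc[OF _ h' p(1)] Comp_assoc[OF _ h' p(2)] by auto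
      then have "v \<Zcomp> h = u" using u ex1 by blast
      then show "v = u \<Zcomp> k"
        using v h' k Comp_assoc[of v Z P h "Dom C p" k P] Id_right[of v Z P] by simp
    qed
  qed
  then show ?thesis using hp \<Phi> unfolding universal_cone_def dom by blast
qed

end

section \<open>Components of the category of spans\<close>

lemma span_smc_simps [simp]:
  "Ob (span_smc C R X) = X"
  "Arr (span_smc C R X) = {f \<in> Arr (span_cat C). Dom (span_cat C) f \<in> X \<and> Cod (span_cat C) f \<in> X}"
  "Dom (span_smc C R X) = Dom (span_cat C)"
  "Cod (span_smc C R X) = Cod (span_cat C)"
  "Ten (span_smc C R X) = Prod R"
  "Unit (span_smc C R X) = Terminal R"
  by (simp_all add: span_smc_def full_sub_def cat_data.defs smc_data.defs)

lemma span_smc_ops: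
  "Id (span_smc C R X) = Id (span_cat C)"
  "Comp (span_smc C R X) = Comp (span_cat C)"
  "LUnit (span_smc C R X) A = span_of C (Pr2 R (Terminal R) A)"
  "RUnit (span_smc C R X) A = span_of C (Pr1 R A (Terminal R))"
  "Sym (span_smc C R X) A B = span_of C (pairing C R B A (Pr2 R A B) (Pr1 R A B))"
  "Assoc (span_smc C R X) A B D = span_of C (pairing C R A (Prod R B D)
        (Pr1 R (Prod R A B) D \<Zcomp>\<^bsub>C\<^esub> Pr1 R A B)
        (pairing C R B D (Pr1 R (Prod R A B) D \<Zcomp>\<^bsub>C\<^esub> Pr2 R A B) (Pr2 R (Prod R A B) D)))"
  by (simp_all add: span_smc_def full_sub_def cat_data.defs smc_data.defs)

lemma span_smc_TenA: "TenA (span_smc C R X) (A, B, X') (A', B', Y') =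
   (Prod R A A', Prod R B B',
        {(pairing C R A A' (p \<Zcomp>\<^bsub>C\<^esub> f) (q \<Zcomp>\<^bsub>C\<^esub> f'), pairing C R B B' (p \<Zcomp>\<^bsub>C\<^esub> g) (q \<Zcomp>\<^bsub>C\<^esub> g')) | f g f' g' p q.
           (f, g) \<in> X' \<and> (f', g') \<in> Y' \<and> is_product C (Dom C f) (Dom C f') p q})"
  by (simp add: span_smc_def full_sub_def cat_data.defs smc_data.defs)

text \<open>A category of graph-like objects, with sets of nodes and arcs. The functor \<open>ob\<close> is right
  adjoint to \<open>ed\<close>, so a span between objects in its image is a labelled graph.\<close>

locale graph_model = cat C + set_universe U pair pt
  for C :: "('o, 'm, 'z) cat_data_scheme" (structure) and U :: "'u set set" and pair pt +
  fixes R :: "('o, 'm) products" and ob :: "'u set \<Rightarrow> 'o" and ed :: "'o \<Rightarrow> 'u set"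
    and vt :: "'o \<Rightarrow> 'v set" and sr tg :: "'o \<Rightarrow> 'u \<Rightarrow> 'v" and lab :: "'m \<Rightarrow> 'u \<Rightarrow> 'u"
  assumes ob_Ob: "A \<in> U \<Longrightarrow> ob A \<in> Ob C"
    and ed_ob: "ed (ob A) = A"
    and vt_ob: "\<exists>v. vt (ob A) = {v}"
    and sr_tg: "G \<in> Ob C \<Longrightarrow> sr G \<in> ed G \<rightarrow> vt G \<and> tg G \<in> ed G \<rightarrow> vt G"
    and lab_in: "f \<in> Hom C G H \<Longrightarrow> x \<in> ed G \<Longrightarrow> lab f x \<in> ed H"
    and lab_Id: "G \<in> Ob C \<Longrightarrow> x \<in> ed G \<Longrightarrow> lab (Id C G) x = x"
    and lab_Comp: "f \<in> Hom C G H \<Longrightarrow> g \<in> Hom C H K \<Longrightarrow> x \<in> ed G \<Longrightarrow> lab (f \<Zcomp> g) x = lab g (lab f x)"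
    and hom_ob_ex: "G \<in> Ob C \<Longrightarrow> A \<in> U \<Longrightarrow> \<theta> \<in> ed G \<rightarrow> A \<Longrightarrow>
      \<exists>k \<in> Hom C G (ob A). \<forall>x \<in> ed G. lab k x = \<theta> x"
    and hom_ob_eq: "A \<in> U \<Longrightarrow> k \<in> Hom C G (ob A) \<Longrightarrow> k' \<in> Hom C G (ob A) \<Longrightarrow>
      (\<And>x. x \<in> ed G \<Longrightarrow> lab k x = lab k' x) \<Longrightarrow> k = k'"
    and iso_ex: "G \<in> Ob C \<Longrightarrow> H \<in> Ob C \<Longrightarrow> bij_betw \<phi> (vt G) (vt H) \<Longrightarrow> bij_betw \<psi> (ed G) (ed H) \<Longrightarrow>
      \<forall>e \<in> ed G. sr H (\<psi> e) = \<phi> (sr G e) \<and> tg H (\<psi> e) = \<phi> (tg G e) \<Longrightarrow>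
      \<exists>h \<in> Isos C G H. \<forall>e \<in> ed G. lab h e = \<psi> e"
    and iso_bij: "h \<in> Isos C G H \<Longrightarrow> bij_betw (lab h) (ed G) (ed H) \<and>
      (\<exists>\<phi>. bij_betw \<phi> (vt G) (vt H) \<and>
        (\<forall>e \<in> ed G. sr H (lab h e) = \<phi> (sr G e) \<and> tg H (lab h e) = \<phi> (tg G e)))"
    and cone_ex: "G \<in> Ob C \<Longrightarrow> H \<in> Ob C \<Longrightarrow>
      \<exists>p q \<phi>. universal_cone C G H (\<lambda>a b. \<forall>x \<in> ed (Dom C a). Q (lab a x) (lab b x)) p q \<and>
        bij_betw \<phi> (vt (Dom C p)) (vt G \<times> vt H) \<and>
        bij_betw (\<lambda>x. (lab p x, lab q x)) (ed (Dom C p)) {(e, e'). e \<in> ed G \<and> e' \<in> ed H \<and> Q e e'} \<and>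
        (\<forall>x \<in> ed (Dom C p). \<phi> (sr (Dom C p) x) = (sr G (lab p x), sr H (lab q x)) \<and>
           \<phi> (tg (Dom C p) x) = (tg G (lab p x), tg H (lab q x)))"
    and Prod_ob [simp]: "Prod R (ob A) (ob B) = ob (set_prod pair A B)"
    and Terminal_ob [simp]: "Terminal R = ob {pt}"
    and Pr_Hom: "A \<in> U \<Longrightarrow> B \<in> U \<Longrightarrow> Pr1 R (ob A) (ob B) \<in> Hom C (ob (set_prod pair A B)) (ob A) \<and>
      Pr2 R (ob A) (ob B) \<in> Hom C (ob (set_prod pair A B)) (ob B)"
    and lab_Pr: "a \<in> A \<Longrightarrow> b \<in> B \<Longrightarrow> lab (Pr1 R (ob A) (ob B)) (pair a b) = a \<and>
      lab (Pr2 R (ob A) (ob B)) (pair a b) = b"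
begin

text \<open>By \<open>hom_ob_ex\<close> and \<open>hom_ob_eq\<close> an arrow from the head into
  \<open>ob A\<close> amounts to an arbitrary labelling of the arcs by \<open>A\<close>, so passing
  from a span to its graph loses nothing up to isomorphism.\<close>

definition mk :: "'m \<Rightarrow> 'm \<Rightarrow> ('v, 'u, 'u) lgraph" where
  "mk f g = \<lparr>nodes = vt (Dom C f), arcs = ed (Dom C f), tail = sr (Dom C f), head = tg (Dom C f),
     lin = lab f, lout = lab g\<rparr>"

text \<open>The argument may be any graph of any type, not just one of the form
  \<open>mk f g\<close>. So the results of \<open>lg_comp\<close> and \<open>lg_ten\<close> can be
  inserted directly.\<close>

definition cls :: "'u set \<Rightarrow> 'u set \<Rightarrow> ('w, 'e, 'u) lgraph \<Rightarrow> ('o, 'm) span_arr" where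
  "cls A B m = (ob A, ob B, {(f, g). (f, g) \<in> spans C (ob A) (ob B) \<and> mk f g \<simeq> m})"

text \<open>Guarantees that \<open>cls A B m\<close> is inhabited; a graph too large for the
  universe would give an empty class.\<close>

definition rep :: "'u set \<Rightarrow> 'u set \<Rightarrow> ('w, 'e, 'u) lgraph \<Rightarrow> bool" where
  "rep A B m \<longleftrightarrow> A \<in> U \<and> B \<in> U \<and> (\<exists>f g. (f, g) \<in> spans C (ob A) (ob B) \<and> mk f g \<simeq> m)"

definition fn :: "'u set \<Rightarrow> 'u set \<Rightarrow> ('u \<Rightarrow> 'u) \<Rightarrow> ('o, 'm) span_arr" where
  "fn A B h = cls A B (lg_fun A h)"

abbreviation S where "S \<equiv> span_smc C R (ob ` U)"

lemma ob_inj: "ob A = ob B \<longleftrightarrow> A = B"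
  by (metis ed_ob)

text \<open>For sets, \<open>ob\<close> is the identity and these rules would loop, so they are simplification rules only
  locally.\<close>

context
  notes [simp] = ed_ob ob_inj
begin

section \<open>Isomorphism classes of spans and of labelled graphs\<close>

lemma spansD: "(f, g) \<in> spans C G H \<Longrightarrow> f \<in> Hom C (Dom C f) G \<and> g \<in> Hom C (Dom C f) H"
  by (auto simp: spans_def Hom_def)

lemma spansI: "f \<in> Hom C E G \<Longrightarrow> g \<in> Hom C E H \<Longrightarrow> (f, g) \<in> spans C G H"
  by (auto simp: spans_def)

lemma mk_on: "(f, g) \<in> spans C (ob A) (ob B) \<Longrightarrow> lgraph_on A B (mk f g)"
  using spansD[of f g] sr_tg[of "Dom C f"] lab_in[of f _ "ob A"] lab_in[of g "Dom C f" "ob B"]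
    Hom_Ob[of f "Dom C f" "ob A"]
  by (auto simp: lgraph_on_def wf_lgraph_def mk_def)

lemma rep_on: "rep A B m \<Longrightarrow> lgraph_on A B m"
  using mk_on lgraph_on_iso unfolding rep_def by blast

lemma rep_U: "rep A B m \<Longrightarrow> A \<in> U" "rep A B m \<Longrightarrow> B \<in> U"
  by (auto simp: rep_def)

lemma rep_cong: "m \<simeq> n \<Longrightarrow> rep A B m \<Longrightarrow> rep A B n"
  using lgraph_iso_trans unfolding rep_def by blast

lemma cls_cong: "m \<simeq> n \<Longrightarrow> cls A B m = cls A B n"
  using lgraph_iso_trans[of _ m n] lgraph_iso_trans[OF _ lgraph_iso_sym, of _ n m]
  unfolding cls_def by auto

lemma cls_eq_iff:
  assumes "rep A B m" shows "cls A B m = cls A B n \<longleftrightarrow> m \<simeq> n"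
proof
  assume eq: "cls A B m = cls A B n"
  obtain f g where fg: "(f, g) \<in> spans C (ob A) (ob B)" "mk f g \<simeq> m" using assms by (auto simp: rep_def)
  then have "mk f g \<simeq> n" using eq by (auto simp: cls_def)
  then show "m \<simeq> n" by (rule lgraph_iso_trans[OF lgraph_iso_sym[OF fg(2)]])
qed (rule cls_cong)

text \<open>An isomorphism of heads yields bijections of nodes and arcs by \<open>iso_bij\<close>.
  Conversely \<open>iso_ex\<close> realises a pair of bijections by an isomorphism of heads; it
  commutes with the legs because arrows into \<open>ob A\<close> are determined by their
  labels.\<close>

lemma span_rel_iff:
  assumes U: "A \<in> U" "B \<in> U"
    and fg: "(f, g) \<in> spans C (ob A) (ob B)" and fg': "(f', g') \<in> spans C (ob A) (ob B)"
  shows "((f, g), (f', g')) \<in> span_rel C (ob A) (ob B) \<longleftrightarrow> mk f g \<simeq> mk f' g'"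
proof
  let ?G = "Dom C f" and ?H = "Dom C f'"
  note h1 = spansD[OF fg] and h2 = spansD[OF fg']
  {
    assume "((f, g), (f', g')) \<in> span_rel C (ob A) (ob B)"
    then obtain h where h: "h \<in> Isos C ?G ?H" "h \<Zcomp> f' = f" "h \<Zcomp> g' = g"
      by (auto simp: span_rel_def)
    obtain \<phi> where \<phi>: "bij_betw (lab h) (ed ?G) (ed ?H)" "bij_betw \<phi> (vt ?G) (vt ?H)"
      "\<forall>e \<in> ed ?G. sr ?H (lab h e) = \<phi> (sr ?G e) \<and> tg ?H (lab h e) = \<phi> (tg ?G e)"
      using iso_bij[OF h(1)] by blast
    have "h \<in> Hom C ?G ?H" using h by (simp add: Isos_def)
    then have "lab f' (lab h e) = lab f e" "lab g' (lab h e) = lab g e" if "e \<in> ed ?G" for e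
      using h h2 that lab_Comp by metis+
    then show "mk f g \<simeq> mk f' g'"
      using \<phi> lgraph_on_wf[OF mk_on[OF fg]]
      by (intro lgraph_isoI[where \<phi> = \<phi> and \<psi> = "lab h"]) (auto simp: mk_def)
  }
  assume "mk f g \<simeq> mk f' g'"
  then obtain \<phi> \<psi> where \<phi>: "bij_betw \<phi> (vt ?G) (vt ?H)" "bij_betw \<psi> (ed ?G) (ed ?H)"
    "\<forall>e \<in> ed ?G. sr ?H (\<psi> e) = \<phi> (sr ?G e) \<and> tg ?H (\<psi> e) = \<phi> (tg ?G e)"
    and l: "\<forall>e \<in> ed ?G. lab f' (\<psi> e) = lab f e \<and> lab g' (\<psi> e) = lab g e"
    by (auto simp: lgraph_iso_def mk_def)
  obtain h where h: "h \<in> Isos C ?G ?H" "\<forall>e \<in> ed ?G. lab h e = \<psi> e"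
    using iso_ex[OF _ _ \<phi>] h1 h2 Hom_Ob by blast
  have hh: "h \<in> Hom C ?G ?H" using h by (simp add: Isos_def)
  have "h \<Zcomp> f' = f" "h \<Zcomp> g' = g"
    using h1 h2 l h(2) hh U
    by (auto intro!: hom_ob_eq[of A "h \<Zcomp> f'" ?G f] hom_ob_eq[of B "h \<Zcomp> g'" ?G g]
        simp: lab_Comp[OF hh] intro: Comp_in_Hom)
  then show "((f, g), (f', g')) \<in> span_rel C (ob A) (ob B)"
    using h fg fg' by (auto simp: span_rel_def)
qed

lemma span_rel_Image:
  assumes "A \<in> U" "B \<in> U" "(f, g) \<in> spans C (ob A) (ob B)"
  shows "(ob A, ob B, span_rel C (ob A) (ob B) `` {(f, g)}) = cls A B (mk f g)"
proof -
  have "((f, g), (f', g')) \<in> span_rel C (ob A) (ob B) \<longleftrightarrow>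
      (f', g') \<in> spans C (ob A) (ob B) \<and> mk f' g' \<simeq> mk f g" for f' g'
    using span_rel_iff[OF assms, of f' g'] lgraph_iso_sym[of "mk f g" "mk f' g'"]
      lgraph_iso_sym[of "mk f' g'" "mk f g"] by (auto simp: span_rel_def)
  then show ?thesis unfolding cls_def by auto
qed

lemma Hom_S:
  assumes "A \<in> U" "B \<in> U"
  shows "Hom S (ob A) (ob B) = {cls A B (mk f g) | f g. (f, g) \<in> spans C (ob A) (ob B)}"
proof -
  have "Hom S (ob A) (ob B) =
      {(ob A, ob B, span_rel C (ob A) (ob B) `` {(f, g)}) | f g. (f, g) \<in> spans C (ob A) (ob B)}"
    using assms by (auto simp: Hom_def span_cat_def quotient_def ob_Ob) blast
  also have "\<dots> = {cls A B (mk f g) | f g. (f, g) \<in> spans C (ob A) (ob B)}"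
    using span_rel_Image[OF assms] by (intro Collect_cong) metis
  finally show ?thesis .
qed

lemma cls_Hom:
  assumes "rep A B m" shows "cls A B m \<in> Hom S (ob A) (ob B)"
proof -
  obtain f g where "(f, g) \<in> spans C (ob A) (ob B)" "mk f g \<simeq> m" using assms by (auto simp: rep_def)
  then show ?thesis
    unfolding Hom_S[OF rep_U(1)[OF assms] rep_U(2)[OF assms]] cls_cong[symmetric, OF \<open>mk f g \<simeq> m\<close>] by blast
qed

lemma rep_mk: "A \<in> U \<Longrightarrow> B \<in> U \<Longrightarrow> (f, g) \<in> spans C (ob A) (ob B) \<Longrightarrow> rep A B (mk f g)"
  using lgraph_iso_refl[OF lgraph_on_wf[OF mk_on]] unfolding rep_def by blast

lemma rep_wf: "rep A B m \<Longrightarrow> wf_lgraph m"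
  by (rule lgraph_on_wf[OF rep_on])

lemma HomE:
  assumes "F \<in> Hom S G H"
  obtains A B f g where "G = ob A" "H = ob B" "A \<in> U" "B \<in> U"
    "F = cls A B (mk f g)" "rep A B (mk f g)"
proof -
  have "G \<in> ob ` U" "H \<in> ob ` U" using assms by (auto simp: Hom_def)
  then obtain A B where AB: "G = ob A" "H = ob B" "A \<in> U" "B \<in> U" by blast
  obtain f g where fg: "(f, g) \<in> spans C (ob A) (ob B)" "F = cls A B (mk f g)"
    using Hom_S[OF AB(3,4)] assms AB by auto
  show ?thesis by (rule that[OF AB fg(2) rep_mk[OF AB(3,4) fg(1)]])
qed

lemma HomE':
  assumes "F \<in> Hom S (ob A) H"
  obtains B f g where "H = ob B" "B \<in> U" "F = cls A B (mk f g)" "rep A B (mk f g)"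
  using assms by (elim HomE) simp

text \<open>\<open>pairing\<close> is a definite description, so existence and uniqueness have to be
  settled. An arrow into \<open>ob (A \<boxtimes> B)\<close> is a labelling by coded pairs, and a
  coded pair is determined by its components.\<close>

lemma pairing_ob:
  assumes "A \<in> U" "B \<in> U" and a: "a \<in> Hom C Z (ob A)" and b: "b \<in> Hom C Z (ob B)"
  shows "pairing C R (ob A) (ob B) a b \<in> Hom C Z (ob (A \<boxtimes> B)) \<and>
    (\<forall>x \<in> ed Z. lab (pairing C R (ob A) (ob B) a b) x = pair (lab a x) (lab b x))"
proof -
  note Pr = Pr_Hom[OF assms(1,2), THEN conjunct1] Pr_Hom[OF assms(1,2), THEN conjunct2]
  have AB: "A \<boxtimes> B \<in> U" using assms by simp
  have mem: "lab a x \<in> A" "lab b x \<in> B" if "x \<in> ed Z" for x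
    using lab_in[OF a that] lab_in[OF b that] by auto
  then have "(\<lambda>x. pair (lab a x) (lab b x)) \<in> ed Z \<rightarrow> A \<boxtimes> B" by auto
  then obtain u where u: "u \<in> Hom C Z (ob (A \<boxtimes> B))" "\<forall>x \<in> ed Z. lab u x = pair (lab a x) (lab b x)"
    using hom_ob_ex[OF _ AB] Hom_Ob[OF a] by blast
  have "u \<Zcomp> Pr1 R (ob A) (ob B) = a" "u \<Zcomp> Pr2 R (ob A) (ob B) = b"
    using assms u Pr mem lab_Pr
    by (auto intro!: hom_ob_eq[OF assms(1) _ a] hom_ob_eq[OF assms(2) _ b] intro: Comp_in_Hom
        simp: lab_Comp[OF u(1)])
  moreover have "v = u" if v: "v \<in> Hom C Z (ob (A \<boxtimes> B))"
    "v \<Zcomp> Pr1 R (ob A) (ob B) = a" "v \<Zcomp> Pr2 R (ob A) (ob B) = b" for v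
  proof (rule hom_ob_eq[OF AB v(1) u(1)])
    fix x assume x: "x \<in> ed Z"
    obtain c d where cd: "lab v x = pair c d" "c \<in> A" "d \<in> B"
      using lab_in[OF v(1) x] by (auto elim: times_cases)
    have "lab a x = c" "lab b x = d"
      using lab_Comp[OF v(1) Pr(1) x] lab_Comp[OF v(1) Pr(2) x] cd lab_Pr[OF cd(2,3)] v by auto
    then show "lab v x = lab u x" using cd u x by simp
  qed
  moreover have "Dom C a = Z" using a by (simp add: Hom_def)
  ultimately have "pairing C R (ob A) (ob B) a b = u"
    using u(1) unfolding pairing_def Prod_ob by (blast intro: the_equality)
  with u show ?thesis by simp
qed

lemmas pairing_Hom = pairing_ob[THEN conjunct1]
lemmas lab_pairing = pairing_ob[THEN conjunct2, rule_format]

lemma Comp_pairing: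
  assumes "A \<in> U" "B \<in> U" and a: "a \<in> Hom C Z (ob A)" and b: "b \<in> Hom C Z (ob B)"
    and u: "u \<in> Hom C Y Z"
  shows "u \<Zcomp> pairing C R (ob A) (ob B) a b = pairing C R (ob A) (ob B) (u \<Zcomp> a) (u \<Zcomp> b)"
  using assms lab_in[OF u]
  by (intro hom_ob_eq[of "A \<boxtimes> B" _ Y] Comp_in_Hom[OF u] pairing_Hom)
    (auto simp: lab_Comp[OF u] lab_pairing lab_pairing[OF _ _ Comp_in_Hom[OF u] Comp_in_Hom[OF u]]
      pairing_Hom lab_Comp[OF u pairing_Hom])

text \<open>Common end of \<open>pullback_ex\<close> and \<open>product_ex\<close>: the cone
  identifies nodes and arcs of its apex with pairs, and only the labels of the two new legs remain
  to be compared.\<close>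

lemma mk_cone:
  assumes p: "p \<in> Hom C P G" "bij_betw \<phi> (vt P) (vt G \<times> vt H)"
    "bij_betw (\<lambda>x. (lab p x, lab q x)) (ed P) {(e, e'). e \<in> ed G \<and> e' \<in> ed H \<and> Q e e'}"
    "\<forall>x \<in> ed P. \<phi> (sr P x) = (sr G (lab p x), sr H (lab q x)) \<and>
           \<phi> (tg P x) = (tg G (lab p x), tg H (lab q x))"
    and u: "u \<in> Hom C P K"
    and m: "nodes m = vt G \<times> vt H" "arcs m = {(e, e'). e \<in> ed G \<and> e' \<in> ed H \<and> Q e e'}"
    "tail m = map_prod (sr G) (sr H)" "head m = map_prod (tg G) (tg H)"
    and l: "\<And>x. x \<in> ed P \<Longrightarrow> lin m (lab p x, lab q x) = lab u x"
      "\<And>x. x \<in> ed P \<Longrightarrow> lout m (lab p x, lab q x) = lab v x"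
  shows "mk u v \<simeq> m"
proof -
  have "Dom C u = P" "P \<in> Ob C" using u Hom_Ob by (auto simp: Hom_def)
  then show ?thesis
    using p m l sr_tg[of P]
    by (intro lgraph_isoI[where \<phi> = \<phi> and \<psi> = "\<lambda>x. (lab p x, lab q x)"]) (auto simp: mk_def wf_lgraph_def)
qed

text \<open>The cones of \<open>cone_ex\<close> are governed by labels, pullbacks by composites. If
  \<open>Q\<close> says that the two middle labels agree, both conditions coincide, because arrows
  into \<open>ob B\<close> are determined by their labels.\<close>

lemma pullback_ex:
  assumes B: "B \<in> U" and fg: "(f, g) \<in> spans C (ob A) (ob B)" "(f', g') \<in> spans C (ob B) (ob D)"
  shows "\<exists>p q. is_pullback C g f' p q \<and> mk (p \<Zcomp> f) (q \<Zcomp> g') \<simeq> lg_comp (mk f g) (mk f' g')"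
proof -
  let ?G = "Dom C f" and ?H = "Dom C f'"
  have h: "f \<in> Hom C ?G (ob A)" "g \<in> Hom C ?G (ob B)" "f' \<in> Hom C ?H (ob B)" "g' \<in> Hom C ?H (ob D)"
    using fg spansD by auto
  then have gh: "?G \<in> Ob C" "?H \<in> Ob C" using Hom_Ob by auto
  obtain p q \<phi> where
    c: "universal_cone C ?G ?H (\<lambda>a b. \<forall>x \<in> ed (Dom C a). lab g (lab a x) = lab f' (lab b x)) p q"
    and \<phi>: "bij_betw \<phi> (vt (Dom C p)) (vt ?G \<times> vt ?H)"
        "bij_betw (\<lambda>x. (lab p x, lab q x)) (ed (Dom C p))
          {(e, e'). e \<in> ed ?G \<and> e' \<in> ed ?H \<and> lab g e = lab f' e'}"
        "\<forall>x \<in> ed (Dom C p). \<phi> (sr (Dom C p) x) = (sr ?G (lab p x), sr ?H (lab q x)) \<and>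
           \<phi> (tg (Dom C p) x) = (tg ?G (lab p x), tg ?H (lab q x))"
    using cone_ex[OF gh, of "\<lambda>e e'. lab g e = lab f' e'"] by blast
  have p: "p \<in> Hom C (Dom C p) ?G" "q \<in> Hom C (Dom C p) ?H" using c by (auto simp: universal_cone_def)
  have "(\<forall>x \<in> ed (Dom C a). lab g (lab a x) = lab f' (lab b x)) \<longleftrightarrow> a \<Zcomp> g = b \<Zcomp> f'"
    if a: "a \<in> Hom C Z ?G" and b: "b \<in> Hom C Z ?H" for Z a b
  proof -
    have "Dom C a = Z" using a by (simp add: Hom_def)
    then show ?thesis
      using lab_Comp[OF a h(2)] lab_Comp[OF b h(3)]
        hom_ob_eq[OF B Comp_in_Hom[OF a h(2)] Comp_in_Hom[OF b h(3)]] by auto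
  qed
  then have "universal_cone C ?G ?H (\<lambda>a b. a \<Zcomp> g = b \<Zcomp> f') p q"
    using c by (subst (asm) universal_cone_cong) auto
  moreover have "Dom C g = ?G" "g \<in> Arr C" "f' \<in> Arr C" "Cod C g = Cod C f'" using h by (auto simp: Hom_def)
  ultimately have "is_pullback C g f' p q" by (simp add: is_pullback_cone)
  moreover have "mk (p \<Zcomp> f) (q \<Zcomp> g') \<simeq> lg_comp (mk f g) (mk f' g')"
    by (rule mk_cone[OF p(1) \<phi> Comp_in_Hom[OF p(1) h(1)]])
      (simp_all add: lg_comp_def mk_def lab_Comp[OF p(1) h(1)] lab_Comp[OF p(2) h(4)])
  ultimately show ?thesis by blast
qed

text \<open>The same cone with a trivial condition. The legs are now pairings, whose labels are
  coded pairs as in \<open>lg_ten\<close>.\<close>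

lemma product_ex:
  assumes U: "A \<in> U" "B \<in> U" "A' \<in> U" "B' \<in> U"
    and fg: "(f, g) \<in> spans C (ob A) (ob B)" "(f', g') \<in> spans C (ob A') (ob B')"
  shows "\<exists>p q. is_product C (Dom C f) (Dom C f') p q \<and>
    mk (pairing C R (ob A) (ob A') (p \<Zcomp> f) (q \<Zcomp> f')) (pairing C R (ob B) (ob B') (p \<Zcomp> g) (q \<Zcomp> g'))
      \<simeq> mk f g \<otimes>\<^sub>l mk f' g'"
proof -
  let ?G = "Dom C f" and ?H = "Dom C f'"
  have h: "f \<in> Hom C ?G (ob A)" "g \<in> Hom C ?G (ob B)" "f' \<in> Hom C ?H (ob A')" "g' \<in> Hom C ?H (ob B')"
    using fg spansD by auto
  then have gh: "?G \<in> Ob C" "?H \<in> Ob C" using Hom_Ob by auto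
  obtain p q \<phi> where
    c: "universal_cone C ?G ?H (\<lambda>a b. \<forall>x \<in> ed (Dom C a). True) p q"
    and \<phi>: "bij_betw \<phi> (vt (Dom C p)) (vt ?G \<times> vt ?H)"
        "bij_betw (\<lambda>x. (lab p x, lab q x)) (ed (Dom C p))
          {(e, e'). e \<in> ed ?G \<and> e' \<in> ed ?H \<and> True}"
        "\<forall>x \<in> ed (Dom C p). \<phi> (sr (Dom C p) x) = (sr ?G (lab p x), sr ?H (lab q x)) \<and>
           \<phi> (tg (Dom C p) x) = (tg ?G (lab p x), tg ?H (lab q x))"
    using cone_ex[OF gh, of "\<lambda>e e'. True"] by blast
  have p: "p \<in> Hom C (Dom C p) ?G" "q \<in> Hom C (Dom C p) ?H" using c by (auto simp: universal_cone_def)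
  note hp = Comp_in_Hom[OF p(1) h(1)] Comp_in_Hom[OF p(1) h(2)] Comp_in_Hom[OF p(2) h(3)] Comp_in_Hom[OF p(2) h(4)]
  have "is_product C ?G ?H p q" using c by (simp add: is_product_cone)
  moreover have "mk (pairing C R (ob A) (ob A') (p \<Zcomp> f) (q \<Zcomp> f'))
      (pairing C R (ob B) (ob B') (p \<Zcomp> g) (q \<Zcomp> g')) \<simeq> mk f g \<otimes>\<^sub>l mk f' g'"
    by (rule mk_cone[OF p(1) \<phi> pairing_Hom[OF U(1,3) hp(1,3)]])
      (auto simp add: lg_ten_def mk_def lab_pairing[OF U(1,3) hp(1,3)] lab_pairing[OF U(2,4) hp(2,4)]
        lab_Comp[OF p(1) h(1)] lab_Comp[OF p(2) h(4)] lab_Comp[OF p(1) h(2)] lab_Comp[OF p(2) h(3)])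
  ultimately show ?thesis by blast
qed

section \<open>Composition and tensor of classes of spans\<close>

lemma span_Image_closed:
  assumes U: "A \<in> U" "B \<in> U" and uv: "(u, v) \<in> spans C (ob A) (ob B)"
    and uv': "(u', v') \<in> spans C (ob A) (ob B)"
    and h: "h \<in> Isos C (Dom C u) (Dom C u')" "h \<Zcomp> u' = u" "h \<Zcomp> v' = v"
  shows "mk u v \<simeq> mk u' v'"
  using span_rel_iff[OF U uv uv'] uv uv' h by (auto simp: span_rel_def)

lemma span_iso_ex:
  assumes U: "A \<in> U" "B \<in> U" and uv: "(u, v) \<in> spans C (ob A) (ob B)"
    and uv': "(u', v') \<in> spans C (ob A) (ob B)" and "mk u v \<simeq> mk u' v'"
  shows "\<exists>h \<in> Isos C (Dom C u) (Dom C u'). h \<Zcomp> u' = u \<and> h \<Zcomp> v' = v"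
  using span_rel_iff[OF U uv uv'] assms by (auto simp: span_rel_def)

text \<open>From left to right, any pullback is isomorphic to the one of \<open>pullback_ex\<close>,
  and \<open>lg_comp\<close> respects isomorphism of the factors. From right to left, a span
  isomorphic to one composite is itself a composite, of the same representatives along a transported
  pullback.\<close>

lemma cls_Comp_set:
  assumes m: "rep A B m" and n: "rep B D n"
  shows "(\<exists>f g f' g' p q. u = p \<Zcomp> f \<and> v = q \<Zcomp> g' \<and> ((f, g) \<in> spans C (ob A) (ob B) \<and> mk f g \<simeq> m) \<and>
      ((f', g') \<in> spans C (ob B) (ob D) \<and> mk f' g' \<simeq> n) \<and> is_pullback C g f' p q) \<longleftrightarrow>
    (u, v) \<in> spans C (ob A) (ob D) \<and> mk u v \<simeq> lg_comp m n"
    (is "?L \<longleftrightarrow> ?R")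
proof
  note U = rep_U(1)[OF m] rep_U(2)[OF m] rep_U(2)[OF n]
  have cone: "is_pullback C g f' p q \<longleftrightarrow>
      universal_cone C (Dom C f) (Dom C f') (\<lambda>a b. a \<Zcomp> g = b \<Zcomp> f') p q"
    if "(f, g) \<in> spans C (ob A) (ob B)" "(f', g') \<in> spans C (ob B) (ob D)" for f g f' g' p q
  proof -
    have "Dom C g = Dom C f" "g \<in> Arr C" "f' \<in> Arr C" "Cod C g = Cod C f'"
      using that[THEN spansD] by (auto simp: Hom_def)
    then show ?thesis by (simp add: is_pullback_cone)
  qed
  have comp: "p \<in> Hom C (Dom C p) (Dom C f) \<and> q \<in> Hom C (Dom C p) (Dom C f') \<and>
      p \<Zcomp> g = q \<Zcomp> f' \<and> (p \<Zcomp> f, q \<Zcomp> g') \<in> spans C (ob A) (ob D) \<and> Dom C (p \<Zcomp> f) = Dom C p"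
    if fg: "(f, g) \<in> spans C (ob A) (ob B)" "(f', g') \<in> spans C (ob B) (ob D)"
      and pb: "is_pullback C g f' p q" for f g f' g' p q
  proof -
    have p: "p \<in> Hom C (Dom C p) (Dom C f)" "q \<in> Hom C (Dom C p) (Dom C f')" "p \<Zcomp> g = q \<Zcomp> f'"
      using pb unfolding cone[OF fg] by (auto simp: universal_cone_def)
    then have "p \<Zcomp> f \<in> Hom C (Dom C p) (ob A)" "q \<Zcomp> g' \<in> Hom C (Dom C p) (ob D)"
      using fg[THEN spansD] Comp_in_Hom by blast+
    with p show ?thesis by (auto intro: spansI simp: Hom_def)
  qed
  {
    assume ?L
    then obtain f g f' g' p q where uv: "u = p \<Zcomp> f" "v = q \<Zcomp> g'"
      and fg: "(f, g) \<in> spans C (ob A) (ob B)" "mk f g \<simeq> m"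
      and fg': "(f', g') \<in> spans C (ob B) (ob D)" "mk f' g' \<simeq> n" and pb: "is_pullback C g f' p q"
      by blast
    obtain p0 q0 where pb0: "is_pullback C g f' p0 q0"
      and eq0: "mk (p0 \<Zcomp> f) (q0 \<Zcomp> g') \<simeq> lg_comp (mk f g) (mk f' g')"
      using pullback_ex[OF U(2) fg(1) fg'(1)] by blast
    note c = comp[OF fg(1) fg'(1) pb] and c0 = comp[OF fg(1) fg'(1) pb0]
    obtain h where h: "h \<in> Isos C (Dom C p) (Dom C p0)" "h \<Zcomp> p0 = p" "h \<Zcomp> q0 = q"
      using universal_cone_unique pb pb0 unfolding cone[OF fg(1) fg'(1)] by blast
    have "h \<in> Hom C (Dom C p) (Dom C p0)" using h(1) by (simp add: Isos_def)
    then have "h \<Zcomp> (p0 \<Zcomp> f) = u" "h \<Zcomp> (q0 \<Zcomp> g') = v"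
      using h c0 fg(1) fg'(1) uv Comp_assoc[of h "Dom C p" "Dom C p0"] spansD by metis+
    then have "mk u v \<simeq> mk (p0 \<Zcomp> f) (q0 \<Zcomp> g')"
      using c c0 h(1) unfolding uv by (intro span_Image_closed[OF U(1,3)]) auto
    also note eq0
    also have "lg_comp (mk f g) (mk f' g') \<simeq> lg_comp m n" by (rule lg_comp_cong[OF fg(2) fg'(2)])
    finally show ?R using c uv by simp
  }
  assume R: ?R
  obtain f g where fg: "(f, g) \<in> spans C (ob A) (ob B)" "mk f g \<simeq> m" using m by (auto simp: rep_def)
  obtain f' g' where fg': "(f', g') \<in> spans C (ob B) (ob D)" "mk f' g' \<simeq> n" using n by (auto simp: rep_def)
  obtain p0 q0 where pb0: "is_pullback C g f' p0 q0"
    and eq0: "mk (p0 \<Zcomp> f) (q0 \<Zcomp> g') \<simeq> lg_comp (mk f g) (mk f' g')"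
    using pullback_ex[OF U(2) fg(1) fg'(1)] by blast
  note c0 = comp[OF fg(1) fg'(1) pb0]
  have "lg_comp m n \<simeq> lg_comp (mk f g) (mk f' g')"
    by (intro lgraph_iso_sym[OF lg_comp_cong] fg fg')
  \<comment> \<open>Only an isomorphism \<open>h\<close> from \<open>(u, v)\<close> to one composite
    is available. Moving the pullback along \<open>h\<close> makes the composites equal to
    \<open>u\<close> and \<open>v\<close> themselves.\<close>
  from lgraph_iso_trans[OF conjunct2[OF R] lgraph_iso_trans[OF this lgraph_iso_sym[OF eq0]]]
  obtain h where h: "h \<in> Isos C (Dom C u) (Dom C p0)" "h \<Zcomp> (p0 \<Zcomp> f) = u" "h \<Zcomp> (q0 \<Zcomp> g') = v"
    using span_iso_ex[OF U(1,3) conjunct1[OF R]] c0 by metis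
  have hh: "h \<in> Hom C (Dom C u) (Dom C p0)" using h(1) by (simp add: Isos_def)
  have as: "(h \<Zcomp> p0) \<Zcomp> k = h \<Zcomp> (p0 \<Zcomp> k)" if "k \<in> Hom C (Dom C f) K" for k K
    using Comp_assoc[OF hh _ that] c0 by blast
  have as': "(h \<Zcomp> q0) \<Zcomp> k = h \<Zcomp> (q0 \<Zcomp> k)" if "k \<in> Hom C (Dom C f') K" for k K
    using Comp_assoc[OF hh _ that] c0 by blast
  note sp = spansD[OF fg(1)] spansD[OF fg'(1)]
  have "(h \<Zcomp> p0) \<Zcomp> g = (h \<Zcomp> q0) \<Zcomp> f'" using as as' sp c0 by metis
  then have "is_pullback C g f' (h \<Zcomp> p0) (h \<Zcomp> q0)"
    using universal_cone_iso[OF pb0[unfolded cone[OF fg(1) fg'(1)]] h(1)]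
    unfolding cone[OF fg(1) fg'(1)] by blast
  moreover have "u = (h \<Zcomp> p0) \<Zcomp> f" "v = (h \<Zcomp> q0) \<Zcomp> g'" using as as' sp h by metis+
  ultimately show ?L using fg fg' by blast
qed

lemma cls_Comp:
  assumes "rep A B m" "rep B D n"
  shows "cls A B m \<Zcomp>\<^bsub>S\<^esub> cls B D n = cls A D (lg_comp m n)"
proof -
  have "cls A B m \<Zcomp>\<^bsub>S\<^esub> cls B D n = (ob A, ob D, {(u, v). \<exists>f g f' g' p q. u = p \<Zcomp> f \<and> v = q \<Zcomp> g' \<and>
      ((f, g) \<in> spans C (ob A) (ob B) \<and> mk f g \<simeq> m) \<and>
      ((f', g') \<in> spans C (ob B) (ob D) \<and> mk f' g' \<simeq> n) \<and> is_pullback C g f' p q})"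
    by (auto simp: cls_def span_cat_def span_smc_ops) blast+
  then show ?thesis unfolding cls_Comp_set[OF assms] by (simp only: cls_def)
qed

lemma rep_Comp:
  assumes m: "rep A B m" and n: "rep B D n" shows "rep A D (lg_comp m n)"
proof -
  obtain f g where fg: "(f, g) \<in> spans C (ob A) (ob B)" "mk f g \<simeq> m" using m by (auto simp: rep_def)
  obtain f' g' where fg': "(f', g') \<in> spans C (ob B) (ob D)" "mk f' g' \<simeq> n" using n by (auto simp: rep_def)
  obtain p q where pb0: "is_pullback C g f' p q"
    using pullback_ex[OF rep_U(2)[OF m] fg(1) fg'(1)] by blast
  have "(p \<Zcomp> f, q \<Zcomp> g') \<in> spans C (ob A) (ob D) \<and> mk (p \<Zcomp> f) (q \<Zcomp> g') \<simeq> lg_comp m n"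
    using fg fg' pb0 by (subst cls_Comp_set[OF m n, symmetric]) blast
  then show ?thesis using rep_U[OF m] rep_U[OF n] unfolding rep_def by blast
qed

text \<open>The argument of \<open>cls_Comp_set\<close> with products for pullbacks. The additional
  point is that an isomorphism of apexes has to pass through the pairings.\<close>

lemma cls_TenA_set:
  assumes m: "rep A B m" and n: "rep A' B' n"
  shows "(\<exists>f g f' g' p q. u = pairing C R (ob A) (ob A') (p \<Zcomp> f) (q \<Zcomp> f') \<and>
        v = pairing C R (ob B) (ob B') (p \<Zcomp> g) (q \<Zcomp> g') \<and>
        ((f, g) \<in> spans C (ob A) (ob B) \<and> mk f g \<simeq> m) \<and>
        ((f', g') \<in> spans C (ob A') (ob B') \<and> mk f' g' \<simeq> n) \<and> is_product C (Dom C f) (Dom C f') p q) \<longleftrightarrow>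
    (u, v) \<in> spans C (ob (A \<boxtimes> A')) (ob (B \<boxtimes> B')) \<and> mk u v \<simeq> m \<otimes>\<^sub>l n"
    (is "?L \<longleftrightarrow> ?R")
proof
  note U = rep_U[OF m] rep_U[OF n]
  note U2 = times_in_U[OF U(1,3)] times_in_U[OF U(2,4)]
  let ?u = "\<lambda>f f' p q. pairing C R (ob A) (ob A') (p \<Zcomp> f) (q \<Zcomp> f')"
  let ?v = "\<lambda>g g' p q. pairing C R (ob B) (ob B') (p \<Zcomp> g) (q \<Zcomp> g')"
  \<comment> \<open>The last conjunct moves a precomposed arrow inside both pairings. It turns an
    isomorphism of product cones into one of spans, and back.\<close>
  have comp: "(?u f f' p q, ?v g g' p q) \<in> spans C (ob (A \<boxtimes> A')) (ob (B \<boxtimes> B')) \<and> Dom C (?u f f' p q) = Z \<and>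
      (\<forall>h Y. h \<in> Hom C Y Z \<longrightarrow> h \<Zcomp> ?u f f' p q = ?u f f' (h \<Zcomp> p) (h \<Zcomp> q) \<and>
        h \<Zcomp> ?v g g' p q = ?v g g' (h \<Zcomp> p) (h \<Zcomp> q))"
    if fg: "(f, g) \<in> spans C (ob A) (ob B)" "(f', g') \<in> spans C (ob A') (ob B')"
      and p: "p \<in> Hom C Z (Dom C f)" "q \<in> Hom C Z (Dom C f')" for f g f' g' p q Z
  proof -
    have h: "f \<in> Hom C (Dom C f) (ob A)" "g \<in> Hom C (Dom C f) (ob B)"
      "f' \<in> Hom C (Dom C f') (ob A')" "g' \<in> Hom C (Dom C f') (ob B')"
      using fg[THEN spansD] by auto
    note hp = Comp_in_Hom[OF p(1) h(1)] Comp_in_Hom[OF p(1) h(2)] Comp_in_Hom[OF p(2) h(3)] Comp_in_Hom[OF p(2) h(4)]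
    note ph = pairing_Hom[OF U(1,3) hp(1,3)] pairing_Hom[OF U(2,4) hp(2,4)]
    have "k \<Zcomp> ?u f f' p q = ?u f f' (k \<Zcomp> p) (k \<Zcomp> q) \<and> k \<Zcomp> ?v g g' p q = ?v g g' (k \<Zcomp> p) (k \<Zcomp> q)"
      if k: "k \<in> Hom C Y Z" for k Y
      by (simp add: Comp_pairing[OF U(1,3) hp(1,3) k] Comp_pairing[OF U(2,4) hp(2,4) k]
          Comp_assoc[OF k p(1) h(1)] Comp_assoc[OF k p(1) h(2)] Comp_assoc[OF k p(2) h(3)] Comp_assoc[OF k p(2) h(4)])
    moreover have "Dom C (?u f f' p q) = Z" using ph by (simp add: Hom_def)
    ultimately show ?thesis using spansI[OF ph] by blast
  qed
  have prodD: "p \<in> Hom C (Dom C p) G \<and> q \<in> Hom C (Dom C p) H" if "is_product C G H p q" for p q G H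
    using that by (simp add: is_product_def)
  {
    assume ?L
    then obtain f g f' g' p q where uv: "u = ?u f f' p q" "v = ?v g g' p q"
      and fg: "(f, g) \<in> spans C (ob A) (ob B)" "mk f g \<simeq> m"
      and fg': "(f', g') \<in> spans C (ob A') (ob B')" "mk f' g' \<simeq> n"
      and pb: "is_product C (Dom C f) (Dom C f') p q"
      by blast
    obtain p0 q0 where pb0: "is_product C (Dom C f) (Dom C f') p0 q0"
      and eq0: "mk (?u f f' p0 q0) (?v g g' p0 q0) \<simeq> mk f g \<otimes>\<^sub>l mk f' g'"
      using product_ex[OF U fg(1) fg'(1)] by blast
    note pp = prodD[OF pb] and pp0 = prodD[OF pb0]
    note c = comp[OF fg(1) fg'(1) pp[THEN conjunct1] pp[THEN conjunct2]]
    note c0 = comp[OF fg(1) fg'(1) pp0[THEN conjunct1] pp0[THEN conjunct2]]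
    obtain h where h: "h \<in> Isos C (Dom C p) (Dom C p0)" "h \<Zcomp> p0 = p" "h \<Zcomp> q0 = q"
      using universal_cone_unique pb pb0 unfolding is_product_cone by blast
    have "h \<in> Hom C (Dom C p) (Dom C p0)" using h(1) by (simp add: Isos_def)
    then have "h \<Zcomp> ?u f f' p0 q0 = u" "h \<Zcomp> ?v g g' p0 q0 = v"
      using c0 h(2,3) uv by auto
    then have "mk u v \<simeq> mk (?u f f' p0 q0) (?v g g' p0 q0)"
      using c c0 h(1) unfolding uv by (intro span_Image_closed[OF U2]) auto
    also note eq0
    also have "mk f g \<otimes>\<^sub>l mk f' g' \<simeq> m \<otimes>\<^sub>l n" by (rule lg_ten_cong[OF fg(2) fg'(2)])
    finally show ?R using c uv by simp
  }
  assume R: ?R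
  obtain f g where fg: "(f, g) \<in> spans C (ob A) (ob B)" "mk f g \<simeq> m" using m by (auto simp: rep_def)
  obtain f' g' where fg': "(f', g') \<in> spans C (ob A') (ob B')" "mk f' g' \<simeq> n" using n by (auto simp: rep_def)
  obtain p0 q0 where pb0: "is_product C (Dom C f) (Dom C f') p0 q0"
    and eq0: "mk (?u f f' p0 q0) (?v g g' p0 q0) \<simeq> mk f g \<otimes>\<^sub>l mk f' g'"
    using product_ex[OF U fg(1) fg'(1)] by blast
  note pp0 = prodD[OF pb0]
  note c0 = comp[OF fg(1) fg'(1) pp0[THEN conjunct1] pp0[THEN conjunct2]]
  have "m \<otimes>\<^sub>l n \<simeq> mk f g \<otimes>\<^sub>l mk f' g'"
    by (intro lgraph_iso_sym[OF lg_ten_cong] fg fg')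
  from lgraph_iso_trans[OF conjunct2[OF R] lgraph_iso_trans[OF this lgraph_iso_sym[OF eq0]]]
  obtain h where h: "h \<in> Isos C (Dom C u) (Dom C p0)" "h \<Zcomp> ?u f f' p0 q0 = u" "h \<Zcomp> ?v g g' p0 q0 = v"
    using span_iso_ex[OF U2 conjunct1[OF R]] c0 by metis
  have hh: "h \<in> Hom C (Dom C u) (Dom C p0)" using h(1) by (simp add: Isos_def)
  have "is_product C (Dom C f) (Dom C f') (h \<Zcomp> p0) (h \<Zcomp> q0)"
    using universal_cone_iso[OF pb0[unfolded is_product_cone] h(1)] unfolding is_product_cone by blast
  moreover have "u = ?u f f' (h \<Zcomp> p0) (h \<Zcomp> q0)" "v = ?v g g' (h \<Zcomp> p0) (h \<Zcomp> q0)"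
    using c0 hh h(2,3) by auto
  ultimately show ?L using fg fg' by blast
qed

lemma cls_TenA:
  assumes "rep A B m" "rep A' B' n"
  shows "cls A B m \<otimes>\<^bsub>S\<^esub> cls A' B' n = cls (A \<boxtimes> A') (B \<boxtimes> B') (m \<otimes>\<^sub>l n)"
proof -
  have "cls A B m \<otimes>\<^bsub>S\<^esub> cls A' B' n = (ob (A \<boxtimes> A'), ob (B \<boxtimes> B'), {(u, v). \<exists>f g f' g' p q.
        u = pairing C R (ob A) (ob A') (p \<Zcomp> f) (q \<Zcomp> f') \<and>
        v = pairing C R (ob B) (ob B') (p \<Zcomp> g) (q \<Zcomp> g') \<and>
        ((f, g) \<in> spans C (ob A) (ob B) \<and> mk f g \<simeq> m) \<and>
        ((f', g') \<in> spans C (ob A') (ob B') \<and> mk f' g' \<simeq> n) \<and> is_product C (Dom C f) (Dom C f') p q})"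
    unfolding cls_def span_smc_TenA by auto blast+
  then show ?thesis unfolding cls_TenA_set[OF assms] by (simp only: cls_def)
qed

lemma rep_TenA:
  assumes m: "rep A B m" and n: "rep A' B' n" shows "rep (A \<boxtimes> A') (B \<boxtimes> B') (m \<otimes>\<^sub>l n)"
proof -
  note U = rep_U[OF m] rep_U[OF n]
  obtain f g where fg: "(f, g) \<in> spans C (ob A) (ob B)" "mk f g \<simeq> m" using m by (auto simp: rep_def)
  obtain f' g' where fg': "(f', g') \<in> spans C (ob A') (ob B')" "mk f' g' \<simeq> n" using n by (auto simp: rep_def)
  obtain p q where pb0: "is_product C (Dom C f) (Dom C f') p q"
    using product_ex[OF U fg(1) fg'(1)] by blast
  let ?u = "pairing C R (ob A) (ob A') (p \<Zcomp> f) (q \<Zcomp> f')"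
  let ?v = "pairing C R (ob B) (ob B') (p \<Zcomp> g) (q \<Zcomp> g')"
  have "(?u, ?v) \<in> spans C (ob (A \<boxtimes> A')) (ob (B \<boxtimes> B')) \<and> mk ?u ?v \<simeq> m \<otimes>\<^sub>l n"
    using fg fg' pb0 by (subst cls_TenA_set[OF m n, symmetric]) blast
  then show ?thesis using U unfolding rep_def by auto
qed

section \<open>Functions regarded as spans\<close>

lemma mk_Id:
  assumes "A \<in> U" "k \<in> Hom C (ob A) (ob B)"
  shows "mk (Id C (ob A)) k \<simeq> lg_fun A (lab k)"
proof -
  have I: "Id C (ob A) \<in> Hom C (ob A) (ob A)" using assms by (simp add: Id_in_Hom ob_Ob)
  \<comment> \<open>The head is \<open>ob A\<close>, whose only node corresponds to the node
    \<open>()\<close> of \<open>lg_fun\<close>.\<close>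
  obtain v where "vt (ob A) = {v}" using vt_ob by blast
  moreover have "Dom C (Id C (ob A)) = ob A" using I by (simp add: Hom_def)
  ultimately show ?thesis
    using lgraph_on_wf[OF mk_on[OF spansI[OF I assms(2)]]] assms(1)
    by (intro lgraph_isoI[where \<phi> = "\<lambda>_. ()" and \<psi> = "\<lambda>x. x"])
      (auto simp: mk_def lg_fun_def lab_Id ob_Ob bij_betw_def)
qed

lemma span_of_fn:
  assumes "A \<in> U" "B \<in> U" "k \<in> Hom C (ob A) (ob B)"
  shows "span_of C k = fn A B (lab k)"
proof -
  have I: "Id C (ob A) \<in> Hom C (ob A) (ob A)" using assms by (simp add: Id_in_Hom ob_Ob)
  have "Dom C k = ob A" "Cod C k = ob B" using assms by (auto simp: Hom_def)
  then show ?thesis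
    using span_rel_Image[OF assms(1,2) spansI[OF I assms(3)]] cls_cong[OF mk_Id[OF assms(1,3)]]
    by (simp add: span_of_def fn_def)
qed

lemma fn_cong: "(\<And>x. x \<in> A \<Longrightarrow> h x = k x) \<Longrightarrow> fn A B h = fn A B k"
  unfolding fn_def by (intro cls_cong lg_fun_cong)

text \<open>A function on labels need not be \<open>lab\<close> of an arrow;
  \<open>hom_ob_ex\<close> provides an arrow agreeing with it on \<open>A\<close>, and
  \<open>lg_fun A h\<close> sees no more than that up to isomorphism.\<close>

lemma rep_fun:
  assumes "A \<in> U" "B \<in> U" "h \<in> A \<rightarrow> B" shows "rep A B (lg_fun A h)"
proof -
  obtain k where k: "k \<in> Hom C (ob A) (ob B)" "\<forall>x \<in> A. lab k x = h x"
    using hom_ob_ex[of "ob A" B h] assms ob_Ob by auto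
  have I: "Id C (ob A) \<in> Hom C (ob A) (ob A)" using assms by (simp add: Id_in_Hom ob_Ob)
  have "mk (Id C (ob A)) k \<simeq> lg_fun A h"
    using k(2) by (intro lgraph_iso_trans[OF mk_Id[OF assms(1) k(1)]] lg_fun_cong) simp
  then show ?thesis using spansI[OF I k(1)] assms unfolding rep_def by blast
qed

lemma fn_Hom: "A \<in> U \<Longrightarrow> B \<in> U \<Longrightarrow> h \<in> A \<rightarrow> B \<Longrightarrow> fn A B h \<in> Hom S (ob A) (ob B)"
  unfolding fn_def by (intro cls_Hom rep_fun)

lemma fn_Comp:
  "A \<in> U \<Longrightarrow> B \<in> U \<Longrightarrow> D \<in> U \<Longrightarrow> h \<in> A \<rightarrow> B \<Longrightarrow> k \<in> B \<rightarrow> D \<Longrightarrow>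
    fn A B h \<Zcomp>\<^bsub>S\<^esub> fn B D k = fn A D (\<lambda>x. k (h x))"
  unfolding fn_def by (subst cls_Comp) (auto intro: rep_fun cls_cong lg_comp_fun_fun)

lemma fn_TenA:
  "A \<in> U \<Longrightarrow> B \<in> U \<Longrightarrow> A' \<in> U \<Longrightarrow> B' \<in> U \<Longrightarrow> h \<in> A \<rightarrow> B \<Longrightarrow> k \<in> A' \<rightarrow> B' \<Longrightarrow>
    fn A B h \<otimes>\<^bsub>S\<^esub> fn A' B' k = fn (A \<boxtimes> A') (B \<boxtimes> B') (cross h k)"
  unfolding fn_def by (subst cls_TenA) (auto intro: rep_fun cls_cong lg_ten_fun)

lemma cls_Comp_fn:
  "rep A B m \<Longrightarrow> D \<in> U \<Longrightarrow> h \<in> B \<rightarrow> D \<Longrightarrow> cls A B m \<Zcomp>\<^bsub>S\<^esub> fn B D h = cls A D (relabel (\<lambda>x. x) h m)"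
  unfolding fn_def
  by (subst cls_Comp) (auto intro: rep_fun rep_U cls_cong lg_comp_fun_right rep_on)

lemma fn_Comp_cls:
  assumes "rep B D m" "A \<in> U" "h \<in> A \<rightarrow> B" "k \<in> B \<rightarrow> A"
    "\<And>x. x \<in> A \<Longrightarrow> k (h x) = x" "\<And>y. y \<in> B \<Longrightarrow> h (k y) = y"
  shows "fn A B h \<Zcomp>\<^bsub>S\<^esub> cls B D m = cls A D (relabel k (\<lambda>x. x) m)"
  unfolding fn_def cls_Comp[OF rep_fun[OF assms(2) rep_U(1)[OF assms(1)] assms(3)] assms(1)]
  by (rule cls_cong[OF lg_comp_fun_left[OF rep_on[OF assms(1)] assms(3-6)]])

lemma rep_relabel_out:
  assumes "rep A B m" "D \<in> U" "h \<in> B \<rightarrow> D" shows "rep A D (relabel (\<lambda>x. x) h m)"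
  by (rule rep_cong[OF lg_comp_fun_right[OF rep_on[OF assms(1)]]
        rep_Comp[OF assms(1) rep_fun[OF rep_U(2)[OF assms(1)] assms(2,3)]]])

lemma rep_relabel_in:
  assumes "rep B D m" "A \<in> U" "h \<in> A \<rightarrow> B" "k \<in> B \<rightarrow> A"
    "\<And>x. x \<in> A \<Longrightarrow> k (h x) = x" "\<And>y. y \<in> B \<Longrightarrow> h (k y) = y"
  shows "rep A D (relabel k (\<lambda>x. x) m)"
  by (rule rep_cong[OF lg_comp_fun_left[OF rep_on[OF assms(1)] assms(3-6)]
        rep_Comp[OF rep_fun[OF assms(2) rep_U(1)[OF assms(1)] assms(3)] assms(1)]])

lemma Id_fn: "A \<in> U \<Longrightarrow> Id S (ob A) = fn A A (\<lambda>x. x)"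
proof -
  assume A: "A \<in> U"
  then have I: "Id C (ob A) \<in> Hom C (ob A) (ob A)" by (simp add: Id_in_Hom ob_Ob)
  then have "Dom C (Id C (ob A)) = ob A" "Cod C (Id C (ob A)) = ob A" by (auto simp: Hom_def)
  then have "Id S (ob A) = span_of C (Id C (ob A))" by (simp add: span_cat_def span_of_def span_smc_ops)
  also have "\<dots> = fn A A (\<lambda>x. x)"
    using A by (simp add: span_of_fn[OF A A I]) (auto intro: fn_cong simp: lab_Id ob_Ob)
  finally show ?thesis .
qed

lemma Pr:
  assumes "A \<in> U" "B \<in> U"
  shows "Pr1 R (ob A) (ob B) \<in> Hom C (ob (A \<boxtimes> B)) (ob A)" "Pr2 R (ob A) (ob B) \<in> Hom C (ob (A \<boxtimes> B)) (ob B)"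
  using Pr_Hom assms by auto

lemma LUnit_fn: "A \<in> U \<Longrightarrow> LUnit S (ob A) = fn ({pt} \<boxtimes> A) A sn"
  by (simp add: span_smc_ops span_of_fn[OF _ _ Pr(2)] pt_closed) (auto intro!: fn_cong elim!: times_cases simp: lab_Pr)

lemma RUnit_fn: "A \<in> U \<Longrightarrow> RUnit S (ob A) = fn (A \<boxtimes> {pt}) A fs"
  by (simp add: span_smc_ops span_of_fn[OF _ _ Pr(1)] pt_closed) (auto intro!: fn_cong elim!: times_cases simp: lab_Pr)

lemma Sym_fn:
  assumes "A \<in> U" "B \<in> U" shows "Sym S (ob A) (ob B) = fn (A \<boxtimes> B) (B \<boxtimes> A) swap_fn"
proof -
  note p = Pr[OF assms]
  show ?thesis
    using assms span_of_fn[OF _ _ pairing_Hom[OF assms(2,1) p(2,1)]]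
    by (simp add: span_smc_ops) (auto intro!: fn_cong elim!: times_cases simp: lab_Pr lab_pairing[OF assms(2,1) p(2,1)])
qed

lemma Assoc_fn:
  assumes U: "A \<in> U" "B \<in> U" "D \<in> U"
  shows "Assoc S (ob A) (ob B) (ob D) = fn ((A \<boxtimes> B) \<boxtimes> D) (A \<boxtimes> (B \<boxtimes> D)) assoc_fn"
proof -
  have AB: "A \<boxtimes> B \<in> U" "B \<boxtimes> D \<in> U" using U by auto
  note P = Pr[OF U(1,2)] and Q = Pr[OF AB(1) U(3)]
  note pq = Comp_in_Hom[OF Q(1) P(1)] Comp_in_Hom[OF Q(1) P(2)]
  note bd = pairing_Hom[OF U(2,3) pq(2) Q(2)]
  note abd = pairing_Hom[OF U(1) AB(2) pq(1) bd]
  show ?thesis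
    using U AB span_of_fn[OF _ _ abd]
    by (simp add: span_smc_ops) (auto intro!: fn_cong elim!: times_cases
        simp: lab_Pr lab_pairing[OF U(1) AB(2) pq(1) bd] lab_pairing[OF U(2,3) pq(2) Q(2)]
          lab_Comp[OF Q(1) P(1)] lab_Comp[OF Q(1) P(2)])
qed

lemma fn_inverse:
  assumes "A \<in> U" "B \<in> U" "h \<in> A \<rightarrow> B" "k \<in> B \<rightarrow> A"
    "\<And>x. x \<in> A \<Longrightarrow> k (h x) = x" "\<And>y. y \<in> B \<Longrightarrow> h (k y) = y"
  shows "fn A B h \<Zcomp>\<^bsub>S\<^esub> fn B A k = Id S (ob A)" "fn B A k \<Zcomp>\<^bsub>S\<^esub> fn A B h = Id S (ob B)"
  unfolding Id_fn[OF assms(1)] Id_fn[OF assms(2)] using assms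
  by (simp_all add: fn_Comp) (auto intro: fn_cong)

lemma fn_Isos:
  assumes "A \<in> U" "B \<in> U" "h \<in> A \<rightarrow> B" "k \<in> B \<rightarrow> A"
    "\<And>x. x \<in> A \<Longrightarrow> k (h x) = x" "\<And>y. y \<in> B \<Longrightarrow> h (k y) = y"
  shows "fn A B h \<in> Isos S (ob A) (ob B)"
  using fn_inverse[OF assms] fn_Hom[OF assms(1-3)] fn_Hom[OF assms(2,1,4)] unfolding Isos_def by blast

section \<open>The symmetric monoidal category of spans\<close>

lemma cat_S: "cat S"
proof
  show "Dom S f \<in> Ob S" "Cod S f \<in> Ob S" if "f \<in> Arr S" for f using that by simp_all
  show "Id S G \<in> Hom S G G" if "G \<in> Ob S" for G
    using that fn_Hom[of _ _ "\<lambda>x. x"] by (auto simp: Id_fn)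
  fix F G H assume F: "F \<in> Hom S G H"
  obtain A B f g where 1: "G = ob A" "H = ob B" "A \<in> U" "B \<in> U" "F = cls A B (mk f g)" "rep A B (mk f g)"
    using F by (rule HomE)
  show "Id S G \<Zcomp>\<^bsub>S\<^esub> F = F" "F \<Zcomp>\<^bsub>S\<^esub> Id S H = F"
    unfolding 1 Id_fn[OF 1(3)] Id_fn[OF 1(4)] fn_def
    using 1 by (subst cls_Comp; auto intro: rep_fun cls_cong lg_comp_id_left lg_comp_id_right rep_on)+
  fix F' K assume F': "F' \<in> Hom S H K"
  obtain D f' g' where 2: "K = ob D" "D \<in> U" "F' = cls B D (mk f' g')" "rep B D (mk f' g')"
    using F'[unfolded 1] by (rule HomE')
  show "F \<Zcomp>\<^bsub>S\<^esub> F' \<in> Hom S G K"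
    unfolding 1 2 cls_Comp[OF 1(6) 2(4)] by (intro cls_Hom rep_Comp[OF 1(6) 2(4)])
  fix F'' L assume F'': "F'' \<in> Hom S K L"
  obtain E f'' g'' where 3: "L = ob E" "E \<in> U" "F'' = cls D E (mk f'' g'')" "rep D E (mk f'' g'')"
    using F''[unfolded 2] by (rule HomE')
  show "(F \<Zcomp>\<^bsub>S\<^esub> F') \<Zcomp>\<^bsub>S\<^esub> F'' = F \<Zcomp>\<^bsub>S\<^esub> (F' \<Zcomp>\<^bsub>S\<^esub> F'')"
    unfolding 1 2 3 cls_Comp[OF 1(6) 2(4)] cls_Comp[OF 2(4) 3(4)]
      cls_Comp[OF rep_Comp[OF 1(6) 2(4)] 3(4)] cls_Comp[OF 1(6) rep_Comp[OF 2(4) 3(4)]]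
    by (rule cls_cong[OF lg_comp_assoc[OF rep_wf[OF 1(6)] rep_wf[OF 2(4)] rep_wf[OF 3(4)]]])
qed

interpretation S: cat S by (rule cat_S)

text \<open>Evaluates the inverses in \<open>st_rel\<close>, \<open>mid_swap\<close> and the
  composition of \<open>St\<close>: associators are functions, and so are invertible spans of sets
  by \<open>Isos_M\<close> below.\<close>

lemma Inv_fn:
  assumes "A \<in> U" "B \<in> U" "h \<in> A \<rightarrow> B" "k \<in> B \<rightarrow> A"
    "\<And>x. x \<in> A \<Longrightarrow> k (h x) = x" "\<And>y. y \<in> B \<Longrightarrow> h (k y) = y"
  shows "Inv S (fn A B h) = fn B A k"
  by (rule S.Inv_eqI[OF fn_Hom[OF assms(1-3)] fn_Hom[OF assms(2,1,4)] fn_inverse[OF assms]])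

text \<open>The axioms fall into two groups. Those quantified over objects only involve functions
  and are checked on generic tuples. Those quantified over spans become isomorphisms of labelled
  graphs once the coherence arrows are absorbed into relabellings.\<close>

theorem symmetric_monoidal_S: "symmetric_monoidal_category S"
proof
  have OS: "\<And>G. G \<in> Ob S \<longleftrightarrow> (\<exists>A \<in> U. G = ob A)" by auto
  have TS: "Ten S (ob A) (ob B) = ob (A \<boxtimes> B)" "Unit S = ob {pt}" for A B by auto
  note simps = Id_fn LUnit_fn RUnit_fn Sym_fn Assoc_fn fn_Comp fn_TenA Pi_iff pt_closed
  show "\<one>\<^bsub>S\<^esub> \<in> Ob S" using pt_closed by simp
  fix G H assume "G \<in> Ob S" "H \<in> Ob S"
  then obtain A B where [simp]: "G = ob A" "H = ob B" "A \<in> U" "B \<in> U" by auto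
  show "G \<odot>\<^bsub>S\<^esub> H \<in> Ob S" by simp
  show "Id S G \<otimes>\<^bsub>S\<^esub> Id S H = Id S (G \<odot>\<^bsub>S\<^esub> H)"
    by (simp add: simps) (auto intro!: fn_cong elim!: times_cases)
  show "\<l>\<^bsub>S\<^esub> G \<in> Isos S (\<one>\<^bsub>S\<^esub> \<odot>\<^bsub>S\<^esub> G) G"
    by (simp add: simps, rule fn_Isos[where k = "pair pt"])
      (auto simp: pt_closed elim!: times_cases)
  show "\<r>\<^bsub>S\<^esub> G \<in> Isos S (G \<odot>\<^bsub>S\<^esub> \<one>\<^bsub>S\<^esub>) G"
    by (simp add: simps, rule fn_Isos[where k = "\<lambda>x. pair x pt"])
      (auto simp: pt_closed elim!: times_cases)
  show "\<sigma>\<^bsub>S\<^esub> G H \<in> Hom S (G \<odot>\<^bsub>S\<^esub> H) (H \<odot>\<^bsub>S\<^esub> G)"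
    by (simp add: simps, rule fn_Hom) (auto elim!: times_cases)
  show "\<sigma>\<^bsub>S\<^esub> G H \<Zcomp>\<^bsub>S\<^esub> \<sigma>\<^bsub>S\<^esub> H G = Id S (G \<odot>\<^bsub>S\<^esub> H)"
    by (simp add: simps) (auto intro!: fn_cong elim!: times_cases)
  show "\<alpha>\<^bsub>S\<^esub> G \<one>\<^bsub>S\<^esub> H \<Zcomp>\<^bsub>S\<^esub> (Id S G \<otimes>\<^bsub>S\<^esub> \<l>\<^bsub>S\<^esub> H) = \<r>\<^bsub>S\<^esub> G \<otimes>\<^bsub>S\<^esub> Id S H"
    by (simp add: simps) (auto intro!: fn_cong elim!: times_cases)
  fix K assume "K \<in> Ob S"
  then obtain D where [simp]: "K = ob D" "D \<in> U" by auto
  show "\<alpha>\<^bsub>S\<^esub> G H K \<in> Isos S ((G \<odot>\<^bsub>S\<^esub> H) \<odot>\<^bsub>S\<^esub> K) (G \<odot>\<^bsub>S\<^esub> (H \<odot>\<^bsub>S\<^esub> K))"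
    by (simp add: simps, rule fn_Isos[where k = unassoc_fn])
      (auto elim!: times_cases)
  show "\<alpha>\<^bsub>S\<^esub> G H K \<Zcomp>\<^bsub>S\<^esub> \<sigma>\<^bsub>S\<^esub> G (H \<odot>\<^bsub>S\<^esub> K) \<Zcomp>\<^bsub>S\<^esub> \<alpha>\<^bsub>S\<^esub> H K G
        = (\<sigma>\<^bsub>S\<^esub> G H \<otimes>\<^bsub>S\<^esub> Id S K) \<Zcomp>\<^bsub>S\<^esub> \<alpha>\<^bsub>S\<^esub> H G K \<Zcomp>\<^bsub>S\<^esub> (Id S H \<otimes>\<^bsub>S\<^esub> \<sigma>\<^bsub>S\<^esub> G K)"
    by (simp add: simps) (auto intro!: fn_cong elim!: times_cases)
  fix L assume "L \<in> Ob S"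
  then obtain E where [simp]: "L = ob E" "E \<in> U" by auto
  show "(\<alpha>\<^bsub>S\<^esub> G H K \<otimes>\<^bsub>S\<^esub> Id S L) \<Zcomp>\<^bsub>S\<^esub> \<alpha>\<^bsub>S\<^esub> G (H \<odot>\<^bsub>S\<^esub> K) L \<Zcomp>\<^bsub>S\<^esub> (Id S G \<otimes>\<^bsub>S\<^esub> \<alpha>\<^bsub>S\<^esub> H K L)
        = \<alpha>\<^bsub>S\<^esub> (G \<odot>\<^bsub>S\<^esub> H) K L \<Zcomp>\<^bsub>S\<^esub> \<alpha>\<^bsub>S\<^esub> G H (K \<odot>\<^bsub>S\<^esub> L)"
    by (simp add: simps) (auto intro!: fn_cong elim!: times_cases)
next
  have TS: "Ten S (ob A) (ob B) = ob (A \<boxtimes> B)" "Unit S = ob {pt}" for A B by auto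
  fix F G H assume "F \<in> Hom S G H"
  then obtain A B f g where 1: "G = ob A" "H = ob B" "A \<in> U" "B \<in> U" "F = cls A B (mk f g)" "rep A B (mk f g)"
    by (rule HomE)
  note wf1 = rep_wf[OF 1(6)]
  have pt_rep: "rep {pt} {pt} (lg_fun {pt} (\<lambda>x. x))" by (rule rep_fun) (auto simp: pt_closed)
  have Id1: "Id S \<one>\<^bsub>S\<^esub> = cls {pt} {pt} (lg_fun {pt} (\<lambda>x. x))"
    unfolding TS Id_fn[OF pt_closed] fn_def ..
  \<comment> \<open>The map \<open>sn\<close> is a bijection from \<open>{pt} \<boxtimes> A\<close>
    onto \<open>A\<close> with inverse \<open>pair pt\<close>, so the composite merely relabels
    inputs.\<close>
  have "fn ({pt} \<boxtimes> A) A sn \<Zcomp>\<^bsub>S\<^esub> cls A B (mk f g) = cls ({pt} \<boxtimes> A) B (relabel (pair pt) (\<lambda>x. x) (mk f g))"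
    by (rule fn_Comp_cls[OF 1(6)]) (use 1 pt_closed in \<open>auto elim!: times_cases\<close>)
  moreover have "cls ({pt} \<boxtimes> A) ({pt} \<boxtimes> B) (lg_fun {pt} (\<lambda>x. x) \<otimes>\<^sub>l mk f g) \<Zcomp>\<^bsub>S\<^esub> fn ({pt} \<boxtimes> B) B sn
      = cls ({pt} \<boxtimes> A) B (relabel (\<lambda>x. x) sn (lg_fun {pt} (\<lambda>x. x) \<otimes>\<^sub>l mk f g))"
    by (rule cls_Comp_fn[OF rep_TenA[OF pt_rep 1(6)]]) (use 1 in \<open>auto elim!: times_cases\<close>)
  ultimately show "(Id S \<one>\<^bsub>S\<^esub> \<otimes>\<^bsub>S\<^esub> F) \<Zcomp>\<^bsub>S\<^esub> \<l>\<^bsub>S\<^esub> H = \<l>\<^bsub>S\<^esub> G \<Zcomp>\<^bsub>S\<^esub> F"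
    unfolding Id1 1 LUnit_fn[OF 1(3)] LUnit_fn[OF 1(4)] cls_TenA[OF pt_rep 1(6)]
    using cls_cong[OF lg_lunit_nat[OF wf1]] by simp
  have "fn (A \<boxtimes> {pt}) A fs \<Zcomp>\<^bsub>S\<^esub> cls A B (mk f g) = cls (A \<boxtimes> {pt}) B (relabel (\<lambda>x. pair x pt) (\<lambda>x. x) (mk f g))"
    by (rule fn_Comp_cls[OF 1(6)]) (use 1 pt_closed in \<open>auto elim!: times_cases\<close>)
  moreover have "cls (A \<boxtimes> {pt}) (B \<boxtimes> {pt}) (mk f g \<otimes>\<^sub>l lg_fun {pt} (\<lambda>x. x)) \<Zcomp>\<^bsub>S\<^esub> fn (B \<boxtimes> {pt}) B fs
      = cls (A \<boxtimes> {pt}) B (relabel (\<lambda>x. x) fs (mk f g \<otimes>\<^sub>l lg_fun {pt} (\<lambda>x. x)))"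
    by (rule cls_Comp_fn[OF rep_TenA[OF 1(6) pt_rep]]) (use 1 in \<open>auto elim!: times_cases\<close>)
  ultimately show "(F \<otimes>\<^bsub>S\<^esub> Id S \<one>\<^bsub>S\<^esub>) \<Zcomp>\<^bsub>S\<^esub> \<r>\<^bsub>S\<^esub> H = \<r>\<^bsub>S\<^esub> G \<Zcomp>\<^bsub>S\<^esub> F"
    unfolding Id1 1 RUnit_fn[OF 1(3)] RUnit_fn[OF 1(4)] cls_TenA[OF 1(6) pt_rep]
    using cls_cong[OF lg_runit_nat[OF wf1]] by simp
  fix F' G' H' assume "F' \<in> Hom S G' H'"
  then obtain A' B' f' g' where 2: "G' = ob A'" "H' = ob B'" "A' \<in> U" "B' \<in> U"
    "F' = cls A' B' (mk f' g')" "rep A' B' (mk f' g')" by (rule HomE)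
  note wf2 = rep_wf[OF 2(6)]
  show "F \<otimes>\<^bsub>S\<^esub> F' \<in> Hom S (G \<odot>\<^bsub>S\<^esub> G') (H \<odot>\<^bsub>S\<^esub> H')"
    unfolding 1 2 TS cls_TenA[OF 1(6) 2(6)] by (rule cls_Hom[OF rep_TenA[OF 1(6) 2(6)]])
  have "fn (A \<boxtimes> A') (A' \<boxtimes> A) swap_fn \<Zcomp>\<^bsub>S\<^esub> cls (A' \<boxtimes> A) (B' \<boxtimes> B) (mk f' g' \<otimes>\<^sub>l mk f g)
      = cls (A \<boxtimes> A') (B' \<boxtimes> B) (relabel swap_fn (\<lambda>x. x) (mk f' g' \<otimes>\<^sub>l mk f g))"
    by (rule fn_Comp_cls[OF rep_TenA[OF 2(6) 1(6)]]) (use 1 2 in \<open>auto elim!: times_cases\<close>)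
  moreover have "cls (A \<boxtimes> A') (B \<boxtimes> B') (mk f g \<otimes>\<^sub>l mk f' g') \<Zcomp>\<^bsub>S\<^esub> fn (B \<boxtimes> B') (B' \<boxtimes> B) swap_fn
      = cls (A \<boxtimes> A') (B' \<boxtimes> B) (relabel (\<lambda>x. x) swap_fn (mk f g \<otimes>\<^sub>l mk f' g'))"
    by (rule cls_Comp_fn[OF rep_TenA[OF 1(6) 2(6)]]) (use 1 2 in \<open>auto elim!: times_cases\<close>)
  ultimately show "(F \<otimes>\<^bsub>S\<^esub> F') \<Zcomp>\<^bsub>S\<^esub> \<sigma>\<^bsub>S\<^esub> H H' = \<sigma>\<^bsub>S\<^esub> G G' \<Zcomp>\<^bsub>S\<^esub> (F' \<otimes>\<^bsub>S\<^esub> F)"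
    unfolding 1 2 Sym_fn[OF 1(3) 2(3)] Sym_fn[OF 1(4) 2(4)] cls_TenA[OF 1(6) 2(6)] cls_TenA[OF 2(6) 1(6)]
    using cls_cong[OF lg_swap_nat[OF wf1 wf2]] by simp
  {
    fix F'' G'' H'' assume "F'' \<in> Hom S G'' H''"
    then obtain A'' B'' f'' g'' where 3: "G'' = ob A''" "H'' = ob B''" "A'' \<in> U" "B'' \<in> U"
      "F'' = cls A'' B'' (mk f'' g'')" "rep A'' B'' (mk f'' g'')" by (rule HomE)
    note wf3 = rep_wf[OF 3(6)]
    note r12 = rep_TenA[OF 1(6) 2(6)] and r23 = rep_TenA[OF 2(6) 3(6)]
    note r = rep_TenA[OF r12 3(6)] rep_TenA[OF 1(6) r23]
    have "fn ((A \<boxtimes> A') \<boxtimes> A'') (A \<boxtimes> A' \<boxtimes> A'') assoc_fn \<Zcomp>\<^bsub>S\<^esub>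
        cls (A \<boxtimes> A' \<boxtimes> A'') (B \<boxtimes> B' \<boxtimes> B'') (mk f g \<otimes>\<^sub>l mk f' g' \<otimes>\<^sub>l mk f'' g'')
        = cls ((A \<boxtimes> A') \<boxtimes> A'') (B \<boxtimes> B' \<boxtimes> B'') (relabel unassoc_fn (\<lambda>x. x) (mk f g \<otimes>\<^sub>l mk f' g' \<otimes>\<^sub>l mk f'' g''))"
      by (rule fn_Comp_cls[OF r(2)]) (use 1 2 3 in \<open>auto elim!: times_cases\<close>)
    moreover have "cls ((A \<boxtimes> A') \<boxtimes> A'') ((B \<boxtimes> B') \<boxtimes> B'') ((mk f g \<otimes>\<^sub>l mk f' g') \<otimes>\<^sub>l mk f'' g'') \<Zcomp>\<^bsub>S\<^esub>
        fn ((B \<boxtimes> B') \<boxtimes> B'') (B \<boxtimes> B' \<boxtimes> B'') assoc_fn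
        = cls ((A \<boxtimes> A') \<boxtimes> A'') (B \<boxtimes> B' \<boxtimes> B'') (relabel (\<lambda>x. x) assoc_fn ((mk f g \<otimes>\<^sub>l mk f' g') \<otimes>\<^sub>l mk f'' g''))"
      by (rule cls_Comp_fn[OF r(1)]) (use 1 2 3 in \<open>auto elim!: times_cases\<close>)
    ultimately show "((F \<otimes>\<^bsub>S\<^esub> F') \<otimes>\<^bsub>S\<^esub> F'') \<Zcomp>\<^bsub>S\<^esub> \<alpha>\<^bsub>S\<^esub> H H' H'' = \<alpha>\<^bsub>S\<^esub> G G' G'' \<Zcomp>\<^bsub>S\<^esub> (F \<otimes>\<^bsub>S\<^esub> (F' \<otimes>\<^bsub>S\<^esub> F''))"
      unfolding 1 2 3 Assoc_fn[OF 1(3) 2(3) 3(3)] Assoc_fn[OF 1(4) 2(4) 3(4)]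
        cls_TenA[OF 1(6) 2(6)] cls_TenA[OF 2(6) 3(6)] cls_TenA[OF r12 3(6)] cls_TenA[OF 1(6) r23]
      using cls_cong[OF lg_assoc_nat[OF wf1 wf2 wf3]] by simp
  }
  fix F1 K F1' K' assume "F1 \<in> Hom S H K" "F1' \<in> Hom S H' K'"
  from this[unfolded 1 2]
  obtain D f1 g1 D' f1' g1' where 3: "K = ob D" "D \<in> U" "F1 = cls B D (mk f1 g1)" "rep B D (mk f1 g1)"
    "K' = ob D'" "D' \<in> U" "F1' = cls B' D' (mk f1' g1')" "rep B' D' (mk f1' g1')"
    by (elim HomE') simp
  note c = rep_Comp[OF 1(6) 3(4)] rep_Comp[OF 2(6) 3(8)]
  note t = rep_TenA[OF 1(6) 2(6)] rep_TenA[OF 3(4) 3(8)]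
  have "lg_comp (mk f g) (mk f1 g1) \<otimes>\<^sub>l lg_comp (mk f' g') (mk f1' g1') \<simeq>
      lg_comp (mk f g \<otimes>\<^sub>l mk f' g') (mk f1 g1 \<otimes>\<^sub>l mk f1' g1')"
    by (rule lg_ten_comp[OF rep_wf[OF 1(6)] rep_wf[OF 3(4)] rep_wf[OF 2(6)] rep_wf[OF 3(8)]])
  then show "(F \<Zcomp>\<^bsub>S\<^esub> F1) \<otimes>\<^bsub>S\<^esub> (F' \<Zcomp>\<^bsub>S\<^esub> F1') = (F \<otimes>\<^bsub>S\<^esub> F') \<Zcomp>\<^bsub>S\<^esub> (F1 \<otimes>\<^bsub>S\<^esub> F1')"
    unfolding 1 2 3 cls_Comp[OF 1(6) 3(4)] cls_Comp[OF 2(6) 3(8)] cls_TenA[OF c]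
      cls_TenA[OF 1(6) 2(6)] cls_TenA[OF 3(4) 3(8)] cls_Comp[OF t] by (rule cls_cong)
qed

end

end

section \<open>Sets and graphs as models\<close>

lemma Set_cat_simps [simp]:
  "Ob (Set_cat U) = U" "Dom (Set_cat U) (A, B, f) = A" "Cod (Set_cat U) (A, B, f) = B"
  "Comp (Set_cat U) (A, B, f) (B', D, g) = (A, D, compose A g f)"
  "Id (Set_cat U) A = (A, A, \<lambda>x \<in> A. x)"
  by (simp_all add: Set_cat_def)

lemma Hom_Set: "Hom (Set_cat U) A B = {(A, B, f) | f. A \<in> U \<and> B \<in> U \<and> f \<in> A \<rightarrow>\<^sub>E B}"
  by (auto simp: Hom_def Set_cat_def)

lemma Arr_Set: "f \<in> Arr (Set_cat U) \<longleftrightarrow> (\<exists>A B g. f = (A, B, g) \<and> A \<in> U \<and> B \<in> U \<and> g \<in> A \<rightarrow>\<^sub>E B)"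
  by (auto simp: Set_cat_def)

lemma in_Hom_Set: "(X, Y, f) \<in> Hom (Set_cat U) A B \<longleftrightarrow>
    X = A \<and> Y = B \<and> A \<in> U \<and> B \<in> U \<and> f \<in> A \<rightarrow>\<^sub>E B"
  by (auto simp: Hom_Set)

lemma cat_Set: "cat (Set_cat U)"
  by unfold_locales
    (auto simp: in_Hom_Set Arr_Set compose_def fun_eq_iff Pi_iff PiE_def extensional_def restrict_def)

definition graphs :: "'u set set \<Rightarrow> 'u graph set" where
  "graphs U = {G. Edges G \<in> U \<and> Verts G \<in> U \<and>
     src G \<in> Edges G \<rightarrow>\<^sub>E Verts G \<and> tgt G \<in> Edges G \<rightarrow>\<^sub>E Verts G}"

lemma Graph_cat_simps [simp]:
  "Ob (Graph_cat U) = graphs U" "Dom (Graph_cat U) (G, H, f) = G" "Cod (Graph_cat U) (G, H, f) = H"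
  "Comp (Graph_cat U) (G, H, e, v) (H', K, e', v') =
    (G, K, compose (Edges G) e' e, compose (Verts G) v' v)"
  "Id (Graph_cat U) G = (G, G, \<lambda>x \<in> Edges G. x, \<lambda>x \<in> Verts G. x)"
  by (auto simp: Graph_cat_def graphs_def Let_def)

definition graph_hom :: "'u graph \<Rightarrow> 'u graph \<Rightarrow> ('u \<Rightarrow> 'u) \<Rightarrow> ('u \<Rightarrow> 'u) \<Rightarrow> bool" where
  "graph_hom G H e v \<longleftrightarrow> e \<in> Edges G \<rightarrow>\<^sub>E Edges H \<and> v \<in> Verts G \<rightarrow>\<^sub>E Verts H \<and>
     (\<forall>x \<in> Edges G. src H (e x) = v (src G x) \<and> tgt H (e x) = v (tgt G x))"

lemma Hom_Graph: "Hom (Graph_cat U) G H =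
    {(G, H, e, v) | e v. G \<in> graphs U \<and> H \<in> graphs U \<and> graph_hom G H e v}"
  by (auto simp: Hom_def Graph_cat_def graphs_def graph_hom_def Let_def)

lemma graphs_ends:
  "G \<in> graphs U \<Longrightarrow> x \<in> Edges G \<Longrightarrow> src G x \<in> Verts G \<and> tgt G x \<in> Verts G"
  by (auto simp: graphs_def)

lemma Arr_Graph: "f \<in> Arr (Graph_cat U) \<longleftrightarrow>
    (\<exists>G H e v. f = (G, H, e, v) \<and> G \<in> graphs U \<and> H \<in> graphs U \<and> graph_hom G H e v)"
  by (auto simp: Graph_cat_def graphs_def graph_hom_def Let_def)

lemma in_Hom_Graph: "(X, Y, e, v) \<in> Hom (Graph_cat U) G H \<longleftrightarrow>
    X = G \<and> Y = H \<and> G \<in> graphs U \<and> H \<in> graphs U \<and> graph_hom G H e v"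
  by (auto simp: Hom_Graph)

lemma cat_Graph: "cat (Graph_cat U)"
  by unfold_locales
    (auto simp: in_Hom_Graph Arr_Graph graph_hom_def compose_def fun_eq_iff Pi_iff PiE_def extensional_def restrict_def
      dest: graphs_ends)

lemma single_vertex_simps [simp]:
  "Edges (single_vertex pt A) = A" "Verts (single_vertex pt A) = {pt}"
  "x \<in> A \<Longrightarrow> src (single_vertex pt A) x = pt" "x \<in> A \<Longrightarrow> tgt (single_vertex pt A) x = pt"
  by (auto simp: single_vertex_def)

lemma bij_betw_inverse:
  assumes "bij_betw f A B"
  obtains g where "bij_betw g B A" "\<And>x. x \<in> A \<Longrightarrow> g (f x) = x" "\<And>y. y \<in> B \<Longrightarrow> f (g y) = y"
  using assms by (metis bij_betw_inv_into bij_betw_inv_into_left bij_betw_inv_into_right)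

context set_universe
begin

lemma single_vertex_graphs: "A \<in> U \<Longrightarrow> single_vertex pt A \<in> graphs U"
  using pt_closed by (auto simp: graphs_def single_vertex_def)

lemma proj_eq: "proj1 pair A B = (\<lambda>z \<in> A \<boxtimes> B. fs z)" "proj2 pair A B = (\<lambda>z \<in> A \<boxtimes> B. sn z)"
  by (auto simp: proj1_def proj2_def pr1_def pr2_def)

text \<open>With \<open>()\<close> as the only node everywhere, the conditions on end points hold
  trivially, and the locale specialises to ordinary functions and spans of sets.\<close>

sublocale Set: graph_model "Set_cat U" U pair pt "set_products pair pt" "\<lambda>A. A" "\<lambda>A. A"
  "\<lambda>_. {()}" "\<lambda>_ _. ()" "\<lambda>_ _. ()" "\<lambda>f. snd (snd f)"
proof (intro graph_model.intro cat_Set graph_model_axioms.intro)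
  let ?C = "Set_cat U" and ?lab = "\<lambda>f. snd (snd f)"
  show "set_universe U pair pt" by (rule set_universe_axioms)
  fix G H assume G: "G \<in> Ob ?C" and H: "H \<in> Ob ?C"
  {
    fix \<psi> assume "bij_betw \<psi> G H"
    then obtain \<psi>' where *: "bij_betw \<psi> G H" "bij_betw \<psi>' H G" "\<And>x. x \<in> G \<Longrightarrow> \<psi>' (\<psi> x) = x"
      "\<And>y. y \<in> H \<Longrightarrow> \<psi> (\<psi>' y) = y" by (metis bij_betw_inverse)
    have "(G, H, restrict \<psi> G) \<in> Hom ?C G H" "(H, G, restrict \<psi>' H) \<in> Hom ?C H G"
      using G H * by (auto simp: in_Hom_Set bij_betw_def)
    moreover have "(G, H, restrict \<psi> G) \<Zcomp>\<^bsub>?C\<^esub> (H, G, restrict \<psi>' H) = Id ?C G"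
      "(H, G, restrict \<psi>' H) \<Zcomp>\<^bsub>?C\<^esub> (G, H, restrict \<psi> G) = Id ?C H"
      using * by (auto simp: compose_def fun_eq_iff bij_betw_def)
    ultimately have "(G, H, restrict \<psi> G) \<in> Isos ?C G H"
      unfolding Isos_def by blast
    then show "\<exists>h \<in> Isos ?C G H. \<forall>e \<in> G. ?lab h e = \<psi> e" by force
  }
  fix Q
  \<comment> \<open>One apex covers products and pullbacks: the coded pairs satisfying
    \<open>Q\<close>, a subset of the product and hence in \<open>U\<close> by
    \<open>subset_closed\<close>.\<close>
  let ?P = "{pair e e' | e e'. e \<in> G \<and> e' \<in> H \<and> Q e e'}"
  let ?p = "(?P, G, restrict fs ?P)" and ?q = "(?P, H, restrict sn ?P)"
  have P: "?P \<in> U" by (rule subset_closed[OF times_in_U[of G H]]) (use G H in auto)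
  have "\<exists>!u. u \<in> Hom ?C Z ?P \<and> u \<Zcomp>\<^bsub>?C\<^esub> ?p = a \<and> u \<Zcomp>\<^bsub>?C\<^esub> ?q = b"
    if ab0: "a \<in> Hom ?C Z G" "b \<in> Hom ?C Z H" "\<forall>x \<in> Dom ?C a. Q (?lab a x) (?lab b x)" for Z a b
  proof -
    obtain f g where ab: "a = (Z, G, f)" "b = (Z, H, g)" "Z \<in> U" "f \<in> Z \<rightarrow>\<^sub>E G" "g \<in> Z \<rightarrow>\<^sub>E H"
      using ab0 by (auto simp: Hom_Set)
    have Q: "Q (f x) (g x)" if "x \<in> Z" for x using that ab0(3) by (simp add: ab)
    show ?thesis
    proof (intro ex1I[of _ "(Z, ?P, \<lambda>z \<in> Z. pair (f z) (g z))"] conjI)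
      show "(Z, ?P, \<lambda>z \<in> Z. pair (f z) (g z)) \<in> Hom ?C Z ?P"
        using ab Q P by (auto simp: in_Hom_Set)
      show "(Z, ?P, \<lambda>z \<in> Z. pair (f z) (g z)) \<Zcomp>\<^bsub>?C\<^esub> ?p = a" "(Z, ?P, \<lambda>z \<in> Z. pair (f z) (g z)) \<Zcomp>\<^bsub>?C\<^esub> ?q = b"
        using ab Q by (auto simp: compose_def fun_eq_iff PiE_def extensional_def)
      fix u assume u: "u \<in> Hom ?C Z ?P \<and> u \<Zcomp>\<^bsub>?C\<^esub> ?p = a \<and> u \<Zcomp>\<^bsub>?C\<^esub> ?q = b"
      then obtain w where w: "u = (Z, ?P, w)" "w \<in> Z \<rightarrow>\<^sub>E ?P" by (auto simp: Hom_Set)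
      have "w z = (\<lambda>z \<in> Z. pair (f z) (g z)) z" for z
      proof (cases "z \<in> Z")
        case True
        then obtain e e' where e: "w z = pair e e'" "w z \<in> ?P" using PiE_mem[OF w(2) True] by blast
        have "compose Z (restrict fs ?P) w z = f z" "compose Z (restrict sn ?P) w z = g z"
          using u unfolding w ab by auto
        then show ?thesis using e True by (auto simp: compose_def)
      qed (use w in auto)
      then show "u = (Z, ?P, \<lambda>z \<in> Z. pair (f z) (g z))" unfolding w by auto
    qed
  qed
  moreover have "?p \<in> Hom ?C ?P G" "?q \<in> Hom ?C ?P H" using P G H by (auto simp: in_Hom_Set)
  ultimately have "universal_cone ?C G H (\<lambda>a b. \<forall>x \<in> Dom ?C a. Q (?lab a x) (?lab b x)) ?p ?q"
    unfolding universal_cone_def Set_cat_simps by auto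
  moreover have "bij_betw (\<lambda>x. (?lab ?p x, ?lab ?q x)) ?P {(e, e'). e \<in> G \<and> e' \<in> H \<and> Q e e'}"
    by (rule bij_betwI[where g = "\<lambda>(x, y). pair x y"]) auto
  moreover have "bij_betw (\<lambda>_. ((), ())) {()} ({()} \<times> {()})" by (auto simp: bij_betw_def)
  ultimately show "\<exists>p q \<phi>. universal_cone ?C G H (\<lambda>a b. \<forall>x \<in> Dom ?C a. Q (?lab a x) (?lab b x)) p q \<and>
        bij_betw \<phi> {()} ({()} \<times> {()}) \<and>
        bij_betw (\<lambda>x. (?lab p x, ?lab q x)) (Dom ?C p) {(e, e'). e \<in> G \<and> e' \<in> H \<and> Q e e'} \<and>
        (\<forall>x \<in> Dom ?C p. \<phi> () = ((), ()) \<and> \<phi> () = ((), ()))"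
    by (intro exI[of _ ?p] exI[of _ ?q] exI[of _ "\<lambda>_. ((), ())"]) simp
next
  fix h G H assume "h \<in> Isos (Set_cat U) G H"
  then obtain f g where h: "h = (G, H, f)" "f \<in> G \<rightarrow>\<^sub>E H" "g \<in> H \<rightarrow>\<^sub>E G"
    "compose G g f = (\<lambda>x \<in> G. x)" "compose H f g = (\<lambda>x \<in> H. x)"
    by (auto simp: Isos_def Hom_Set)
  then have "g (f x) = x" if "x \<in> G" for x using that by (metis compose_eq restrict_apply')
  moreover have "f (g x) = x" if "x \<in> H" for x using that h by (metis compose_eq restrict_apply')
  ultimately have "bij_betw f G H" using h by (intro bij_betwI[where g = g]) auto
  then show "bij_betw (snd (snd h)) G H \<and> (\<exists>\<phi>. bij_betw \<phi> {()} {()} \<and> (\<forall>e \<in> G. () = \<phi> () \<and> () = \<phi> ()))"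
    using h by (auto intro!: exI[of _ id])
next
  fix G A \<theta> assume "G \<in> Ob (Set_cat U)" "A \<in> U" "\<theta> \<in> G \<rightarrow> A"
  then show "\<exists>k \<in> Hom (Set_cat U) G A. \<forall>x \<in> G. snd (snd k) x = \<theta> x"
    by (intro bexI[of _ "(G, A, restrict \<theta> G)"]) (auto simp: Hom_Set)
next
  fix A k G k' assume "A \<in> U" "k \<in> Hom (Set_cat U) G A" "k' \<in> Hom (Set_cat U) G A"
    "\<And>x. x \<in> G \<Longrightarrow> snd (snd k) x = snd (snd k') x"
  then show "k = k'" by (auto simp: Hom_Set intro: PiE_ext)
next
  fix f g G H K x assume f: "f \<in> Hom (Set_cat U) G H" "x \<in> G"
  then show "snd (snd f) x \<in> H" by (auto simp: Hom_Set)
  assume "g \<in> Hom (Set_cat U) H K"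
  with f show "snd (snd (f \<Zcomp>\<^bsub>Set_cat U\<^esub> g)) x = snd (snd g) (snd (snd f) x)"
    by (auto simp: Hom_Set compose_def)
next
  fix A B assume "A \<in> U" "B \<in> U"
  then show "Pr1 (set_products pair pt) A B \<in> Hom (Set_cat U) (A \<boxtimes> B) A \<and>
      Pr2 (set_products pair pt) A B \<in> Hom (Set_cat U) (A \<boxtimes> B) B"
    by (auto simp: in_Hom_Set set_products_def proj_eq elim!: times_cases)
qed (simp_all add: set_products_def proj_eq)

sublocale Graph: graph_model "Graph_cat U" U pair pt "single_vertex_products pair pt" "single_vertex pt"
  Edges Verts src tgt "\<lambda>(G, H, e, v). e"
proof (intro graph_model.intro cat_Graph graph_model_axioms.intro)
  let ?C = "Graph_cat U" and ?lab = "\<lambda>(G :: 'u graph, H :: 'u graph, e :: 'u \<Rightarrow> 'u, v :: 'u \<Rightarrow> 'u). e"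
  show "set_universe U pair pt" by (rule set_universe_axioms)
  fix G H assume G: "G \<in> Ob ?C" and H: "H \<in> Ob ?C"
  {
    fix \<phi> \<psi> assume \<phi>: "bij_betw \<phi> (Verts G) (Verts H)" and \<psi>: "bij_betw \<psi> (Edges G) (Edges H)"
      and hom: "\<forall>e \<in> Edges G. src H (\<psi> e) = \<phi> (src G e) \<and> tgt H (\<psi> e) = \<phi> (tgt G e)"
    obtain \<phi>' where 1: "bij_betw \<phi>' (Verts H) (Verts G)" "\<And>x. x \<in> Verts G \<Longrightarrow> \<phi>' (\<phi> x) = x"
      "\<And>y. y \<in> Verts H \<Longrightarrow> \<phi> (\<phi>' y) = y" using bij_betw_inverse[OF \<phi>] by blast
    obtain \<psi>' where 2: "bij_betw \<psi>' (Edges H) (Edges G)" "\<And>x. x \<in> Edges G \<Longrightarrow> \<psi>' (\<psi> x) = x"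
      "\<And>y. y \<in> Edges H \<Longrightarrow> \<psi> (\<psi>' y) = y" using bij_betw_inverse[OF \<psi>] by blast
    note mem = \<phi>[THEN bij_betwE, rule_format] \<psi>[THEN bij_betwE, rule_format]
      1(1)[THEN bij_betwE, rule_format] 2(1)[THEN bij_betwE, rule_format]
    let ?h = "(G, H, restrict \<psi> (Edges G), restrict \<phi> (Verts G))"
    let ?k = "(H, G, restrict \<psi>' (Edges H), restrict \<phi>' (Verts H))"
    have ends: "src G x \<in> Verts G" "tgt G x \<in> Verts G" if "x \<in> Edges G" for x
      using graphs_ends[of G U x] G that by auto
    have ends': "src H y \<in> Verts H" "tgt H y \<in> Verts H" if "y \<in> Edges H" for y
      using graphs_ends[of H U y] H that by auto
    \<comment> \<open>The inverse of a bijective morphism respects end points: apply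
      \<open>\<phi>'\<close> to the equations for \<open>\<psi>\<close> at the edge
      \<open>\<psi>' y\<close>.\<close>
    have "src G (\<psi>' y) = \<phi>' (src H y)" "tgt G (\<psi>' y) = \<phi>' (tgt H y)" if "y \<in> Edges H" for y
      using 1(2)[OF ends(1)[OF mem(4)[OF that]]] 1(2)[OF ends(2)[OF mem(4)[OF that]]]
        hom mem(4)[OF that] 2(3)[OF that] by auto
    note inv_ends = this
    have "restrict \<psi>' (Edges H) \<in> Edges H \<rightarrow>\<^sub>E Edges G" using mem(4) by auto
    moreover have "restrict \<phi>' (Verts H) \<in> Verts H \<rightarrow>\<^sub>E Verts G" using mem(3) by auto
    moreover have "\<forall>x \<in> Edges H. src G (restrict \<psi>' (Edges H) x) = restrict \<phi>' (Verts H) (src H x) \<and>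
        tgt G (restrict \<psi>' (Edges H) x) = restrict \<phi>' (Verts H) (tgt H x)"
      using inv_ends ends' by auto
    ultimately have "graph_hom H G (restrict \<psi>' (Edges H)) (restrict \<phi>' (Verts H))"
      unfolding graph_hom_def by blast
    moreover have "restrict \<psi> (Edges G) \<in> Edges G \<rightarrow>\<^sub>E Edges H" using mem(2) by auto
    moreover have "restrict \<phi> (Verts G) \<in> Verts G \<rightarrow>\<^sub>E Verts H" using mem(1) by auto
    moreover have "\<forall>x \<in> Edges G. src H (restrict \<psi> (Edges G) x) = restrict \<phi> (Verts G) (src G x) \<and>
        tgt H (restrict \<psi> (Edges G) x) = restrict \<phi> (Verts G) (tgt G x)"
      using hom ends by auto
    ultimately have "graph_hom H G (restrict \<psi>' (Edges H)) (restrict \<phi>' (Verts H))"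
      "graph_hom G H (restrict \<psi> (Edges G)) (restrict \<phi> (Verts G))"
      unfolding graph_hom_def by blast+
    then have "?h \<in> Hom ?C G H" "?k \<in> Hom ?C H G"
      using G H by (simp_all add: in_Hom_Graph)
    moreover have "?h \<Zcomp>\<^bsub>?C\<^esub> ?k = Id ?C G" "?k \<Zcomp>\<^bsub>?C\<^esub> ?h = Id ?C H"
      using 1(2,3) 2(2,3) mem by (simp_all add: compose_def fun_eq_iff)
    ultimately have "?h \<in> Isos ?C G H"
      unfolding Isos_def by blast
    then show "\<exists>h \<in> Isos ?C G H. \<forall>e \<in> Edges G. ?lab h e = \<psi> e" by force
  }
  fix Q
  \<comment> \<open>The condition \<open>Q\<close> cuts down the edges only; every pair of vertices
    is kept.\<close>
  let ?E = "{pair e e' | e e'. e \<in> Edges G \<and> e' \<in> Edges H \<and> Q e e'}" and ?V = "Verts G \<boxtimes> Verts H"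
  let ?P = "\<lparr>Edges = ?E, Verts = ?V,
    src = (\<lambda>z \<in> ?E. pair (src G (fs z)) (src H (sn z))), tgt = (\<lambda>z \<in> ?E. pair (tgt G (fs z)) (tgt H (sn z)))\<rparr>"
  let ?p = "(?P, G, restrict fs ?E, restrict fs ?V)" and ?q = "(?P, H, restrict sn ?E, restrict sn ?V)"
  have GH: "Edges G \<in> U" "Edges H \<in> U" "Verts G \<in> U" "Verts H \<in> U" using G H by (auto simp: graphs_def)
  have "?E \<in> U" by (rule subset_closed[OF times_in_U[OF GH(1,2)]]) auto
  then have P: "?P \<in> graphs U"
    unfolding graphs_def using GH graphs_ends[of G U] graphs_ends[of H U] G H by auto
  have pq: "?p \<in> Hom ?C ?P G" "?q \<in> Hom ?C ?P H"
    using P G H graphs_ends[of G U] graphs_ends[of H U]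
    by (auto simp: in_Hom_Graph graph_hom_def elim!: times_cases)
  have "\<exists>!u. u \<in> Hom ?C Z ?P \<and> u \<Zcomp>\<^bsub>?C\<^esub> ?p = a \<and> u \<Zcomp>\<^bsub>?C\<^esub> ?q = b"
    if ab0: "a \<in> Hom ?C Z G" "b \<in> Hom ?C Z H" "\<forall>x \<in> Edges (Dom ?C a). Q (?lab a x) (?lab b x)" for Z a b
  proof -
    obtain f g v w where ab: "a = (Z, G, f, v)" "b = (Z, H, g, w)" "Z \<in> graphs U" "graph_hom Z G f v" "graph_hom Z H g w"
      using ab0 by (auto simp: Hom_Graph)
    have Q: "Q (f x) (g x)" if "x \<in> Edges Z" for x using that ab0(3) by (simp add: ab)
    let ?u = "(Z, ?P, \<lambda>z \<in> Edges Z. pair (f z) (g z), \<lambda>z \<in> Verts Z. pair (v z) (w z))"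
    show ?thesis
    proof (intro ex1I[of _ ?u] conjI)
      have "\<exists>e e'. pair (f x) (g x) = pair e e' \<and> e \<in> Edges G \<and> e' \<in> Edges H \<and> Q e e'" if "x \<in> Edges Z" for x
        using that Q ab(4,5) by (auto simp: graph_hom_def)
      then show "?u \<in> Hom ?C Z ?P"
        using ab P graphs_ends[OF ab(3)] by (auto simp: in_Hom_Graph graph_hom_def PiE_mem)
      show "?u \<Zcomp>\<^bsub>?C\<^esub> ?p = a" "?u \<Zcomp>\<^bsub>?C\<^esub> ?q = b"
        using ab Q by (auto simp: compose_def fun_eq_iff PiE_def extensional_def graph_hom_def)
      fix u assume u: "u \<in> Hom ?C Z ?P \<and> u \<Zcomp>\<^bsub>?C\<^esub> ?p = a \<and> u \<Zcomp>\<^bsub>?C\<^esub> ?q = b"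
      then obtain k l where k: "u = (Z, ?P, k, l)" "k \<in> Edges Z \<rightarrow>\<^sub>E ?E" "l \<in> Verts Z \<rightarrow>\<^sub>E ?V"
        by (auto simp: Hom_Graph graph_hom_def)
      have eq: "compose (Edges Z) (restrict fs ?E) k = f" "compose (Edges Z) (restrict sn ?E) k = g"
          "compose (Verts Z) (restrict fs ?V) l = v" "compose (Verts Z) (restrict sn ?V) l = w"
        using u unfolding k ab by auto
      have "k z = (\<lambda>z \<in> Edges Z. pair (f z) (g z)) z" for z
      proof (cases "z \<in> Edges Z")
        case True
        then obtain e e' where "k z = pair e e'" "k z \<in> ?E" using PiE_mem[OF k(2) True] by blast
        then show ?thesis using True by (auto simp: eq[symmetric] compose_def)
      qed (use k in auto)
      moreover have "l z = (\<lambda>z \<in> Verts Z. pair (v z) (w z)) z" for z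
      proof (cases "z \<in> Verts Z")
        case True
        then obtain e e' where "l z = pair e e'" "l z \<in> ?V"
          using PiE_mem[OF k(3) True] by (auto elim: times_cases)
        then show ?thesis using True by (auto simp: eq[symmetric] compose_def)
      qed (use k in auto)
      ultimately show "u = ?u" unfolding k by auto
    qed
  qed
  then have "universal_cone ?C G H (\<lambda>a b. \<forall>x \<in> Edges (Dom ?C a). Q (?lab a x) (?lab b x)) ?p ?q"
    using pq unfolding universal_cone_def Graph_cat_simps by auto
  moreover have "bij_betw (\<lambda>x. (?lab ?p x, ?lab ?q x)) ?E {(e, e'). e \<in> Edges G \<and> e' \<in> Edges H \<and> Q e e'}"
    by (rule bij_betwI[where g = "\<lambda>(x, y). pair x y"]) auto
  moreover have "bij_betw (\<lambda>z. (fs z, sn z)) ?V (Verts G \<times> Verts H)"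
    by (rule bij_betwI[where g = "\<lambda>(x, y). pair x y"]) (auto elim!: times_cases)
  ultimately show "\<exists>p q \<phi>. universal_cone ?C G H (\<lambda>a b. \<forall>x \<in> Edges (Dom ?C a). Q (?lab a x) (?lab b x)) p q \<and>
        bij_betw \<phi> (Verts (Dom ?C p)) (Verts G \<times> Verts H) \<and>
        bij_betw (\<lambda>x. (?lab p x, ?lab q x)) (Edges (Dom ?C p)) {(e, e'). e \<in> Edges G \<and> e' \<in> Edges H \<and> Q e e'} \<and>
        (\<forall>x \<in> Edges (Dom ?C p). \<phi> (src (Dom ?C p) x) = (src G (?lab p x), src H (?lab q x)) \<and>
          \<phi> (tgt (Dom ?C p) x) = (tgt G (?lab p x), tgt H (?lab q x)))"
    by (intro exI[of _ ?p] exI[of _ ?q] exI[of _ "\<lambda>z. (fs z, sn z)"]) auto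
next
  fix h G H assume "h \<in> Isos (Graph_cat U) G H"
  then obtain f g v w where h: "h = (G, H, f, v)" "graph_hom G H f v" "graph_hom H G g w"
    "compose (Edges G) g f = (\<lambda>x \<in> Edges G. x)" "compose (Edges H) f g = (\<lambda>x \<in> Edges H. x)"
    "compose (Verts G) w v = (\<lambda>x \<in> Verts G. x)" "compose (Verts H) v w = (\<lambda>x \<in> Verts H. x)"
    by (auto simp: Isos_def Hom_Graph)
  have "g (f x) = x" if "x \<in> Edges G" for x using that h(4) by (metis compose_eq restrict_apply')
  moreover have "f (g x) = x" if "x \<in> Edges H" for x using that h(5) by (metis compose_eq restrict_apply')
  ultimately have 1: "bij_betw f (Edges G) (Edges H)"
    using h by (intro bij_betwI[where g = g]) (auto simp: graph_hom_def)
  have "w (v x) = x" if "x \<in> Verts G" for x using that h(6) by (metis compose_eq restrict_apply')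
  moreover have "v (w x) = x" if "x \<in> Verts H" for x using that h(7) by (metis compose_eq restrict_apply')
  ultimately have "bij_betw v (Verts G) (Verts H)"
    using h by (intro bij_betwI[where g = w]) (auto simp: graph_hom_def)
  then show "bij_betw (case h of (G, H, e, v) \<Rightarrow> e) (Edges G) (Edges H) \<and>
      (\<exists>\<phi>. bij_betw \<phi> (Verts G) (Verts H) \<and>
        (\<forall>e \<in> Edges G. src H ((case h of (G, H, e, v) \<Rightarrow> e) e) = \<phi> (src G e) \<and>
           tgt H ((case h of (G, H, e, v) \<Rightarrow> e) e) = \<phi> (tgt G e)))"
    using h 1 by (auto simp: graph_hom_def)
next
  fix G A \<theta> assume G: "G \<in> Ob (Graph_cat U)" "A \<in> U" "\<theta> \<in> Edges G \<rightarrow> A"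
  \<comment> \<open>Vertices can only go to \<open>pt\<close>, and both ends of every edge of the
    target are \<open>pt\<close>, so an arbitrary map on edges is a morphism.\<close>
  have "(G, single_vertex pt A, restrict \<theta> (Edges G), \<lambda>x \<in> Verts G. pt) \<in> Hom (Graph_cat U) G (single_vertex pt A)"
    using G single_vertex_graphs graphs_ends[of G U] by (auto simp: in_Hom_Graph graph_hom_def Pi_iff)
  then show "\<exists>k \<in> Hom (Graph_cat U) G (single_vertex pt A). \<forall>x \<in> Edges G. (case k of (G, H, e, v) \<Rightarrow> e) x = \<theta> x"
    by (rule bexI[rotated]) simp
next
  fix A k G k' assume "A \<in> U" "k \<in> Hom (Graph_cat U) G (single_vertex pt A)" "k' \<in> Hom (Graph_cat U) G (single_vertex pt A)"
    "\<And>x. x \<in> Edges G \<Longrightarrow> (case k of (G, H, e, v) \<Rightarrow> e) x = (case k' of (G, H, e, v) \<Rightarrow> e) x"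
  then show "k = k'" by (auto simp: Hom_Graph graph_hom_def intro: PiE_ext)
next
  fix f g G H K x assume f: "f \<in> Hom (Graph_cat U) G H" "x \<in> Edges G"
  then show "(case f of (G, H, e, v) \<Rightarrow> e) x \<in> Edges H" by (auto simp: Hom_Graph graph_hom_def)
  assume "g \<in> Hom (Graph_cat U) H K"
  with f show "(case f \<Zcomp>\<^bsub>Graph_cat U\<^esub> g of (G, H, e, v) \<Rightarrow> e) x =
      (case g of (G, H, e, v) \<Rightarrow> e) ((case f of (G, H, e, v) \<Rightarrow> e) x)"
    by (auto simp: Hom_Graph compose_def)
next
  fix A B assume "A \<in> U" "B \<in> U"
  then show "Pr1 (single_vertex_products pair pt) (single_vertex pt A) (single_vertex pt B)
        \<in> Hom (Graph_cat U) (single_vertex pt (A \<boxtimes> B)) (single_vertex pt A) \<and>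
      Pr2 (single_vertex_products pair pt) (single_vertex pt A) (single_vertex pt B)
        \<in> Hom (Graph_cat U) (single_vertex pt (A \<boxtimes> B)) (single_vertex pt B)"
    by (auto simp: in_Hom_Graph graph_hom_def single_vertex_products_def Let_def proj_eq single_vertex_graphs
        elim!: times_cases)
next
  fix G assume "G \<in> Ob (Graph_cat U)"
  then show "src G \<in> Edges G \<rightarrow> Verts G \<and> tgt G \<in> Edges G \<rightarrow> Verts G"
    using graphs_ends[of G U] by auto
qed (simp_all add: single_vertex_products_def Let_def proj_eq single_vertex_graphs)

end

section \<open>Stateful processes as labelled graphs\<close>

lemma relabel_relabel: "relabel i j (relabel i' j' m) = relabel (i \<circ> i') (j \<circ> j') m"
  by (simp add: relabel_def comp_assoc)

text \<open>The isomorphism matches composable pairs of arcs with elements of \<open>S\<close>. As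
  it preserves labels, it sends a pair to its input label, which is also its output label. The two
  conclusions are surjectivity and injectivity of this map.\<close>

lemma lg_comp_identityD:
  assumes "lg_comp p q \<simeq> lg_fun S (\<lambda>x. x)"
  shows "s \<in> S \<Longrightarrow> \<exists>e \<in> arcs p. \<exists>e' \<in> arcs q. lout p e = lin q e' \<and> lin p e = s \<and> lout q e' = s"
    and "e \<in> arcs p \<Longrightarrow> e' \<in> arcs q \<Longrightarrow> d \<in> arcs p \<Longrightarrow> d' \<in> arcs q \<Longrightarrow> lout p e = lin q e' \<Longrightarrow>
      lout p d = lin q d' \<Longrightarrow> lin p e = lin p d \<Longrightarrow> e = d \<and> e' = d'"
proof -
  obtain \<psi> where "bij_betw \<psi> (arcs (lg_comp p q)) (arcs (lg_fun S (\<lambda>x. x)))"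
    "\<forall>x \<in> arcs (lg_comp p q). lin (lg_fun S (\<lambda>x. x)) (\<psi> x) = lin (lg_comp p q) x \<and>
      lout (lg_fun S (\<lambda>x. x)) (\<psi> x) = lout (lg_comp p q) x"
    using assms unfolding lgraph_iso_def by blast
  moreover have "arcs (lg_fun S (\<lambda>x. x)) = S" "lin (lg_fun S (\<lambda>x. x)) x = x" "lout (lg_fun S (\<lambda>x. x)) x = x"
    "lin (lg_comp p q) y = lin p (fst y)" "lout (lg_comp p q) y = lout q (snd y)" for x y
    by (simp_all add: lg_comp_def lg_fun_def)
  ultimately have "bij_betw \<psi> (arcs (lg_comp p q)) S"
    "\<forall>x \<in> arcs (lg_comp p q). \<psi> x = lin p (fst x) \<and> \<psi> x = lout q (snd x)"
    by (simp_all only:)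
  then have \<psi>: "bij_betw \<psi> (arcs (lg_comp p q)) S"
    "\<And>x. x \<in> arcs (lg_comp p q) \<Longrightarrow> \<psi> x = lin p (fst x) \<and> \<psi> x = lout q (snd x)"
    by blast+
  have arc: "(e, e') \<in> arcs (lg_comp p q) \<longleftrightarrow> e \<in> arcs p \<and> e' \<in> arcs q \<and> lout p e = lin q e'" for e e'
    by (simp add: lg_comp_def)
  {
    assume "s \<in> S"
    then obtain x where "x \<in> arcs (lg_comp p q)" "\<psi> x = s"
      using \<psi>(1) by (auto simp: bij_betw_def)
    then show "\<exists>e \<in> arcs p. \<exists>e' \<in> arcs q. lout p e = lin q e' \<and> lin p e = s \<and> lout q e' = s"
      using \<psi>(2)[of x] arc[of "fst x" "snd x"] by (intro bexI[of _ "fst x"] bexI[of _ "snd x"]) auto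
  }
  assume *: "e \<in> arcs p" "e' \<in> arcs q" "d \<in> arcs p" "d' \<in> arcs q" "lout p e = lin q e'"
      "lout p d = lin q d'" "lin p e = lin p d"
  then have "(e, e') \<in> arcs (lg_comp p q)" "(d, d') \<in> arcs (lg_comp p q)" by (auto simp: arc)
  moreover from this have "\<psi> (e, e') = \<psi> (d, d')" using \<psi>(2) * by fastforce
  ultimately show "e = d \<and> e' = d'" using \<psi>(1) by (auto simp: bij_betw_def inj_on_def)
qed

text \<open>If two arcs of \<open>p\<close> share an input label, each extends to a composable pair
  with an arc of \<open>q\<close>; both pairs have the same input, so they coincide. For a shared
  output label the mirrored argument first needs that a composable pair in \<open>q\<close>,
  \<open>p\<close> also closes up in the other order.\<close>

lemma lg_iso_bij:
  assumes p: "lgraph_on S T p" and q: "lgraph_on T S q"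
    and pq: "lg_comp p q \<simeq> lg_fun S (\<lambda>x. x)" and qp: "lg_comp q p \<simeq> lg_fun T (\<lambda>x. x)"
  shows "bij_betw (lin p) (arcs p) S" "bij_betw (lout p) (arcs p) T"
proof -
  note pq1 = lg_comp_identityD(1)[OF pq] and pq2 = lg_comp_identityD(2)[OF pq]
  note qp1 = lg_comp_identityD(1)[OF qp] and qp2 = lg_comp_identityD(2)[OF qp]
  have mem: "lin p e \<in> S" "lout p e \<in> T" if "e \<in> arcs p" for e
    using p that by (auto simp: lgraph_on_def)
  have "e = d" if e: "e \<in> arcs p" "d \<in> arcs p" "lin p e = lin p d" for e d
  proof -
    obtain e' where "e' \<in> arcs q" "lout p e = lin q e'" using qp1[OF mem(2)[OF e(1)]] by metis
    moreover obtain d' where "d' \<in> arcs q" "lout p d = lin q d'" using qp1[OF mem(2)[OF e(2)]] by metis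
    ultimately show ?thesis using pq2 e by blast
  qed
  moreover have "e = d" if e: "e \<in> arcs p" "d \<in> arcs p" "lout p e = lout p d" for e d
  proof -
    obtain e' where e': "e' \<in> arcs q" "lin p e = lout q e'" using pq1[OF mem(1)[OF e(1)]] by metis
    obtain d' where d': "d' \<in> arcs q" "lin p d = lout q d'" using pq1[OF mem(1)[OF e(2)]] by metis
    have "lin q e' \<in> T" "lin q d' \<in> T" using q e' d' by (auto simp: lgraph_on_def)
    \<comment> \<open>Compare \<open>(e', e)\<close> with the pair that \<open>qp1\<close> assigns
      to the element \<open>lin q e'\<close> of \<open>T\<close>. Both start with that label, so
      they are equal, and the assigned pair ends where it starts.\<close>
    have "lout p e = lin q e'" if "e \<in> arcs p" "e' \<in> arcs q" "lin p e = lout q e'" for e e'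
    proof -
      have "lin q e' \<in> T" using q that by (auto simp: lgraph_on_def)
      then obtain c' c where c: "c' \<in> arcs q" "c \<in> arcs p" "lout q c' = lin p c" "lin q c' = lin q e'" "lout p c = lin q e'"
        using qp1 by metis
      then have "c' = e' \<and> c = e" using qp2[of c' c e' e] that by simp
      then show ?thesis using c by simp
    qed
    then have "lin q e' = lin q d'" using e e' d' by metis
    then show ?thesis using qp2[of e' e d' d] e e' d' by simp
  qed
  ultimately have "inj_on (lin p) (arcs p)" "inj_on (lout p) (arcs p)" by (auto simp: inj_on_def)
  moreover have "lin p ` arcs p = S" "lout p ` arcs p = T"
    using pq1 qp1 mem by (auto simp: image_iff) metis+
  ultimately show "bij_betw (lin p) (arcs p) S" "bij_betw (lout p) (arcs p) T"
    by (auto simp: bij_betw_def)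
qed

context graph_model
begin

lemma rep_object:
  assumes "G \<in> Ob C" "A \<in> U" "B \<in> U" "a \<in> ed G \<rightarrow> A" "b \<in> ed G \<rightarrow> B"
  shows "rep A B \<lparr>nodes = vt G, arcs = ed G, tail = sr G, head = tg G, lin = a, lout = b\<rparr>"
proof -
  obtain f where f: "f \<in> Hom C G (ob A)" "\<forall>x \<in> ed G. lab f x = a x"
    using hom_ob_ex[OF assms(1,2,4)] by blast
  obtain g where g: "g \<in> Hom C G (ob B)" "\<forall>x \<in> ed G. lab g x = b x"
    using hom_ob_ex[OF assms(1,3,5)] by blast
  have "Dom C f = G" using f by (simp add: Hom_def)
  then have "mk f g \<simeq> \<lparr>nodes = vt G, arcs = ed G, tail = sr G, head = tg G, lin = a, lout = b\<rparr>"
    using f g sr_tg[OF assms(1)] by (intro lgraph_iso_cong) (auto simp: mk_def wf_lgraph_def)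
  then show ?thesis using spansI[OF f(1) g(1)] assms unfolding rep_def by blast
qed

end

section \<open>Stateful processes as small labelled graphs\<close>

context set_universe
begin

abbreviation M where "M \<equiv> Span_Set U pair pt"
abbreviation N where "N \<equiv> Span_Graph_single U pair pt"

lemma M_eq: "span_smc (Set_cat U) (set_products pair pt) ((\<lambda>A. A) ` U) = M"
  by (simp add: Span_Set_def)

lemma N_eq: "span_smc (Graph_cat U) (single_vertex_products pair pt) (single_vertex pt ` U) = N"
  by (simp add: Span_Graph_single_def)

lemmas M_Comp = Set.cls_Comp[unfolded M_eq] and M_TenA = Set.cls_TenA[unfolded M_eq]
  and M_Hom = Set.cls_Hom[unfolded M_eq] and M_Hom_eq = Set.Hom_S[unfolded M_eq]
  and M_Inv = Set.Inv_fn[unfolded M_eq] and M_Isos = Set.fn_Isos[unfolded M_eq]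
  and M_fn_Comp = Set.fn_Comp[unfolded M_eq] and M_fn_TenA = Set.fn_TenA[unfolded M_eq]
  and M_Comp_fn = Set.cls_Comp_fn[unfolded M_eq] and M_fn_Comp_cls = Set.fn_Comp_cls[unfolded M_eq]
  and M_Id = Set.Id_fn[unfolded M_eq] and M_Sym = Set.Sym_fn[unfolded M_eq]
  and M_Assoc = Set.Assoc_fn[unfolded M_eq] and M_LUnit = Set.LUnit_fn[unfolded M_eq]
  and M_RUnit = Set.RUnit_fn[unfolded M_eq]

lemma M_simps [simp]: "Ob M = U" "Ten M A B = A \<boxtimes> B" "Unit M = {pt}"
  "Dom M (Set.cls A B m) = A" "Cod M (Set.cls A B m) = B"
  "Dom M (Set.fn A B h) = A" "Cod M (Set.fn A B h) = B"
  unfolding M_eq[symmetric] by (simp_all add: Set.cls_def Set.fn_def span_cat_def)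

text \<open>Nodes and arcs are members of \<open>U\<close>, so that the graph can be read both as a
  process with state space \<open>nodes m\<close> and as a span of graphs.\<close>

definition small :: "'u set \<Rightarrow> 'u set \<Rightarrow> ('u, 'u, 'u) lgraph \<Rightarrow> bool" where
  "small A B m \<longleftrightarrow> A \<in> U \<and> B \<in> U \<and> nodes m \<in> U \<and> arcs m \<in> U \<and> lgraph_on A B m"

text \<open>The span of sets underlying a process: states become part of the labels, and the single
  remaining node is that of a set.\<close>

definition flat :: "('u, 'u, 'u) lgraph \<Rightarrow> (unit, 'u, 'u) lgraph" where
  "flat m = \<lparr>nodes = {()}, arcs = arcs m, tail = (\<lambda>_. ()), head = (\<lambda>_. ()),
     lin = (\<lambda>e. pair (tail m e) (lin m e)), lout = (\<lambda>e. pair (head m e) (lout m e))\<rparr>"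

definition process :: "'u set \<Rightarrow> 'u set \<Rightarrow> ('u, 'u, 'u) lgraph \<Rightarrow> 'u set \<times> ('u set, 'u fn) span_arr" where
  "process A B m = (nodes m, Set.cls (nodes m \<boxtimes> A) (nodes m \<boxtimes> B) (flat m))"

text \<open>Only the members \<open>m'\<close> have to be small. The argument may have any type, so
  composites of graphs need not be coded before they are inserted.\<close>

definition process_class :: "'u set \<Rightarrow> 'u set \<Rightarrow> ('v, 'e, 'u) lgraph \<Rightarrow> ('u set, ('u set, 'u fn) span_arr) st_arr" where
  "process_class A B m = (A, B, {process A B m' | m'. small A B m' \<and> m' \<simeq> m})"

lemma small_wf: "small A B m \<Longrightarrow> wf_lgraph m"
  by (auto simp: small_def lgraph_on_def)

lemma rep_flat:
  assumes "small A B m" shows "Set.rep (nodes m \<boxtimes> A) (nodes m \<boxtimes> B) (flat m)"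
  unfolding flat_def using assms
  by (intro Set.rep_object) (auto simp: small_def lgraph_on_def wf_lgraph_def)

lemma st_pairs_eq:
  assumes "A \<in> U" "B \<in> U"
  shows "st_pairs M A B = {process A B m | m. small A B m}"
proof (intro equalityI subsetI)
  fix x assume "x \<in> {process A B m | m. small A B m}"
  then show "x \<in> st_pairs M A B"
    using M_Hom[OF rep_flat] by (auto simp: st_pairs_def process_def small_def)
next
  fix x assume "x \<in> st_pairs M A B"
  then obtain S F where x: "x = (S, F)" "S \<in> U" "F \<in> Hom M (S \<boxtimes> A) (S \<boxtimes> B)" by (auto simp: st_pairs_def)
  then obtain f g where F: "F = Set.cls (S \<boxtimes> A) (S \<boxtimes> B) (Set.mk f g)"
    and fg: "(f, g) \<in> spans (Set_cat U) (S \<boxtimes> A) (S \<boxtimes> B)"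
    using M_Hom_eq[of "S \<boxtimes> A" "S \<boxtimes> B"] assms by auto
  let ?k = "Set.mk f g"
  \<comment> \<open>Undoes \<open>flat\<close> up to isomorphism: each label in
    \<open>S \<boxtimes> A\<close> or \<open>S \<boxtimes> B\<close> is split into an end point and
    a proper label.\<close>
  define m where "m = \<lparr>nodes = S, arcs = arcs ?k, tail = fs \<circ> lin ?k, head = fs \<circ> lout ?k,
    lin = sn \<circ> lin ?k, lout = sn \<circ> lout ?k\<rparr>"
  have k: "lgraph_on (S \<boxtimes> A) (S \<boxtimes> B) ?k" by (rule Set.mk_on[OF fg])
  then have lin: "lin ?k e \<in> S \<boxtimes> A" "lout ?k e \<in> S \<boxtimes> B" if "e \<in> arcs ?k" for e
    using that by (auto simp: lgraph_on_def)
  have "Dom (Set_cat U) f \<in> U" using fg by (auto simp: spans_def Hom_Set)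
  then have "arcs ?k \<in> U" by (simp add: Set.mk_def)
  moreover have "fs (lin ?k e) \<in> S \<and> sn (lin ?k e) \<in> A \<and> fs (lout ?k e) \<in> S \<and> sn (lout ?k e) \<in> B"
    if "e \<in> arcs ?k" for e using lin[OF that] by (auto elim!: times_cases)
  ultimately have "small A B m"
    using assms x(2) by (auto simp: small_def m_def lgraph_on_def wf_lgraph_def)
  moreover have "pair (fs (lin ?k e)) (sn (lin ?k e)) = lin ?k e"
    "pair (fs (lout ?k e)) (sn (lout ?k e)) = lout ?k e"
    if "e \<in> arcs ?k" for e using lin[OF that] by (auto elim!: times_cases)
  then have "?k \<simeq> flat m"
    using lgraph_on_wf[OF k] by (intro lgraph_iso_cong) (simp_all add: flat_def m_def Set.mk_def)
  then have "process A B m = x"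
    unfolding x F by (simp add: process_def m_def Set.cls_cong)
  ultimately show "x \<in> {process A B m | m. small A B m}" by blast
qed

text \<open>By \<open>lg_iso_bij\<close> both legs of an invertible span are bijective. Identifying
  arcs with their input labels turns the span into the function that leads from input to output
  labels.\<close>

lemma Isos_M:
  assumes U: "S \<in> U" "T \<in> U" and h: "h \<in> Isos M S T"
  shows "\<exists>\<phi>. bij_betw \<phi> S T \<and> h = Set.fn S T \<phi>"
proof -
  obtain k where k: "h \<in> Hom M S T" "k \<in> Hom M T S" "h \<Zcomp>\<^bsub>M\<^esub> k = Id M S" "k \<Zcomp>\<^bsub>M\<^esub> h = Id M T"
    using h by (auto simp: Isos_def)
  obtain f g where p: "h = Set.cls S T (Set.mk f g)" "(f, g) \<in> spans (Set_cat U) S T"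
    using k(1) M_Hom_eq[OF U] by auto
  obtain f' g' where q: "k = Set.cls T S (Set.mk f' g')" "(f', g') \<in> spans (Set_cat U) T S"
    using k(2) M_Hom_eq[OF U(2,1)] by auto
  let ?p = "Set.mk f g" and ?q = "Set.mk f' g'"
  note rp = Set.rep_mk[OF U p(2)] and rq = Set.rep_mk[OF U(2,1) q(2)]
  have "lg_comp ?p ?q \<simeq> lg_fun S (\<lambda>x. x)" "lg_comp ?q ?p \<simeq> lg_fun T (\<lambda>x. x)"
    using k(3,4) unfolding p q M_Comp[OF rp rq] M_Comp[OF rq rp] M_Id[OF U(1)] M_Id[OF U(2)] Set.fn_def
      Set.cls_eq_iff[OF Set.rep_Comp[OF rp rq]] Set.cls_eq_iff[OF Set.rep_Comp[OF rq rp]] by auto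
  note bij = lg_iso_bij[OF Set.rep_on[OF rp] Set.rep_on[OF rq] this]
  let ?i = "inv_into (arcs ?p) (lin ?p)"
  have "bij_betw (lout ?p \<circ> ?i) S T" using bij_betw_trans[OF bij_betw_inv_into[OF bij(1)] bij(2)] .
  moreover have "?p \<simeq> lg_fun S (lout ?p \<circ> ?i)"
    using lgraph_on_wf[OF Set.rep_on[OF rp]] bij
    by (intro lgraph_isoI[where \<phi> = "\<lambda>_. ()" and \<psi> = "lin ?p"])
      (auto simp: lg_fun_def Set.mk_def bij_betw_inv_into_left bij_betw_def[of "\<lambda>_. ()"])
  ultimately show ?thesis unfolding p Set.fn_def using Set.cls_cong by blast
qed

text \<open>Conjugation renames states. The left factor is the inverse of \<phi>, but composition on
  the left relabels by the inverse of the function, so \<phi> acts on inputs and outputs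
  alike.\<close>

lemma st_conjugate:
  assumes m: "small A B m" and T: "T \<in> U" and \<phi>: "bij_betw \<phi> (nodes m) T"
  shows "(Inv M (Set.fn (nodes m) T \<phi>) \<otimes>\<^bsub>M\<^esub> Id M A) \<Zcomp>\<^bsub>M\<^esub> Set.cls (nodes m \<boxtimes> A) (nodes m \<boxtimes> B) (flat m)
      \<Zcomp>\<^bsub>M\<^esub> (Set.fn (nodes m) T \<phi> \<otimes>\<^bsub>M\<^esub> Id M B) =
    Set.cls (T \<boxtimes> A) (T \<boxtimes> B) (relabel (cross \<phi> (\<lambda>x. x)) (cross \<phi> (\<lambda>x. x)) (flat m))"
    "Set.rep (T \<boxtimes> A) (T \<boxtimes> B) (relabel (cross \<phi> (\<lambda>x. x)) (cross \<phi> (\<lambda>x. x)) (flat m))"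
proof -
  have U: "A \<in> U" "B \<in> U" "nodes m \<in> U" using m by (auto simp: small_def)
  obtain \<phi>' where \<phi>': "bij_betw \<phi>' T (nodes m)" "\<And>x. x \<in> nodes m \<Longrightarrow> \<phi>' (\<phi> x) = x"
    "\<And>y. y \<in> T \<Longrightarrow> \<phi> (\<phi>' y) = y" using bij_betw_inverse[OF \<phi>] by blast
  have funs: "\<phi> \<in> nodes m \<rightarrow> T" "\<phi>' \<in> T \<rightarrow> nodes m" using \<phi> \<phi>'(1) by (auto simp: bij_betw_def)
  have c: "cross \<phi>' (\<lambda>x. x) \<in> T \<boxtimes> A \<rightarrow> nodes m \<boxtimes> A" "cross \<phi> (\<lambda>x. x) \<in> nodes m \<boxtimes> A \<rightarrow> T \<boxtimes> A"
    "cross \<phi> (\<lambda>x. x) \<in> nodes m \<boxtimes> B \<rightarrow> T \<boxtimes> B"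
    using funs by (auto elim!: times_cases)
  have i: "x \<in> T \<boxtimes> A \<Longrightarrow> cross \<phi> (\<lambda>x. x) (cross \<phi>' (\<lambda>x. x) x) = x"
    "y \<in> nodes m \<boxtimes> A \<Longrightarrow> cross \<phi>' (\<lambda>x. x) (cross \<phi> (\<lambda>x. x) y) = y" for x y
    using \<phi>' by (auto elim!: times_cases)
  have Inv: "Inv M (Set.fn (nodes m) T \<phi>) = Set.fn T (nodes m) \<phi>'"
    using U T funs \<phi>' by (intro M_Inv)
  have t: "Inv M (Set.fn (nodes m) T \<phi>) \<otimes>\<^bsub>M\<^esub> Id M A = Set.fn (T \<boxtimes> A) (nodes m \<boxtimes> A) (cross \<phi>' (\<lambda>x. x))"
    "Set.fn (nodes m) T \<phi> \<otimes>\<^bsub>M\<^esub> Id M B = Set.fn (nodes m \<boxtimes> B) (T \<boxtimes> B) (cross \<phi> (\<lambda>x. x))"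
    unfolding Inv using U T funs by (simp_all add: M_Id M_fn_TenA)
  have r1: "Set.rep (T \<boxtimes> A) (nodes m \<boxtimes> B) (relabel (cross \<phi> (\<lambda>x. x)) (\<lambda>x. x) (flat m))"
    by (rule Set.rep_relabel_in[OF rep_flat[OF m] times_in_U[OF T U(1)] c(1,2)]) (rule i; assumption)+
  have e1: "Set.fn (T \<boxtimes> A) (nodes m \<boxtimes> A) (cross \<phi>' (\<lambda>x. x)) \<Zcomp>\<^bsub>M\<^esub> Set.cls (nodes m \<boxtimes> A) (nodes m \<boxtimes> B) (flat m) =
      Set.cls (T \<boxtimes> A) (nodes m \<boxtimes> B) (relabel (cross \<phi> (\<lambda>x. x)) (\<lambda>x. x) (flat m))"
    by (rule M_fn_Comp_cls[OF rep_flat[OF m] times_in_U[OF T U(1)] c(1,2)]) (rule i; assumption)+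
  have r: "relabel (\<lambda>x. x) (cross \<phi> (\<lambda>x. x)) (relabel (cross \<phi> (\<lambda>x. x)) (\<lambda>x. x) (flat m)) =
      relabel (cross \<phi> (\<lambda>x. x)) (cross \<phi> (\<lambda>x. x)) (flat m)"
    by (simp add: relabel_relabel comp_def)
  show "(Inv M (Set.fn (nodes m) T \<phi>) \<otimes>\<^bsub>M\<^esub> Id M A) \<Zcomp>\<^bsub>M\<^esub> Set.cls (nodes m \<boxtimes> A) (nodes m \<boxtimes> B) (flat m)
      \<Zcomp>\<^bsub>M\<^esub> (Set.fn (nodes m) T \<phi> \<otimes>\<^bsub>M\<^esub> Id M B) =
    Set.cls (T \<boxtimes> A) (T \<boxtimes> B) (relabel (cross \<phi> (\<lambda>x. x)) (cross \<phi> (\<lambda>x. x)) (flat m))"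
    unfolding t e1 M_Comp_fn[OF r1 times_in_U[OF T U(2)] c(3)] r ..
  show "Set.rep (T \<boxtimes> A) (T \<boxtimes> B) (relabel (cross \<phi> (\<lambda>x. x)) (cross \<phi> (\<lambda>x. x)) (flat m))"
    using Set.rep_relabel_out[OF r1 times_in_U[OF T U(2)] c(3)] unfolding r .
qed

text \<open>An isomorphism of labelled graphs splits in two: \<phi> is its part on nodes, and an
  isomorphism of the flattened graphs is its part on arcs. Equality of the paired labels expresses
  compatibility with ends and labels at once.\<close>

lemma flat_iso_iff:
  assumes m: "wf_lgraph m" and n: "wf_lgraph n"
  shows "(\<exists>\<phi>. bij_betw \<phi> (nodes m) (nodes n) \<and>
      flat n \<simeq> relabel (cross \<phi> (\<lambda>x. x)) (cross \<phi> (\<lambda>x. x)) (flat m)) \<longleftrightarrow> m \<simeq> n"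
proof
  assume "\<exists>\<phi>. bij_betw \<phi> (nodes m) (nodes n) \<and>
      flat n \<simeq> relabel (cross \<phi> (\<lambda>x. x)) (cross \<phi> (\<lambda>x. x)) (flat m)"
  then obtain \<phi> where \<phi>: "bij_betw \<phi> (nodes m) (nodes n)"
    and iso: "flat n \<simeq> relabel (cross \<phi> (\<lambda>x. x)) (cross \<phi> (\<lambda>x. x)) (flat m)" by blast
  obtain \<psi> where "bij_betw \<psi> (arcs m) (arcs n)"
    "\<forall>e \<in> arcs m. pair (tail n (\<psi> e)) (lin n (\<psi> e)) = pair (\<phi> (tail m e)) (lin m e) \<and>
      pair (head n (\<psi> e)) (lout n (\<psi> e)) = pair (\<phi> (head m e)) (lout m e)"
    using lgraph_iso_sym[OF iso] by (auto simp: lgraph_iso_def flat_def relabel_def)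
  then show "m \<simeq> n" using \<phi> m by (intro lgraph_isoI[of m \<phi> n \<psi>]) auto
next
  assume "m \<simeq> n"
  then obtain \<phi> \<psi> where *: "bij_betw \<phi> (nodes m) (nodes n)" "bij_betw \<psi> (arcs m) (arcs n)"
    "\<forall>e \<in> arcs m. tail n (\<psi> e) = \<phi> (tail m e) \<and> head n (\<psi> e) = \<phi> (head m e) \<and>
        lin n (\<psi> e) = lin m e \<and> lout n (\<psi> e) = lout m e"
    unfolding lgraph_iso_def by blast
  then have "relabel (cross \<phi> (\<lambda>x. x)) (cross \<phi> (\<lambda>x. x)) (flat m) \<simeq> flat n"
    by (intro lgraph_isoI[where \<phi> = "\<lambda>_. ()" and \<psi> = \<psi>])
      (auto simp: flat_def relabel_def wf_lgraph_def bij_betw_def[of "\<lambda>_. ()"])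
  then show "\<exists>\<phi>. bij_betw \<phi> (nodes m) (nodes n) \<and>
      flat n \<simeq> relabel (cross \<phi> (\<lambda>x. x)) (cross \<phi> (\<lambda>x. x)) (flat m)"
    using * lgraph_iso_sym by blast
qed

text \<open>The isomorphism of state spaces in \<open>st_rel\<close> supplies the bijection of
  nodes, and the required equality of spans supplies the bijection of arcs.\<close>

lemma st_rel_iff:
  assumes m: "small A B m" and n: "small A B n"
  shows "(process A B m, process A B n) \<in> st_rel M A B \<longleftrightarrow> m \<simeq> n"
proof -
  have U: "A \<in> U" "B \<in> U" "nodes m \<in> U" "nodes n \<in> U" using m n by (auto simp: small_def)
  let ?F = "Set.cls (nodes m \<boxtimes> A) (nodes m \<boxtimes> B) (flat m)" and ?G = "Set.cls (nodes n \<boxtimes> A) (nodes n \<boxtimes> B) (flat n)"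
  have "process A B m \<in> st_pairs M A B" "process A B n \<in> st_pairs M A B"
    using m n unfolding st_pairs_eq[OF U(1,2)] by blast+
  then have "(process A B m, process A B n) \<in> st_rel M A B \<longleftrightarrow>
      (\<exists>h \<in> Isos M (nodes m) (nodes n). ?G = (Inv M h \<otimes>\<^bsub>M\<^esub> Id M A) \<Zcomp>\<^bsub>M\<^esub> ?F \<Zcomp>\<^bsub>M\<^esub> (h \<otimes>\<^bsub>M\<^esub> Id M B))"
    by (simp add: st_rel_def process_def)
  also have "\<dots> \<longleftrightarrow> (\<exists>\<phi>. bij_betw \<phi> (nodes m) (nodes n) \<and> ?G = (Inv M (Set.fn (nodes m) (nodes n) \<phi>) \<otimes>\<^bsub>M\<^esub> Id M A)
      \<Zcomp>\<^bsub>M\<^esub> ?F \<Zcomp>\<^bsub>M\<^esub> (Set.fn (nodes m) (nodes n) \<phi> \<otimes>\<^bsub>M\<^esub> Id M B))"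
  proof -
    have "Set.fn (nodes m) (nodes n) \<phi> \<in> Isos M (nodes m) (nodes n)" if \<phi>: "bij_betw \<phi> (nodes m) (nodes n)" for \<phi>
    proof -
      obtain \<phi>' where "bij_betw \<phi>' (nodes n) (nodes m)" "\<And>x. x \<in> nodes m \<Longrightarrow> \<phi>' (\<phi> x) = x"
        "\<And>y. y \<in> nodes n \<Longrightarrow> \<phi> (\<phi>' y) = y" using bij_betw_inverse[OF \<phi>] by blast
      then show ?thesis using U \<phi> by (intro M_Isos[of _ _ \<phi> \<phi>']) (auto simp: bij_betw_def)
    qed
    then show ?thesis using Isos_M[OF U(3,4)] by blast
  qed
  also have "\<dots> \<longleftrightarrow> (\<exists>\<phi>. bij_betw \<phi> (nodes m) (nodes n) \<and>
      flat n \<simeq> relabel (cross \<phi> (\<lambda>x. x)) (cross \<phi> (\<lambda>x. x)) (flat m))"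
    using st_conjugate[OF m U(4)] Set.cls_eq_iff[OF rep_flat[OF n]] by (intro ex_cong1 conj_cong) simp_all
  also have "\<dots> \<longleftrightarrow> m \<simeq> n" by (rule flat_iso_iff[OF small_wf[OF m] small_wf[OF n]])
  finally show ?thesis .
qed

lemma st_class:
  assumes m: "small A B m" shows "(A, B, st_rel M A B `` {process A B m}) = process_class A B m"
proof -
  have U: "A \<in> U" "B \<in> U" using m by (auto simp: small_def)
  have "x \<in> st_rel M A B `` {process A B m} \<longleftrightarrow> (\<exists>n. x = process A B n \<and> small A B n \<and> n \<simeq> m)" for x
  proof
    assume x: "x \<in> st_rel M A B `` {process A B m}"
    then have "x \<in> st_pairs M A B" by (auto simp: st_rel_def)
    then obtain n where n: "x = process A B n" "small A B n" unfolding st_pairs_eq[OF U] by blast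
    with x have "m \<simeq> n" using st_rel_iff[OF m n(2)] by simp
    then show "\<exists>n. x = process A B n \<and> small A B n \<and> n \<simeq> m" using n lgraph_iso_sym by blast
  next
    assume "\<exists>n. x = process A B n \<and> small A B n \<and> n \<simeq> m"
    then show "x \<in> st_rel M A B `` {process A B m}" using st_rel_iff[OF m] lgraph_iso_sym by blast
  qed
  then have "st_rel M A B `` {process A B m} = {process A B n | n. small A B n \<and> n \<simeq> m}" by blast
  then show ?thesis by (simp add: process_class_def)
qed

lemma process_class_cong:
  assumes "m \<simeq> n" shows "process_class A B m = process_class A B n"
proof -
  have "m' \<simeq> m \<longleftrightarrow> m' \<simeq> n" for m' :: "('u, 'u, 'u) lgraph"
    using lgraph_iso_trans[OF _ assms, of m'] lgraph_iso_trans[OF _ lgraph_iso_sym[OF assms], of m'] by blast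
  then show ?thesis by (simp add: process_class_def)
qed

text \<open>Brings a graph formed on product types back to \<open>'u\<close>. End points are decoded
  by the projections before the original maps are applied.\<close>

definition encode :: "('u \<times> 'u, 'u \<times> 'u, 'u) lgraph \<Rightarrow> ('u, 'u, 'u) lgraph" where
  "encode m = \<lparr>nodes = case_prod pair ` nodes m, arcs = case_prod pair ` arcs m,
     tail = (\<lambda>z. case_prod pair (tail m (fs z, sn z))), head = (\<lambda>z. case_prod pair (head m (fs z, sn z))),
     lin = (\<lambda>z. lin m (fs z, sn z)), lout = (\<lambda>z. lout m (fs z, sn z))\<rparr>"

lemma encode_iso: "wf_lgraph m \<Longrightarrow> m \<simeq> encode m"
  by (intro lgraph_isoI[where \<phi> = "case_prod pair" and \<psi> = "case_prod pair"])
    (auto simp: encode_def bij_betw_def inj_on_def)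

text \<open>The nodes form a full product, but composition keeps only the composable pairs of arcs.
  Asking for a mere inclusion of arcs lets one lemma serve \<open>lg_comp\<close> and
  \<open>lg_ten\<close>; \<open>subset_closed\<close> does the rest.\<close>

lemma small_encode:
  assumes "small A B m" "small A' B' n" "D \<in> U" "E \<in> U" "lgraph_on D E k" "nodes k = nodes m \<times> nodes n"
    "arcs k \<subseteq> arcs m \<times> arcs n"
  shows "small D E (encode k)"
proof -
  have "nodes (encode k) = nodes m \<boxtimes> nodes n" using assms(6) by (auto simp: encode_def set_prod_def)
  moreover have "arcs (encode k) \<subseteq> arcs m \<boxtimes> arcs n" using assms(7) by (auto simp: encode_def)
  moreover have "lgraph_on D E (encode k)" using lgraph_on_iso[OF encode_iso assms(5)] lgraph_on_wf[OF assms(5)] by blast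
  ultimately show ?thesis
    using assms subset_closed[of "arcs m \<boxtimes> arcs n" "arcs (encode k)"] by (auto simp: small_def)
qed

section \<open>Composite and tensor of representatives\<close>

lemma M_Inv_assoc_fn:
  assumes "A \<in> U" "B \<in> U" "D \<in> U"
  shows "Inv M (Set.fn ((A \<boxtimes> B) \<boxtimes> D) (A \<boxtimes> B \<boxtimes> D) assoc_fn) =
    Set.fn (A \<boxtimes> B \<boxtimes> D) ((A \<boxtimes> B) \<boxtimes> D) unassoc_fn"
  using assms by (intro M_Inv) (auto elim!: times_cases)

lemma M_Inv_Assoc:
  assumes "A \<in> U" "B \<in> U" "D \<in> U"
  shows "Inv M (\<alpha>\<^bsub>M\<^esub> A B D) = Set.fn (A \<boxtimes> B \<boxtimes> D) ((A \<boxtimes> B) \<boxtimes> D) unassoc_fn"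
  unfolding M_Assoc[OF assms] by (rule M_Inv_assoc_fn[OF assms])

text \<open>While \<open>f\<close> acts, the state of the second process is carried along unchanged,
  and while \<open>g\<close> acts, that of the first. The structural arrows before \<open>f\<close>
  are absorbed into input labels, all others into output labels, so a single genuine composition of
  two graphs remains.\<close>

lemma st_Comp_representative:
  assumes m: "small A B m" and n: "small B D n"
  defines "S \<equiv> nodes m" and "T \<equiv> nodes n"
  shows "(\<sigma>\<^bsub>M\<^esub> S T \<otimes>\<^bsub>M\<^esub> Id M A) \<Zcomp>\<^bsub>M\<^esub> \<alpha>\<^bsub>M\<^esub> T S A \<Zcomp>\<^bsub>M\<^esub> (Id M T \<otimes>\<^bsub>M\<^esub> Set.cls (S \<boxtimes> A) (S \<boxtimes> B) (flat m)) \<Zcomp>\<^bsub>M\<^esub>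
      Inv M (\<alpha>\<^bsub>M\<^esub> T S B) \<Zcomp>\<^bsub>M\<^esub> (\<sigma>\<^bsub>M\<^esub> T S \<otimes>\<^bsub>M\<^esub> Id M B) \<Zcomp>\<^bsub>M\<^esub> \<alpha>\<^bsub>M\<^esub> S T B \<Zcomp>\<^bsub>M\<^esub>
      (Id M S \<otimes>\<^bsub>M\<^esub> Set.cls (T \<boxtimes> B) (T \<boxtimes> D) (flat n)) \<Zcomp>\<^bsub>M\<^esub> Inv M (\<alpha>\<^bsub>M\<^esub> S T D) =
    Set.cls ((S \<boxtimes> T) \<boxtimes> A) ((S \<boxtimes> T) \<boxtimes> D) (flat (encode (lg_comp m n)))"
proof -
  have U: "A \<in> U" "B \<in> U" "D \<in> U" "S \<in> U" "T \<in> U" using m n by (auto simp: small_def S_def T_def)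
  note r_m = rep_flat[OF m, folded S_def] and r_n = rep_flat[OF n, folded T_def]
  have id: "Set.rep S S (lg_fun S (\<lambda>x. x))" "Set.rep T T (lg_fun T (\<lambda>x. x))"
    using U by (auto intro: Set.rep_fun)
  \<comment> \<open>Inverse of the structural function preceding \<open>f\<close>, as needed for
    relabelling inputs.\<close>
  define k where "k z = cross swap_fn (\<lambda>x. x) (unassoc_fn z)" for z
  define F where "F = lg_fun T (\<lambda>x. x) \<otimes>\<^sub>l flat m"
  define G where "G = lg_fun S (\<lambda>x. x) \<otimes>\<^sub>l flat n"
  define F3 where "F3 = relabel k (\<lambda>x. x) F"
  define F4 where "F4 = relabel (\<lambda>x. x) unassoc_fn F3"
  define F5 where "F5 = relabel (\<lambda>x. x) (cross swap_fn (\<lambda>x. x)) F4"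
  define F6 where "F6 = relabel (\<lambda>x. x) assoc_fn F5"
  have rF: "Set.rep (T \<boxtimes> S \<boxtimes> A) (T \<boxtimes> S \<boxtimes> B) F" unfolding F_def by (rule Set.rep_TenA[OF id(2) r_m])
  have rG: "Set.rep (S \<boxtimes> T \<boxtimes> B) (S \<boxtimes> T \<boxtimes> D) G" unfolding G_def by (rule Set.rep_TenA[OF id(1) r_n])
  have FG: "Id M T \<otimes>\<^bsub>M\<^esub> Set.cls (S \<boxtimes> A) (S \<boxtimes> B) (flat m) = Set.cls (T \<boxtimes> S \<boxtimes> A) (T \<boxtimes> S \<boxtimes> B) F"
    "Id M S \<otimes>\<^bsub>M\<^esub> Set.cls (T \<boxtimes> B) (T \<boxtimes> D) (flat n) = Set.cls (S \<boxtimes> T \<boxtimes> B) (S \<boxtimes> T \<boxtimes> D) G"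
    unfolding F_def G_def M_Id[OF U(4)] M_Id[OF U(5)] Set.fn_def
    by (rule M_TenA[OF id(2) r_m] M_TenA[OF id(1) r_n])+
  have 2: "(\<sigma>\<^bsub>M\<^esub> S T \<otimes>\<^bsub>M\<^esub> Id M A) \<Zcomp>\<^bsub>M\<^esub> \<alpha>\<^bsub>M\<^esub> T S A =
      Set.fn ((S \<boxtimes> T) \<boxtimes> A) (T \<boxtimes> S \<boxtimes> A) (\<lambda>z. assoc_fn (cross swap_fn (\<lambda>x. x) z))"
    using U by (simp add: M_Sym M_Id M_Assoc M_fn_TenA M_fn_Comp Pi_iff)
  have swap: "\<sigma>\<^bsub>M\<^esub> T S \<otimes>\<^bsub>M\<^esub> Id M B = Set.fn ((T \<boxtimes> S) \<boxtimes> B) ((S \<boxtimes> T) \<boxtimes> B) (cross swap_fn (\<lambda>x. x))"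
    using U by (simp add: M_Sym M_Id M_fn_TenA Pi_iff)
  have 3: "Set.fn ((S \<boxtimes> T) \<boxtimes> A) (T \<boxtimes> S \<boxtimes> A) (\<lambda>z. assoc_fn (cross swap_fn (\<lambda>x. x) z)) \<Zcomp>\<^bsub>M\<^esub>
      Set.cls (T \<boxtimes> S \<boxtimes> A) (T \<boxtimes> S \<boxtimes> B) F = Set.cls ((S \<boxtimes> T) \<boxtimes> A) (T \<boxtimes> S \<boxtimes> B) F3"
    unfolding F3_def by (rule M_fn_Comp_cls[OF rF]) (use U in \<open>auto simp: k_def elim!: times_cases\<close>)
  have r3: "Set.rep ((S \<boxtimes> T) \<boxtimes> A) (T \<boxtimes> S \<boxtimes> B) F3"
    unfolding F3_def
    by (rule Set.rep_relabel_in[OF rF, where h = "\<lambda>z. assoc_fn (cross swap_fn (\<lambda>x. x) z)"])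
      (use U in \<open>auto simp: k_def elim!: times_cases\<close>)
  have f: "unassoc_fn \<in> T \<boxtimes> S \<boxtimes> B \<rightarrow> (T \<boxtimes> S) \<boxtimes> B" "cross swap_fn (\<lambda>x. x) \<in> (T \<boxtimes> S) \<boxtimes> B \<rightarrow> (S \<boxtimes> T) \<boxtimes> B"
    "assoc_fn \<in> (S \<boxtimes> T) \<boxtimes> B \<rightarrow> S \<boxtimes> T \<boxtimes> B" "unassoc_fn \<in> S \<boxtimes> T \<boxtimes> D \<rightarrow> (S \<boxtimes> T) \<boxtimes> D"
    by (auto elim!: times_cases)
  have V: "(T \<boxtimes> S) \<boxtimes> B \<in> U" "(S \<boxtimes> T) \<boxtimes> B \<in> U" "S \<boxtimes> T \<boxtimes> B \<in> U" "(S \<boxtimes> T) \<boxtimes> D \<in> U" using U by auto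
  note r4 = Set.rep_relabel_out[OF r3 V(1) f(1), folded F4_def]
  note r5 = Set.rep_relabel_out[OF r4 V(2) f(2), folded F5_def]
  note r6 = Set.rep_relabel_out[OF r5 V(3) f(3), folded F6_def]
  note r7 = Set.rep_Comp[OF r6 rG]
  note 4 = M_Comp_fn[OF r3 V(1) f(1), folded F4_def]
  note 5 = M_Comp_fn[OF r4 V(2) f(2), folded F5_def]
  note 6 = M_Comp_fn[OF r5 V(3) f(3), folded F6_def]
  note 7 = M_Comp[OF r6 rG]
  note 8 = M_Comp_fn[OF r7 V(4) f(4)]
  have wf: "wf_lgraph m" "wf_lgraph n" using m n by (auto dest: small_wf)
  let ?L = "relabel (\<lambda>x. x) unassoc_fn (lg_comp F6 G)"
  have "?L \<simeq> flat (encode (lg_comp m n))"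
  proof (rule lgraph_isoI[where \<phi> = "\<lambda>_. ()" and \<psi> = "\<lambda>((t, e), (s, e')). pair e e'"])
    show "wf_lgraph ?L" by (rule Set.rep_wf[OF Set.rep_relabel_out[OF r7 V(4) f(4)]])
    show "bij_betw (\<lambda>_. ()) (nodes ?L) (nodes (flat (encode (lg_comp m n))))"
      by (auto simp: lg_defs flat_def encode_def F6_def F5_def F4_def F3_def F_def G_def bij_betw_def inj_on_def)
    \<comment> \<open>An arc consists of \<open>e\<close> with an idle state \<open>t\<close> and
      \<open>e'\<close> with an idle state \<open>s\<close>. Composability forces \<open>t\<close>
      to be the state in which \<open>e'\<close> starts and \<open>s\<close> the one in which
      \<open>e\<close> ends, so only the composable pair \<open>(e, e')\<close> is free.\<close>
    have arcs: "arcs ?L = {((t, e), (s, e')). e \<in> arcs m \<and> e' \<in> arcs n \<and> lout m e = lin n e' \<and>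
        t = tail n e' \<and> s = head m e}"
      using wf by (auto simp: lg_defs flat_def F6_def F5_def F4_def F3_def F_def G_def S_def T_def wf_lgraph_def)
    show "bij_betw (\<lambda>((t, e), (s, e')). pair e e') (arcs ?L) (arcs (flat (encode (lg_comp m n))))"
      unfolding arcs
      by (rule bij_betwI[where g = "\<lambda>z. ((tail n (sn z), fs z), (head m (fs z), sn z))"])
        (auto simp: flat_def encode_def lg_comp_def)
    fix x assume "x \<in> arcs ?L"
    then obtain e e' where x: "x = ((tail n e', e), (head m e, e'))" and "lout m e = lin n e'"
      unfolding arcs by auto
    then show "lin (flat (encode (lg_comp m n))) ((\<lambda>((t, e), (s, e')). pair e e') x) = lin ?L x"
      "lout (flat (encode (lg_comp m n))) ((\<lambda>((t, e), (s, e')). pair e e') x) = lout ?L x"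
      by (simp_all add: lg_defs flat_def encode_def F6_def F5_def F4_def F3_def F_def G_def k_def)
  qed (auto simp: flat_def)
  then show ?thesis
    unfolding FG 2 3 M_Inv_Assoc[OF U(5,4,2)] 4 swap 5 M_Assoc[OF U(4,5,2)] 6 7 M_Inv_Assoc[OF U(4,5,3)] 8
    by (rule Set.cls_cong)
qed

lemma mid_swap_M:
  assumes U: "P \<in> U" "Q \<in> U" "R \<in> U" "W \<in> U"
  shows "mid_swap M P Q R W = Set.fn ((P \<boxtimes> Q) \<boxtimes> R \<boxtimes> W) ((P \<boxtimes> R) \<boxtimes> Q \<boxtimes> W)
    (\<lambda>z. pair (pair (fs (fs z)) (fs (sn z))) (pair (sn (fs z)) (sn (sn z))))"
  unfolding mid_swap_def
  using U by (simp add: M_Inv_assoc_fn M_Assoc M_Sym M_Id M_fn_TenA M_fn_Comp Pi_iff)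
    (auto intro!: Set.fn_cong elim!: times_cases)

text \<open>The interchange regroups two pairs of state and label into a pair of states and a pair
  of labels, which is how \<open>flat\<close> labels the arcs of the tensor of two graphs.\<close>

lemma st_TenA_representative:
  assumes m: "small A B m" and n: "small A' B' n"
  defines "S \<equiv> nodes m" and "T \<equiv> nodes n"
  shows "mid_swap M S T A A' \<Zcomp>\<^bsub>M\<^esub> (Set.cls (S \<boxtimes> A) (S \<boxtimes> B) (flat m) \<otimes>\<^bsub>M\<^esub> Set.cls (T \<boxtimes> A') (T \<boxtimes> B') (flat n)) \<Zcomp>\<^bsub>M\<^esub>
      mid_swap M S B T B' =
    Set.cls ((S \<boxtimes> T) \<boxtimes> A \<boxtimes> A') ((S \<boxtimes> T) \<boxtimes> B \<boxtimes> B') (flat (encode (m \<otimes>\<^sub>l n)))"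
proof -
  have U: "A \<in> U" "B \<in> U" "A' \<in> U" "B' \<in> U" "S \<in> U" "T \<in> U" using m n by (auto simp: small_def S_def T_def)
  note r_m = rep_flat[OF m, folded S_def] and r_n = rep_flat[OF n, folded T_def]
  \<comment> \<open>On coded quadruples \<open>k\<close> is its own inverse, so the same function
    relabels inputs and outputs.\<close>
  define k where "k z = pair (pair (fs (fs z)) (fs (sn z))) (pair (sn (fs z)) (sn (sn z)))" for z
  have k [simp]: "k (pair (pair a b) (pair c d)) = pair (pair a c) (pair b d)" for a b c d
    by (simp add: k_def)
  define F where "F = flat m \<otimes>\<^sub>l flat n"
  note rF = Set.rep_TenA[OF r_m r_n, folded F_def]
  have V: "(S \<boxtimes> T) \<boxtimes> A \<boxtimes> A' \<in> U" "(S \<boxtimes> T) \<boxtimes> B \<boxtimes> B' \<in> U" using U by auto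
  have 1: "Set.fn ((S \<boxtimes> T) \<boxtimes> A \<boxtimes> A') ((S \<boxtimes> A) \<boxtimes> T \<boxtimes> A') k \<Zcomp>\<^bsub>M\<^esub> Set.cls ((S \<boxtimes> A) \<boxtimes> T \<boxtimes> A') ((S \<boxtimes> B) \<boxtimes> T \<boxtimes> B') F
      = Set.cls ((S \<boxtimes> T) \<boxtimes> A \<boxtimes> A') ((S \<boxtimes> B) \<boxtimes> T \<boxtimes> B') (relabel k (\<lambda>x. x) F)"
    by (rule M_fn_Comp_cls[OF rF V(1)]) (auto elim!: times_cases)
  have r1: "Set.rep ((S \<boxtimes> T) \<boxtimes> A \<boxtimes> A') ((S \<boxtimes> B) \<boxtimes> T \<boxtimes> B') (relabel k (\<lambda>x. x) F)"
    by (rule Set.rep_relabel_in[OF rF V(1), where h = k]) (auto elim!: times_cases)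
  have f: "k \<in> (S \<boxtimes> B) \<boxtimes> T \<boxtimes> B' \<rightarrow> (S \<boxtimes> T) \<boxtimes> B \<boxtimes> B'" by (auto elim!: times_cases)
  have "relabel (\<lambda>x. x) k (relabel k (\<lambda>x. x) F) \<simeq> flat (encode (m \<otimes>\<^sub>l n))"
    by (rule lgraph_isoI[where \<phi> = "\<lambda>_. ()" and \<psi> = "case_prod pair"])
      (auto simp: lg_defs flat_def encode_def F_def wf_lgraph_def bij_betw_def inj_on_def)
  then show ?thesis
    unfolding mid_swap_M[OF U(5,6,1,3)] mid_swap_M[OF U(5,2,6,4)] k_def[symmetric]
      M_TenA[OF r_m r_n, folded F_def] 1 M_Comp_fn[OF r1 V(2) f]
    by (rule Set.cls_cong)
qed

section \<open>Hom-sets and operations of the category of processes\<close>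

abbreviation P where "P \<equiv> St M"

lemma P_simps [simp]:
  "Ob P = U" "Dom P (A, B, X) = A" "Cod P (A, B, X) = B" "Ten P A B = A \<boxtimes> B" "Unit P = {pt}"
  "Assoc P A B D = st_of M (\<alpha>\<^bsub>M\<^esub> A B D)" "LUnit P A = st_of M (\<l>\<^bsub>M\<^esub> A)" "RUnit P A = st_of M (\<r>\<^bsub>M\<^esub> A)"
  "Sym P A B = st_of M (\<sigma>\<^bsub>M\<^esub> A B)"
  by (simp_all add: St_def)

lemma Hom_P:
  assumes "A \<in> U" "B \<in> U" shows "Hom P A B = {process_class A B m | m. small A B m}"
proof -
  have "Hom P A B = {(A, B, X) | X. X \<in> st_pairs M A B // st_rel M A B}"
    using assms by (auto simp: Hom_def St_def)
  also have "\<dots> = {(A, B, st_rel M A B `` {process A B m}) | m. small A B m}"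
    unfolding quotient_def st_pairs_eq[OF assms] by blast
  also have "\<dots> = {process_class A B m | m. small A B m}"
    using st_class by (intro Collect_cong) metis
  finally show ?thesis .
qed

lemma HomE_P:
  assumes "F \<in> Hom P A B"
  obtains m where "A \<in> U" "B \<in> U" "small A B m" "F = process_class A B m"
proof -
  have "A \<in> U" "B \<in> U" using assms by (auto simp: Hom_def St_def)
  then show ?thesis using assms that Hom_P by blast
qed

text \<open>The operations of \<open>St\<close> are unions over all representatives; they collapse
  once each choice is known to give the same class.\<close>

lemma UN_class:
  assumes "\<And>x. x \<in> X \<Longrightarrow> f x = Z" "X \<noteq> {}" shows "(\<Union>x \<in> X. f x) = Z"
  using assms by auto

text \<open>Any choice of representatives \<open>m'\<close>, \<open>n'\<close> produces the class of
  the encoded \<open>lg_comp m' n'\<close>. As \<open>lg_comp\<close> respects isomorphism, this is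
  the same class for every choice.\<close>

lemma process_class_Comp:
  assumes m: "small A B m" and n: "small B D n"
  shows "process_class A B m \<Zcomp>\<^bsub>P\<^esub> process_class B D n = process_class A D (lg_comp m n)"
proof -
  let ?X = "{process A B m' | m'. small A B m' \<and> m' \<simeq> m}" and ?Y = "{process B D n' | n'. small B D n' \<and> n' \<simeq> n}"
  let ?Z = "{process A D k | k. small A D k \<and> k \<simeq> lg_comp m n}"
  have U: "A \<in> U" "B \<in> U" "D \<in> U" using m n by (auto simp: small_def)
  let ?e = "\<lambda>S f T g. st_rel M A D `` {(S \<odot>\<^bsub>M\<^esub> T,
         (\<sigma>\<^bsub>M\<^esub> S T \<otimes>\<^bsub>M\<^esub> Id M A) \<Zcomp>\<^bsub>M\<^esub> \<alpha>\<^bsub>M\<^esub> T S A \<Zcomp>\<^bsub>M\<^esub> (Id M T \<otimes>\<^bsub>M\<^esub> f) \<Zcomp>\<^bsub>M\<^esub> Inv M (\<alpha>\<^bsub>M\<^esub> T S B) \<Zcomp>\<^bsub>M\<^esub>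
         (\<sigma>\<^bsub>M\<^esub> T S \<otimes>\<^bsub>M\<^esub> Id M B) \<Zcomp>\<^bsub>M\<^esub> \<alpha>\<^bsub>M\<^esub> S T B \<Zcomp>\<^bsub>M\<^esub> (Id M S \<otimes>\<^bsub>M\<^esub> g) \<Zcomp>\<^bsub>M\<^esub> Inv M (\<alpha>\<^bsub>M\<^esub> S T D))}"
  have e: "(case x of (S, f) \<Rightarrow> case y of (T, g) \<Rightarrow> ?e S f T g) = ?Z" if x: "x \<in> ?X" and y: "y \<in> ?Y" for x y
  proof -
    obtain m' where m': "x = process A B m'" "small A B m'" "m' \<simeq> m" using x by blast
    obtain n' where n': "y = process B D n'" "small B D n'" "n' \<simeq> n" using y by blast
    let ?k = "encode (lg_comp m' n')"
    have on: "lgraph_on A D (lg_comp m' n')" using m' n' by (intro lgraph_on_comp) (auto simp: small_def)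
    have k: "small A D ?k"
      by (rule small_encode[OF m'(2) n'(2) U(1,3) on]) (auto simp: lg_comp_def)
    have "nodes ?k = nodes m' \<boxtimes> nodes n'" by (auto simp: encode_def lg_comp_def set_prod_def)
    then have "(case x of (S, f) \<Rightarrow> case y of (T, g) \<Rightarrow> ?e S f T g) = st_rel M A D `` {process A D ?k}"
      unfolding m' n' process_def by (simp add: st_Comp_representative[OF m'(2) n'(2)])
    also have "\<dots> = snd (snd (process_class A D ?k))" by (simp add: st_class[OF k, symmetric])
    also have "process_class A D ?k = process_class A D (lg_comp m n)"
      by (rule process_class_cong[OF lgraph_iso_trans[OF lgraph_iso_sym[OF encode_iso[OF lgraph_on_wf[OF on]]] lg_comp_cong[OF m'(3) n'(3)]]])
    finally show ?thesis by (simp add: process_class_def)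
  qed
  have "process A B m \<in> ?X" "process B D n \<in> ?Y" using m n lgraph_iso_refl[OF small_wf] by blast+
  then have ne: "?X \<noteq> {}" "?Y \<noteq> {}" by blast+
  have "(\<Union>x \<in> ?X. \<Union>y \<in> ?Y. case x of (S, f) \<Rightarrow> case y of (T, g) \<Rightarrow> ?e S f T g) = ?Z"
    by (intro UN_class ne e)
  moreover have "process_class A B m \<Zcomp>\<^bsub>P\<^esub> process_class B D n =
      (A, D, \<Union>x \<in> ?X. \<Union>y \<in> ?Y. case x of (S, f) \<Rightarrow> case y of (T, g) \<Rightarrow> ?e S f T g)"
    by (simp add: St_def process_class_def split_beta)
  ultimately show ?thesis by (simp only: process_class_def)
qed

lemma process_class_TenA:
  assumes m: "small A B m" and n: "small A' B' n"
  shows "process_class A B m \<otimes>\<^bsub>P\<^esub> process_class A' B' n = process_class (A \<boxtimes> A') (B \<boxtimes> B') (m \<otimes>\<^sub>l n)"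
proof -
  let ?A = "A \<boxtimes> A'" and ?B = "B \<boxtimes> B'"
  let ?X = "{process A B m' | m'. small A B m' \<and> m' \<simeq> m}" and ?Y = "{process A' B' n' | n'. small A' B' n' \<and> n' \<simeq> n}"
  let ?Z = "{process ?A ?B k | k. small ?A ?B k \<and> k \<simeq> m \<otimes>\<^sub>l n}"
  have U: "?A \<in> U" "?B \<in> U" using m n by (auto simp: small_def)
  let ?e = "\<lambda>S f T g. st_rel M ?A ?B `` {(S \<odot>\<^bsub>M\<^esub> T,
         mid_swap M S T A A' \<Zcomp>\<^bsub>M\<^esub> (f \<otimes>\<^bsub>M\<^esub> g) \<Zcomp>\<^bsub>M\<^esub> mid_swap M S B T B')}"
  have e: "(case x of (S, f) \<Rightarrow> case y of (T, g) \<Rightarrow> ?e S f T g) = ?Z" if x: "x \<in> ?X" and y: "y \<in> ?Y" for x y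
  proof -
    obtain m' where m': "x = process A B m'" "small A B m'" "m' \<simeq> m" using x by blast
    obtain n' where n': "y = process A' B' n'" "small A' B' n'" "n' \<simeq> n" using y by blast
    let ?k = "encode (m' \<otimes>\<^sub>l n')"
    have on: "lgraph_on ?A ?B (m' \<otimes>\<^sub>l n')" using m' n' by (intro lgraph_on_ten) (auto simp: small_def)
    have k: "small ?A ?B ?k"
      by (rule small_encode[OF m'(2) n'(2) U on]) (auto simp: lg_ten_def)
    have "nodes ?k = nodes m' \<boxtimes> nodes n'" by (auto simp: encode_def lg_ten_def set_prod_def)
    then have "(case x of (S, f) \<Rightarrow> case y of (T, g) \<Rightarrow> ?e S f T g) = st_rel M ?A ?B `` {process ?A ?B ?k}"
      unfolding m' n' process_def by (simp add: st_TenA_representative[OF m'(2) n'(2)])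
    also have "\<dots> = snd (snd (process_class ?A ?B ?k))" by (simp add: st_class[OF k, symmetric])
    also have "process_class ?A ?B ?k = process_class ?A ?B (m \<otimes>\<^sub>l n)"
      by (rule process_class_cong[OF lgraph_iso_trans[OF lgraph_iso_sym[OF encode_iso[OF lgraph_on_wf[OF on]]] lg_ten_cong[OF m'(3) n'(3)]]])
    finally show ?thesis by (simp add: process_class_def)
  qed
  have "process A B m \<in> ?X" "process A' B' n \<in> ?Y" using m n lgraph_iso_refl[OF small_wf] by blast+
  then have ne: "?X \<noteq> {}" "?Y \<noteq> {}" by blast+
  have "(\<Union>x \<in> ?X. \<Union>y \<in> ?Y. case x of (S, f) \<Rightarrow> case y of (T, g) \<Rightarrow> ?e S f T g) = ?Z"
    by (intro UN_class ne e)
  moreover have "process_class A B m \<otimes>\<^bsub>P\<^esub> process_class A' B' n =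
      (?A, ?B, \<Union>x \<in> ?X. \<Union>y \<in> ?Y. case x of (S, f) \<Rightarrow> case y of (T, g) \<Rightarrow> ?e S f T g)"
    by (simp add: St_def process_class_def split_beta)
  ultimately show ?thesis by (simp only: process_class_def)
qed

text \<open>A copy of \<open>lg_fun\<close> whose node is the point of the monoidal unit
  \<open>{pt}\<close>, the state space that \<open>st_of\<close> uses.\<close>

definition stateless :: "'u set \<Rightarrow> ('u \<Rightarrow> 'u) \<Rightarrow> ('u, 'u, 'u) lgraph" where
  "stateless A h = \<lparr>nodes = {pt}, arcs = A, tail = (\<lambda>_. pt), head = (\<lambda>_. pt), lin = (\<lambda>x. x), lout = h\<rparr>"

lemma small_stateless: "A \<in> U \<Longrightarrow> B \<in> U \<Longrightarrow> h \<in> A \<rightarrow> B \<Longrightarrow> small A B (stateless A h)"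
  by (auto simp: small_def stateless_def lgraph_on_def wf_lgraph_def pt_closed)

lemma stateless_iso: "stateless A h \<simeq> lg_fun A h"
  by (rule lgraph_isoI[where \<phi> = "\<lambda>_. ()" and \<psi> = "\<lambda>x. x"])
    (auto simp: stateless_def lg_fun_def wf_lgraph_def bij_betw_def)

text \<open>Flattening puts the constant state \<open>pt\<close> in front of every label, which is
  the effect of tensoring with the identity of the unit; \<open>pair pt\<close> identifies
  \<open>A\<close> with \<open>{pt} \<boxtimes> A\<close>.\<close>

lemma st_of_fn:
  assumes "A \<in> U" "B \<in> U" "h \<in> A \<rightarrow> B"
  shows "st_of M (Set.fn A B h) = process_class A B (stateless A h)"
proof -
  have "lg_fun ({pt} \<boxtimes> A) (cross (\<lambda>x. x) h) \<simeq> flat (stateless A h)"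
    by (rule lgraph_isoI[where \<phi> = "\<lambda>_. ()" and \<psi> = sn])
      (auto simp: stateless_def flat_def lg_fun_def wf_lgraph_def bij_betw_def[of "\<lambda>_. ()"]
        elim!: times_cases intro!: bij_betwI[where g = "pair pt"])
  then have "Set.fn ({pt} \<boxtimes> A) ({pt} \<boxtimes> B) (cross (\<lambda>x. x) h) = Set.cls ({pt} \<boxtimes> A) ({pt} \<boxtimes> B) (flat (stateless A h))"
    unfolding Set.fn_def by (rule Set.cls_cong)
  moreover have "Id M {pt} \<otimes>\<^bsub>M\<^esub> Set.fn A B h = Set.fn ({pt} \<boxtimes> A) ({pt} \<boxtimes> B) (cross (\<lambda>x. x) h)"
    using assms by (simp add: M_Id M_fn_TenA pt_closed)
  moreover have "nodes (stateless A h) = {pt}" by (simp add: stateless_def)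
  ultimately have "({pt}, Id M {pt} \<otimes>\<^bsub>M\<^esub> Set.fn A B h) = process A B (stateless A h)"
    by (simp add: process_def)
  then show ?thesis using st_class[OF small_stateless[OF assms]] by (simp add: st_of_def)
qed

lemma Id_P:
  assumes "A \<in> U" shows "Id P A = process_class A A (stateless A (\<lambda>x. x))"
proof -
  \<comment> \<open>\<open>St\<close> defines its identity from the identity of the tensor with the
    unit, \<open>st_of\<close> from a tensor of identities. On coded pairs the two functions
    agree.\<close>
  have "Id P A = st_of M (Set.fn A A (\<lambda>x. x))"
    using assms M_fn_TenA[of "{pt}" "{pt}" A A "\<lambda>x. x" "\<lambda>x. x"]
    by (simp add: St_def st_of_def M_Id pt_closed)
      (auto intro!: arg_cong[where f = "\<lambda>x. st_rel M A A `` {({pt}, x)}"] Set.fn_cong elim!: times_cases)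
  then show ?thesis using assms by (simp add: st_of_fn)
qed

section \<open>The functor from processes to spans of graphs\<close>

definition process_span :: "('u set, ('u set, 'u fn) span_arr) st_arr \<Rightarrow> ('u graph, 'u graph_arr) span_arr" where
  "process_span = (\<lambda>(A, B, X). (single_vertex pt A, single_vertex pt B,
     {(f, g). (f, g) \<in> spans (Graph_cat U) (single_vertex pt A) (single_vertex pt B) \<and>
        process A B (Graph.mk f g) \<in> X}))"

lemma small_mk:
  assumes "A \<in> U" "B \<in> U" "(f, g) \<in> spans (Graph_cat U) (single_vertex pt A) (single_vertex pt B)"
  shows "small A B (Graph.mk f g)"
proof -
  have "Dom (Graph_cat U) f \<in> graphs U" using assms(3) by (auto simp: spans_def Hom_Graph)
  then show ?thesis
    using assms Graph.mk_on[OF assms(3)] by (auto simp: small_def Graph.mk_def graphs_def)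
qed

lemma rep_small:
  assumes "small A B m" shows "Graph.rep A B m"
proof -
  \<comment> \<open>Source and target of an object of \<open>Graph_cat\<close> must be extensional,
    hence the restrictions; on arcs nothing changes.\<close>
  let ?G = "\<lparr>Edges = arcs m, Verts = nodes m, src = restrict (tail m) (arcs m), tgt = restrict (head m) (arcs m)\<rparr>"
  have G: "?G \<in> Ob (Graph_cat U)"
    using assms by (auto simp: small_def graphs_def lgraph_on_def wf_lgraph_def)
  have "Graph.rep A B \<lparr>nodes = Verts ?G, arcs = Edges ?G, tail = src ?G, head = tgt ?G, lin = lin m, lout = lout m\<rparr>"
    using assms by (intro Graph.rep_object[OF G]) (auto simp: small_def lgraph_on_def)
  moreover have "\<lparr>nodes = Verts ?G, arcs = Edges ?G, tail = src ?G, head = tgt ?G, lin = lin m, lout = lout m\<rparr> \<simeq> m"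
    using assms by (intro lgraph_iso_cong) (auto simp: small_def lgraph_on_def wf_lgraph_def)
  ultimately show ?thesis by (rule Graph.rep_cong[rotated])
qed

text \<open>\<open>process_span\<close> tests each span of graphs by its own process, so no
  representative of the class is ever chosen. The test succeeds exactly for the spans whose graph is
  isomorphic to \<open>m\<close>.\<close>

lemma process_span_class:
  assumes "A \<in> U" "B \<in> U" shows "process_span (process_class A B m) = Graph.cls A B m"
proof -
  have "process A B (Graph.mk f g) \<in> {process A B m' | m'. small A B m' \<and> m' \<simeq> m} \<longleftrightarrow> Graph.mk f g \<simeq> m"
    if fg: "(f, g) \<in> spans (Graph_cat U) (single_vertex pt A) (single_vertex pt B)" for f g
  proof
    note sm = small_mk[OF assms fg]
    assume "process A B (Graph.mk f g) \<in> {process A B m' | m'. small A B m' \<and> m' \<simeq> m}"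
    then obtain m' where m': "process A B (Graph.mk f g) = process A B m'" "small A B m'" "m' \<simeq> m" by blast
    \<comment> \<open>Different graphs can have equal processes, since a process remembers its arcs
      only up to isomorphism. Equal processes are related by \<open>st_rel\<close>, so their graphs
      are at least isomorphic.\<close>
    have "Graph.mk f g \<simeq> m'"
      using st_rel_iff[OF sm m'(2)] st_rel_iff[OF sm sm] lgraph_iso_refl[OF small_wf[OF sm]] m'(1) by simp
    then show "Graph.mk f g \<simeq> m" using m'(3) by (rule lgraph_iso_trans)
  qed (use small_mk[OF assms fg] in blast)
  then show ?thesis by (simp add: process_span_def process_class_def Graph.cls_def cong: conj_cong)
qed

lemmas N_Comp = Graph.cls_Comp[unfolded N_eq] and N_TenA = Graph.cls_TenA[unfolded N_eq]
  and N_Hom_eq = Graph.Hom_S[unfolded N_eq] and N_Id = Graph.Id_fn[unfolded N_eq]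
  and N_Sym = Graph.Sym_fn[unfolded N_eq] and N_Assoc = Graph.Assoc_fn[unfolded N_eq]
  and N_LUnit = Graph.LUnit_fn[unfolded N_eq] and N_RUnit = Graph.RUnit_fn[unfolded N_eq]

lemma N_simps: "Ob N = single_vertex pt ` U" "Unit N = single_vertex pt {pt}"
  "Ten N (single_vertex pt A) (single_vertex pt B) = single_vertex pt (A \<boxtimes> B)"
  unfolding N_eq[symmetric] by simp_all

lemma process_class_Hom: "small A B m \<Longrightarrow> process_class A B m \<in> Hom P A B"
  using Hom_P by (auto simp: small_def)

text \<open>Identities and coherence arrows are functions on both sides, so this one lemma shows
  that all of them are preserved.\<close>

lemma process_span_structure:
  assumes "A \<in> U" "B \<in> U" "h \<in> A \<rightarrow> B"
  shows "st_of M (Set.fn A B h) \<in> Hom P A B \<and> process_span (st_of M (Set.fn A B h)) = Graph.fn A B h"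
  using assms process_class_Hom[OF small_stateless[OF assms]]
  by (simp add: st_of_fn process_span_class Graph.fn_def Graph.cls_cong[OF stateless_iso])

text \<open>Both hom-sets are parametrised by isomorphism classes of small graphs:
  \<open>cls_eq_iff\<close> gives injectivity, and \<open>small_mk\<close> turns any span of graphs
  into a process.\<close>

lemma bij_process_span:
  assumes U: "A \<in> U" "B \<in> U"
  shows "bij_betw process_span (Hom P A B) (Hom N (single_vertex pt A) (single_vertex pt B))"
proof -
  have "process_class A B m = process_class A B n" if "small A B m" "process_span (process_class A B m) = process_span (process_class A B n)" for m n
    using that Graph.cls_eq_iff[OF rep_small[OF that(1)], of n] process_class_cong[of m n] by (simp add: process_span_class[OF U])
  then have "inj_on process_span (Hom P A B)" unfolding Hom_P[OF U] inj_on_def by blast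
  moreover have "process_span ` Hom P A B = Hom N (single_vertex pt A) (single_vertex pt B)"
  proof (intro equalityI subsetI)
    fix x assume "x \<in> process_span ` Hom P A B"
    then obtain m where m: "small A B m" "x = process_span (process_class A B m)"
      unfolding Hom_P[OF U] by blast
    then show "x \<in> Hom N (single_vertex pt A) (single_vertex pt B)"
      using Graph.cls_Hom[OF rep_small[OF m(1)], unfolded N_eq] by (simp add: process_span_class[OF U])
  next
    fix x assume "x \<in> Hom N (single_vertex pt A) (single_vertex pt B)"
    then obtain f g where fg: "(f, g) \<in> spans (Graph_cat U) (single_vertex pt A) (single_vertex pt B)"
      "x = Graph.cls A B (Graph.mk f g)" unfolding N_Hom_eq[OF U] by blast
    then have "process_class A B (Graph.mk f g) \<in> Hom P A B" "x = process_span (process_class A B (Graph.mk f g))"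
      using process_class_Hom[OF small_mk[OF U fg(1)]] fg(2) by (simp_all add: process_span_class[OF U])
    then show "x \<in> process_span ` Hom P A B" by blast
  qed
  ultimately show ?thesis by (simp add: bij_betw_def)
qed

theorem isomorphism_St_Span_Graph:
  "symmetric_monoidal_isomorphism P N (single_vertex pt) process_span
    (\<lambda>A B. Id N (single_vertex pt A \<odot>\<^bsub>N\<^esub> single_vertex pt B)) (Id N \<one>\<^bsub>N\<^esub>)"
proof (rule strict_isomorphism_transport)
  show "symmetric_monoidal_category N" using Graph.symmetric_monoidal_S by (simp add: N_eq)
  show "bij_betw (single_vertex pt) (Ob P) (Ob N)"
    unfolding N_simps P_simps by (auto simp: bij_betw_def inj_on_def Graph.ob_inj)
  show "Dom P f \<in> Ob P \<and> Cod P f \<in> Ob P" if "f \<in> Arr P" for f using that by (auto simp: St_def)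
  show "\<one>\<^bsub>P\<^esub> \<in> Ob P" "single_vertex pt \<one>\<^bsub>P\<^esub> = \<one>\<^bsub>N\<^esub>" by (simp_all add: N_simps pt_closed)
  fix A B assume "A \<in> Ob P" "B \<in> Ob P"
  then have U: "A \<in> U" "B \<in> U" by simp_all
  show "bij_betw process_span (Hom P A B) (Hom N (single_vertex pt A) (single_vertex pt B))" by (rule bij_process_span[OF U])
  show "A \<odot>\<^bsub>P\<^esub> B \<in> Ob P \<and> single_vertex pt (A \<odot>\<^bsub>P\<^esub> B) = single_vertex pt A \<odot>\<^bsub>N\<^esub> single_vertex pt B"
    using U by (simp add: N_simps)
  show "Id P A \<in> Hom P A A \<and> process_span (Id P A) = Id N (single_vertex pt A)"
    using process_span_structure[OF U(1) U(1), of "\<lambda>x. x"] U by (simp add: Id_P st_of_fn N_Id)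
  show "\<l>\<^bsub>P\<^esub> A \<in> Hom P (\<one>\<^bsub>P\<^esub> \<odot>\<^bsub>P\<^esub> A) A \<and> process_span (\<l>\<^bsub>P\<^esub> A) = \<l>\<^bsub>N\<^esub> (single_vertex pt A)"
    using process_span_structure[of "{pt} \<boxtimes> A" A sn] U by (simp add: M_LUnit N_LUnit pt_closed Pi_iff)
  show "\<r>\<^bsub>P\<^esub> A \<in> Hom P (A \<odot>\<^bsub>P\<^esub> \<one>\<^bsub>P\<^esub>) A \<and> process_span (\<r>\<^bsub>P\<^esub> A) = \<r>\<^bsub>N\<^esub> (single_vertex pt A)"
    using process_span_structure[of "A \<boxtimes> {pt}" A fs] U by (simp add: M_RUnit N_RUnit pt_closed Pi_iff)
  show "\<sigma>\<^bsub>P\<^esub> A B \<in> Hom P (A \<odot>\<^bsub>P\<^esub> B) (B \<odot>\<^bsub>P\<^esub> A) \<and> process_span (\<sigma>\<^bsub>P\<^esub> A B) = \<sigma>\<^bsub>N\<^esub> (single_vertex pt A) (single_vertex pt B)"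
    using process_span_structure[of "A \<boxtimes> B" "B \<boxtimes> A" swap_fn] U by (simp add: M_Sym N_Sym Pi_iff)
  fix D assume "D \<in> Ob P"
  then show "\<alpha>\<^bsub>P\<^esub> A B D \<in> Hom P ((A \<odot>\<^bsub>P\<^esub> B) \<odot>\<^bsub>P\<^esub> D) (A \<odot>\<^bsub>P\<^esub> (B \<odot>\<^bsub>P\<^esub> D)) \<and>
      process_span (\<alpha>\<^bsub>P\<^esub> A B D) = \<alpha>\<^bsub>N\<^esub> (single_vertex pt A) (single_vertex pt B) (single_vertex pt D)"
    using process_span_structure[of "(A \<boxtimes> B) \<boxtimes> D" "A \<boxtimes> B \<boxtimes> D" assoc_fn] U by (simp add: M_Assoc N_Assoc Pi_iff)
next
  fix f g A B assume "f \<in> Hom P A B"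
  then obtain m where m: "A \<in> U" "B \<in> U" "small A B m" "f = process_class A B m" by (rule HomE_P)
  {
    fix D assume "g \<in> Hom P B D"
    then obtain n where n: "D \<in> U" "small B D n" "g = process_class B D n" by (elim HomE_P)
    \<comment> \<open>\<open>lg_comp m n\<close> lives on product types; its encoding is a small
      graph of the same class and thus witnesses membership in the hom-set.\<close>
    have "f \<Zcomp>\<^bsub>P\<^esub> g = process_class A D (encode (lg_comp m n))"
    proof -
      have "wf_lgraph (lg_comp m n)" using m n by (intro lgraph_on_wf[OF lgraph_on_comp]) (auto simp: small_def)
      then show ?thesis using m n by (simp add: process_class_Comp process_class_cong[OF encode_iso])
    qed
    moreover have "small A D (encode (lg_comp m n))"
      by (rule small_encode[OF m(3) n(2)]) (use m n in \<open>auto simp: lg_comp_def small_def intro: lgraph_on_comp[unfolded lg_comp_def]\<close>)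
    ultimately have "f \<Zcomp>\<^bsub>P\<^esub> g \<in> Hom P A D" using process_class_Hom by simp
    moreover have "process_span (f \<Zcomp>\<^bsub>P\<^esub> g) = process_span f \<Zcomp>\<^bsub>N\<^esub> process_span g"
      using m n by (simp add: process_class_Comp process_span_class N_Comp[OF rep_small rep_small])
    ultimately show "f \<Zcomp>\<^bsub>P\<^esub> g \<in> Hom P A D \<and> process_span (f \<Zcomp>\<^bsub>P\<^esub> g) = process_span f \<Zcomp>\<^bsub>N\<^esub> process_span g" ..
  }
  fix A' B' assume "g \<in> Hom P A' B'"
  then obtain n where n: "A' \<in> U" "B' \<in> U" "small A' B' n" "g = process_class A' B' n" by (elim HomE_P)
  have on: "lgraph_on (A \<boxtimes> A') (B \<boxtimes> B') (m \<otimes>\<^sub>l n)" using m n by (intro lgraph_on_ten) (auto simp: small_def)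
  have "f \<otimes>\<^bsub>P\<^esub> g = process_class (A \<boxtimes> A') (B \<boxtimes> B') (encode (m \<otimes>\<^sub>l n))"
    using m n by (simp add: process_class_TenA process_class_cong[OF encode_iso[OF lgraph_on_wf[OF on]]])
  moreover have "small (A \<boxtimes> A') (B \<boxtimes> B') (encode (m \<otimes>\<^sub>l n))"
    by (rule small_encode[OF m(3) n(3) _ _ on]) (use m n in \<open>auto simp: lg_ten_def\<close>)
  ultimately have "f \<otimes>\<^bsub>P\<^esub> g \<in> Hom P (A \<odot>\<^bsub>P\<^esub> A') (B \<odot>\<^bsub>P\<^esub> B')" using process_class_Hom by simp
  moreover have "process_span (f \<otimes>\<^bsub>P\<^esub> g) = process_span f \<otimes>\<^bsub>N\<^esub> process_span g"
    using m n by (simp add: process_class_TenA process_span_class N_TenA[OF rep_small rep_small])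
  ultimately show "f \<otimes>\<^bsub>P\<^esub> g \<in> Hom P (A \<odot>\<^bsub>P\<^esub> A') (B \<odot>\<^bsub>P\<^esub> B') \<and> process_span (f \<otimes>\<^bsub>P\<^esub> g) = process_span f \<otimes>\<^bsub>N\<^esub> process_span g" ..
qed

end

theorem theorem4p12:
  fixes U :: "'u set set" and pair :: "'u \<Rightarrow> 'u \<Rightarrow> 'u" and pt :: 'u
  assumes "set_universe U pair pt"
  shows "\<exists>Fo Fa \<phi> \<epsilon>. symmetric_monoidal_isomorphism
    (St (Span_Set U pair pt)) (Span_Graph_single U pair pt) Fo Fa \<phi> \<epsilon>"
  using set_universe.isomorphism_St_Span_Graph[OF assms] by blast

end
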